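(* Let $(M,F)$ be a complete (i.e. both forward and backward geodesically complete) connected Finsler space. If the Ricci tensor $Ric_{ij}$ of $F$ is negative-definite and parallel with respect to the Berwald connection or with respect to the Chern connection, then the geodesics of $F$ are reversible: for every geodesic $\gamma:(a,b)\to M$ of $F$, the reverse curve $\bar\gamma(t)=\gamma(a+b-t)$, $t\in(a,b)$, is also a geodesic of $F$.
   Context: $M$ is a smooth connected $n$-dimensional manifold. A Finsler structure on $M$ is a function $F:TM\to[0,\infty)$ that is $C^\infty$ on the slit tangent bundle $TM\setminus\{0\}$, satisfies $F(x,\lambda y)=\lambda F(x,y)$ for all $\lambda>0$, and whose Hessian $g_{ij}=[\tfrac12F^2]_{y^iy^j}$ is positive-definite on $TM\setminus\{0\}$. The spray coefficients are $G^i(x,y)=\frac14 g^{ih}\left(\frac{\partial^2F^2}{\partial y^h\partial x^j}y^j-\frac{\partial F^2}{\partial x^h}\right)$. The Riemann curvature is $$R^i_k=2\frac{\partial G^i}{\partial x^k}-\frac{\partial^2G^i}{\partial y^k\partial x^j}y^j+2G^j\frac{\partial^2G^i}{\partial y^k\partial y^j}-\frac{\partial G^i}{\partial y^j}\frac{\partial G^j}{\partial y^k},$$ and the Ricci tensor is $Ric_{ij}=\left[\tfrac12R^k_k\right]_{y^iy^j}$ (summation convention), a function of $(x,y)\in TM\setminus\{0\}$. Negative-definite means that the matrix $(Ric_{ij}(x,y))$ is negative-definite at every $(x,y)\in TM\setminus\{0\}$. Let $\frac{\delta}{\delta x^j}=\frac{\partial}{\partial x^j}-\frac{\partial G^k}{\partial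 y^j}\frac{\partial}{\partial y^k}$. The Ricci tensor is parallel with respect to a connection with horizontal coefficients $C^r_{lj}$ (and vanishing vertical coefficients) if both its horizontal and vertical covariant derivatives vanish, i.e. $$\frac{\delta Ric_{hl}}{\delta x^j}-Ric_{hr}C^r_{lj}-Ric_{lr}C^r_{hj}=0\quad\text{and}\quad\frac{\partial Ric_{ij}}{\partial y^k}=0 .$$ For the Berwald connection $C^r_{lj}=\frac{\partial^2G^r}{\partial y^l\partial y^j}$; for the Chern connection $C^r_{lj}=\frac12g^{rs}\left(\frac{\delta g_{sj}}{\delta x^l}+\frac{\delta g_{ls}}{\delta x^j}-\frac{\delta g_{lj}}{\delta x^s}\right)$. A geodesic of $F$ is a regular curve that is locally an extremal of the length functional $\int F(c,\dot c)\,dt$ among smooth curves with the same endpoints; equivalently, after an orientation-preserving reparametrization it satisfies $\ddot x^i+2G^i(x,\dot x)=0$. Orientation-preserving reparametrizations of geodesics are geodesics. For the purpose of completeness, geodesics are taken to be the nonconstant (constant-speed) solutions of $\ddot x^i+2G^i(x,\dot x)=0$: $F$ is forward (resp. backward) geodesically complete if every such geodesic on an open interval $(a,b)$ extends to such a geodesic on $(a,\infty)$ (resp. $(-\infty,b)$); $F$ is complete if it is both. *)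

theory Defs
  imports "HOL-Analysis.Analysis"
begin

text \<open>\<open>Ck_on k S f\<close> and \<open>smooth_on S f\<close> are meant for open \<open>S\<close>; on such sets they are the usual
  notions \<open>C\<^sup>k\<close> and \<open>C\<^sup>\<infinity>\<close> (for finite-dimensional domains).\<close>

primrec Ck_on :: "nat \<Rightarrow> 'a::real_normed_vector set \<Rightarrow> ('a \<Rightarrow> 'b::real_normed_vector) \<Rightarrow> bool" where
  "Ck_on 0 S f \<longleftrightarrow> continuous_on S f"
| "Ck_on (Suc k) S f \<longleftrightarrow>
     (\<forall>x\<in>S. f differentiable (at x)) \<and> (\<forall>v. Ck_on k S (\<lambda>x. frechet_derivative f (at x) v))"

definition smooth_on :: "'a::real_normed_vector set \<Rightarrow> ('a \<Rightarrow> 'b::real_normed_vector) \<Rightarrow> bool" where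
  "smooth_on S f \<longleftrightarrow> (\<forall>k. Ck_on k S f)"

text \<open>A chart is a pair \<open>(U, \<phi>)\<close>; the values of \<open>\<phi>\<close> outside \<open>U\<close> are irrelevant.\<close>

type_synonym ('a, 'n) chart = "'a set \<times> ('a \<Rightarrow> (real, 'n) vec)"

abbreviation chart_dom :: "('a, 'n::finite) chart \<Rightarrow> 'a set" where
  "chart_dom \<kappa> \<equiv> fst \<kappa>"

abbreviation chart_map :: "('a, 'n::finite) chart \<Rightarrow> 'a \<Rightarrow> real ^ 'n" where
  "chart_map \<kappa> \<equiv> snd \<kappa>"

definition chart_image :: "('a, 'n::finite) chart \<Rightarrow> (real ^ 'n) set" where
  "chart_image \<kappa> = chart_map \<kappa> ` chart_dom \<kappa>"

definition chart_inv :: "('a, 'n::finite) chart \<Rightarrow> real ^ 'n \<Rightarrow> 'a" where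
  "chart_inv \<kappa> = inv_into (chart_dom \<kappa>) (chart_map \<kappa>)"

definition transition :: "('a, 'n::finite) chart \<Rightarrow> ('a, 'n) chart \<Rightarrow> real ^ 'n \<Rightarrow> real ^ 'n" where
  "transition \<kappa> \<kappa>' = chart_map \<kappa>' \<circ> chart_inv \<kappa>"

definition smooth_manifold :: "'a topology \<Rightarrow> ('a, 'n::finite) chart set \<Rightarrow> bool" where
  "smooth_manifold X \<A> \<longleftrightarrow>
     Hausdorff_space X \<and> second_countable X \<and>
     (\<Union>\<kappa>\<in>\<A>. chart_dom \<kappa>) = topspace X \<and>
     (\<forall>\<kappa>\<in>\<A>. openin X (chart_dom \<kappa>) \<and> open (chart_image \<kappa>) \<and>
        homeomorphic_map (subtopology X (chart_dom \<kappa>)) (top_of_set (chart_image \<kappa>)) (chart_map \<kappa>)) \<and>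
     (\<forall>\<kappa>\<in>\<A>. \<forall>\<kappa>'\<in>\<A>.
        smooth_on (chart_map \<kappa> ` (chart_dom \<kappa> \<inter> chart_dom \<kappa>')) (transition \<kappa> \<kappa>'))"

definition smooth_into ::
    "'a topology \<Rightarrow> ('a, 'n::finite) chart set \<Rightarrow> 'e::real_normed_vector set \<Rightarrow> ('e \<Rightarrow> 'a) \<Rightarrow> bool" where
  "smooth_into X \<A> W f \<longleftrightarrow>
     continuous_map (top_of_set W) X f \<and>
     (\<forall>\<kappa>\<in>\<A>. smooth_on {w \<in> W. f w \<in> chart_dom \<kappa>} (chart_map \<kappa> \<circ> f))"

text \<open>A tangent vector at \<open>p\<close> is the family of its component vectors in the charts around \<open>p\<close>,
  transforming by the differentials of the coordinate changes. The value 0 at all other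
  charts makes this representation unique.\<close>

type_synonym ('a, 'n) tvec = "('a, 'n) chart \<Rightarrow> (real, 'n) vec"

definition tangent_space :: "('a, 'n::finite) chart set \<Rightarrow> 'a \<Rightarrow> ('a, 'n) tvec set" where
  "tangent_space \<A> p =
     {v. (\<forall>\<kappa>\<in>\<A>. \<forall>\<kappa>'\<in>\<A>. p \<in> chart_dom \<kappa> \<and> p \<in> chart_dom \<kappa>' \<longrightarrow>
            v \<kappa>' = frechet_derivative (transition \<kappa> \<kappa>') (at (chart_map \<kappa> p)) (v \<kappa>)) \<and>
         (\<forall>\<kappa>. \<kappa> \<notin> \<A> \<or> p \<notin> chart_dom \<kappa> \<longrightarrow> v \<kappa> = 0)}"

definition tangent_bundle ::
    "'a topology \<Rightarrow> ('a, 'n::finite) chart set \<Rightarrow> ('a \<times> ('a, 'n) tvec) set" where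
  "tangent_bundle X \<A> = (SIGMA p : topspace X. tangent_space \<A> p)"

text \<open>The tangent vector \<open>y\<^sup>i \<partial>/\<partial>x\<^sup>i\<close> at the point with coordinates \<open>x\<close> in the chart \<open>\<kappa>\<close>.\<close>

definition coord_tvec ::
    "('a, 'n::finite) chart set \<Rightarrow> ('a, 'n) chart \<Rightarrow> real ^ 'n \<Rightarrow> real ^ 'n \<Rightarrow> ('a, 'n) tvec" where
  "coord_tvec \<A> \<kappa> x y = (\<lambda>\<kappa>'.
     if \<kappa>' \<in> \<A> \<and> chart_inv \<kappa> x \<in> chart_dom \<kappa>'
     then frechet_derivative (transition \<kappa> \<kappa>') (at x) y else 0)"

definition local_rep ::
    "('a, 'n::finite) chart set \<Rightarrow> ('a \<times> ('a, 'n) tvec \<Rightarrow> real) \<Rightarrow> ('a, 'n) chart \<Rightarrow>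
     real ^ 'n \<Rightarrow> real ^ 'n \<Rightarrow> real" where
  "local_rep \<A> F \<kappa> x y = F (chart_inv \<kappa> x, coord_tvec \<A> \<kappa> x y)"

definition velocity :: "('a, 'n::finite) chart set \<Rightarrow> (real \<Rightarrow> 'a) \<Rightarrow> real \<Rightarrow> ('a, 'n) tvec" where
  "velocity \<A> \<gamma> t = (\<lambda>\<kappa>.
     if \<kappa> \<in> \<A> \<and> \<gamma> t \<in> chart_dom \<kappa> then vector_derivative (chart_map \<kappa> \<circ> \<gamma>) (at t) else 0)"

definition regular_curve ::
    "'a topology \<Rightarrow> ('a, 'n::finite) chart set \<Rightarrow> real set \<Rightarrow> (real \<Rightarrow> 'a) \<Rightarrow> bool" where
  "regular_curve X \<A> I \<gamma> \<longleftrightarrow> smooth_into X \<A> I \<gamma> \<and> (\<forall>t\<in>I. velocity \<A> \<gamma> t \<noteq> (\<lambda>_. 0))"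

text \<open>Functions on (a coordinate domain of) the tangent bundle are written in the induced
  coordinates \<open>(x, y)\<close>; \<open>dx i\<close> and \<open>dy i\<close> are the partial derivatives with respect to \<open>x\<^sup>i\<close>
  and \<open>y\<^sup>i\<close>. Below, \<open>f\<close> is the coordinate
  expression of a Finsler structure.\<close>

type_synonym 'n lfun = "(real, 'n) vec \<Rightarrow> (real, 'n) vec \<Rightarrow> real"

definition dx :: "'n::finite \<Rightarrow> 'n lfun \<Rightarrow> 'n lfun" where
  "dx i f x y = deriv (\<lambda>t. f (x + t *\<^sub>R axis i 1) y) 0"

definition dy :: "'n::finite \<Rightarrow> 'n lfun \<Rightarrow> 'n lfun" where
  "dy i f x y = deriv (\<lambda>t. f x (y + t *\<^sub>R axis i 1)) 0"

definition sq :: "'n::finite lfun \<Rightarrow> 'n lfun" where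
  "sq f x y = (f x y)\<^sup>2"

definition fund_tensor :: "'n::finite lfun \<Rightarrow> 'n \<Rightarrow> 'n \<Rightarrow> 'n lfun" where
  "fund_tensor f i j = dy j (dy i (\<lambda>x y. 1/2 * sq f x y))"

definition fund_inv :: "'n::finite lfun \<Rightarrow> 'n \<Rightarrow> 'n \<Rightarrow> 'n lfun" where
  "fund_inv f i j x y = matrix_inv (\<chi> k l. fund_tensor f k l x y) $ i $ j"

definition spray :: "'n::finite lfun \<Rightarrow> 'n \<Rightarrow> 'n lfun" where
  "spray f i x y =
     1/4 * (\<Sum>h\<in>UNIV. fund_inv f i h x y *
              ((\<Sum>j\<in>UNIV. dy h (dx j (sq f)) x y * y $ j) - dx h (sq f) x y))"

definition riemann_curv :: "'n::finite lfun \<Rightarrow> 'n \<Rightarrow> 'n \<Rightarrow> 'n lfun" where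
  "riemann_curv f i k x y =
     2 * dx k (spray f i) x y
     - (\<Sum>j\<in>UNIV. dy k (dx j (spray f i)) x y * y $ j)
     + 2 * (\<Sum>j\<in>UNIV. spray f j x y * dy k (dy j (spray f i)) x y)
     - (\<Sum>j\<in>UNIV. dy j (spray f i) x y * dy k (spray f j) x y)"

definition ricci :: "'n::finite lfun \<Rightarrow> 'n \<Rightarrow> 'n \<Rightarrow> 'n lfun" where
  "ricci f i j = dy j (dy i (\<lambda>x y. 1/2 * (\<Sum>k\<in>UNIV. riemann_curv f k k x y)))"

definition delta_x :: "'n::finite lfun \<Rightarrow> 'n \<Rightarrow> 'n lfun \<Rightarrow> 'n lfun" where
  "delta_x f j u x y = dx j u x y - (\<Sum>k\<in>UNIV. dy j (spray f k) x y * dy k u x y)"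

text \<open>Horizontal connection coefficients \<open>C\<^sup>r\<^sub>l\<^sub>j\<close>, with arguments in the order \<open>r l j\<close>.\<close>

definition berwald_coeff :: "'n::finite lfun \<Rightarrow> 'n \<Rightarrow> 'n \<Rightarrow> 'n \<Rightarrow> 'n lfun" where
  "berwald_coeff f r l j = dy l (dy j (spray f r))"

definition chern_coeff :: "'n::finite lfun \<Rightarrow> 'n \<Rightarrow> 'n \<Rightarrow> 'n \<Rightarrow> 'n lfun" where
  "chern_coeff f r l j x y =
     1/2 * (\<Sum>s\<in>UNIV. fund_inv f r s x y *
              (delta_x f l (fund_tensor f s j) x y + delta_x f j (fund_tensor f l s) x y
               - delta_x f s (fund_tensor f l j) x y))"

definition positive_definite :: "real ^ 'n ^ 'n::finite \<Rightarrow> bool" where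
  "positive_definite A \<longleftrightarrow> (\<forall>w. w \<noteq> 0 \<longrightarrow> 0 < w \<bullet> (A *v w))"

definition negative_definite :: "real ^ 'n ^ 'n::finite \<Rightarrow> bool" where
  "negative_definite A \<longleftrightarrow> (\<forall>w. w \<noteq> 0 \<longrightarrow> w \<bullet> (A *v w) < 0)"

definition finsler_structure ::
    "'a topology \<Rightarrow> ('a, 'n::finite) chart set \<Rightarrow> ('a \<times> ('a, 'n) tvec \<Rightarrow> real) \<Rightarrow> bool" where
  "finsler_structure X \<A> F \<longleftrightarrow>
     (\<forall>(p, v) \<in> tangent_bundle X \<A>. 0 \<le> F (p, v)) \<and>
     (\<forall>(p, v) \<in> tangent_bundle X \<A>. \<forall>c>0. F (p, \<lambda>\<kappa>. c *\<^sub>R v \<kappa>) = c * F (p, v)) \<and>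
     (\<forall>\<kappa>\<in>\<A>. smooth_on (chart_image \<kappa> \<times> (- {0})) (\<lambda>(x, y). local_rep \<A> F \<kappa> x y)) \<and>
     (\<forall>\<kappa>\<in>\<A>. \<forall>x\<in>chart_image \<kappa>. \<forall>y. y \<noteq> 0 \<longrightarrow>
        positive_definite (\<chi> i j. fund_tensor (local_rep \<A> F \<kappa>) i j x y))"

definition ricci_negative_definite ::
    "('a, 'n::finite) chart set \<Rightarrow> ('a \<times> ('a, 'n) tvec \<Rightarrow> real) \<Rightarrow> bool" where
  "ricci_negative_definite \<A> F \<longleftrightarrow>
     (\<forall>\<kappa>\<in>\<A>. \<forall>x\<in>chart_image \<kappa>. \<forall>y. y \<noteq> 0 \<longrightarrow>
        negative_definite (\<chi> i j. ricci (local_rep \<A> F \<kappa>) i j x y))"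

definition ricci_parallel ::
    "('n lfun \<Rightarrow> 'n \<Rightarrow> 'n \<Rightarrow> 'n \<Rightarrow> 'n lfun) \<Rightarrow>
     ('a, 'n::finite) chart set \<Rightarrow> ('a \<times> ('a, 'n) tvec \<Rightarrow> real) \<Rightarrow> bool" where
  "ricci_parallel C \<A> F \<longleftrightarrow>
     (\<forall>\<kappa>\<in>\<A>. \<forall>x\<in>chart_image \<kappa>. \<forall>y. y \<noteq> 0 \<longrightarrow>
        (let f = local_rep \<A> F \<kappa> in
          (\<forall>h l j. delta_x f j (ricci f h l) x y
                     - (\<Sum>r\<in>UNIV. ricci f h r x y * C f r l j x y)
                     - (\<Sum>r\<in>UNIV. ricci f l r x y * C f r h j x y) = 0) \<and>
          (\<forall>i j k. dy k (ricci f i j) x y = 0)))"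

definition curve_length ::
    "('a, 'n::finite) chart set \<Rightarrow> ('a \<times> ('a, 'n) tvec \<Rightarrow> real) \<Rightarrow>
     real \<Rightarrow> real \<Rightarrow> (real \<Rightarrow> 'a) \<Rightarrow> real" where
  "curve_length \<A> F c d \<gamma> = integral {c..d} (\<lambda>t. F (\<gamma> t, velocity \<A> \<gamma> t))"

text \<open>\<open>\<gamma>\<close> restricted to \<open>[c,d]\<close> is an extremal of the length functional: the first variation of
  length vanishes for every smooth variation \<open>H(s,t)\<close> through curves with the same endpoints.
  Smoothness on the closed interval means smoothness on a neighbourhood of it.\<close>

definition length_extremal ::
    "'a topology \<Rightarrow> ('a, 'n::finite) chart set \<Rightarrow> ('a \<times> ('a, 'n) tvec \<Rightarrow> real) \<Rightarrow>
     real \<Rightarrow> real \<Rightarrow> (real \<Rightarrow> 'a) \<Rightarrow> bool" where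
  "length_extremal X \<A> F c d \<gamma> \<longleftrightarrow>
     (\<forall>H \<epsilon>. \<epsilon> > 0 \<and> smooth_into X \<A> ({-\<epsilon><..<\<epsilon>} \<times> {c - \<epsilon><..<d + \<epsilon>}) H \<and>
        (\<forall>t\<in>{c..d}. H (0, t) = \<gamma> t) \<and>
        (\<forall>s\<in>{-\<epsilon><..<\<epsilon>}. H (s, c) = \<gamma> c \<and> H (s, d) = \<gamma> d) \<longrightarrow>
        ((\<lambda>s. curve_length \<A> F c d (\<lambda>t. H (s, t))) has_real_derivative 0) (at 0))"

definition geodesic ::
    "'a topology \<Rightarrow> ('a, 'n::finite) chart set \<Rightarrow> ('a \<times> ('a, 'n) tvec \<Rightarrow> real) \<Rightarrow>
     real set \<Rightarrow> (real \<Rightarrow> 'a) \<Rightarrow> bool" where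
  "geodesic X \<A> F I \<gamma> \<longleftrightarrow>
     regular_curve X \<A> I \<gamma> \<and>
     (\<forall>t\<in>I. \<exists>e>0. {t - e..t + e} \<subseteq> I \<and>
        (\<forall>c d. t - e \<le> c \<and> c < d \<and> d \<le> t + e \<longrightarrow> length_extremal X \<A> F c d \<gamma>))"

text \<open>Nonconstant solutions of \<open>x'' + 2 G(x, x') = 0\<close>. Such a solution has nowhere vanishing velocity
  by uniqueness of solutions, since \<open>G\<close>, extended by 0, is \<open>C\<^sup>1\<close> along the zero section.\<close>

definition spray_geodesic ::
    "'a topology \<Rightarrow> ('a, 'n::finite) chart set \<Rightarrow> ('a \<times> ('a, 'n) tvec \<Rightarrow> real) \<Rightarrow>
     real set \<Rightarrow> (real \<Rightarrow> 'a) \<Rightarrow> bool" where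
  "spray_geodesic X \<A> F I \<gamma> \<longleftrightarrow>
     regular_curve X \<A> I \<gamma> \<and>
     (\<forall>\<kappa>\<in>\<A>. \<forall>t\<in>I. \<gamma> t \<in> chart_dom \<kappa> \<longrightarrow>
        (let c = chart_map \<kappa> \<circ> \<gamma>; c' = (\<lambda>s. vector_derivative c (at s)) in
          \<forall>i. vector_derivative c' (at t) $ i + 2 * spray (local_rep \<A> F \<kappa>) i (c t) (c' t) = 0))"

definition forward_complete ::
    "'a topology \<Rightarrow> ('a, 'n::finite) chart set \<Rightarrow> ('a \<times> ('a, 'n) tvec \<Rightarrow> real) \<Rightarrow> bool" where
  "forward_complete X \<A> F \<longleftrightarrow>
     (\<forall>a b \<gamma>. a < b \<and> spray_geodesic X \<A> F {a<..<b} \<gamma> \<longrightarrow>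
        (\<exists>\<eta>. spray_geodesic X \<A> F {a<..} \<eta> \<and> (\<forall>t\<in>{a<..<b}. \<eta> t = \<gamma> t)))"

definition backward_complete ::
    "'a topology \<Rightarrow> ('a, 'n::finite) chart set \<Rightarrow> ('a \<times> ('a, 'n) tvec \<Rightarrow> real) \<Rightarrow> bool" where
  "backward_complete X \<A> F \<longleftrightarrow>
     (\<forall>a b \<gamma>. a < b \<and> spray_geodesic X \<A> F {a<..<b} \<gamma> \<longrightarrow>
        (\<exists>\<eta>. spray_geodesic X \<A> F {..<b} \<eta> \<and> (\<forall>t\<in>{a<..<b}. \<eta> t = \<gamma> t)))"

end

theory Submission
  imports Defs
begin

text \<open>The Ricci tensor does not depend on \<open>y\<close>: its vertical derivative vanishes and, in dimension at
  least two, the punctured tangent space is connected. Horizontal parallelism with respect to a symmetric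
  connection therefore lets the Christoffel trick express \<open>Ric\<^sub>h\<^sub>r C\<^sup>r\<^sub>l\<^sub>j\<close> through the \<open>x\<close>-derivatives of
  \<open>Ric\<close>, and nondegeneracy shows that \<open>C\<close> is independent of \<open>y\<close> as well. Since
  \<open>C\<^sup>r\<^sub>l\<^sub>j y\<^sup>l y\<^sup>j = 2 G\<^sup>r\<close> for both the Berwald and the Chern connection, the spray is even:
  \<open>G(x, -y) = G(x, y)\<close>. The Euler-Lagrange equation of length says that \<open>x'' + 2 G(x, x')\<close> is
  proportional to \<open>x'\<close>, and for an even spray this condition is invariant under reversal of the curve.
  In dimension one it is empty.\<close>

subsection \<open>Calculus of smooth maps\<close>

text \<open>Vertical parallelism makes \<open>Ric\<close> constant only along paths of nonzero
  vectors, so comparing \<open>y\<close> with \<open>-y\<close> needs a path around the origin. A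
  line offers none; there the Euler-Lagrange condition is empty because length is invariant under
  reparametrization: the contraction of the equation with the velocity vanishes identically, and the
  velocity has a single, nonzero component. For the same reason the \<open>y\<close>-Hessian of
  \<open>F\<close> annihilates \<open>y\<close>, and the Euler-Lagrange equation of \<open>F\<close>
  cannot determine the acceleration. It is compared with that of \<open>F^2 / 2\<close>, whose
  Hessian \<open>g\<close> is invertible; up to the factor \<open>F\<close> the two differ by
  \<open>g\<close> applied to a multiple of the velocity. Geodesics are defined through variations,
  so the equation must be derived from extremality and also shown to imply it. The obstacle is that
  \<open>F\<close> is required to be smooth only off the zero section and that a variation may leave
  the chart. Compactness of \<open>[c, d]\<close> removes both: for small \<open>s\<close> the
  varied curves stay in the chart with nonzero velocity, and the derivative at \<open>s = 0\<close>
  sees only such \<open>s\<close>.\<close>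

lemma Ck_on_Suc_imp: "Ck_on (Suc k) S f \<Longrightarrow> Ck_on k S f"
proof (induction k arbitrary: f)
  case 0
  then show ?case
    by (auto intro!: continuous_at_imp_continuous_on differentiable_imp_continuous_within)
next
  case (Suc k)
  then show ?case by (metis Ck_on.simps(2))
qed

text \<open>\<open>frechet_derivative f (at x)\<close> sees \<open>f\<close> on a whole
  neighbourhood of \<open>x\<close>, so agreement on \<open>S\<close> passes to derivatives because
  \<open>S\<close> is open.\<close>

lemma Ck_on_cong:
  assumes "open S" "\<And>x. x \<in> S \<Longrightarrow> f x = g x"
  shows "Ck_on k S f \<longleftrightarrow> Ck_on k S g"
proof -
  have "Ck_on k S g" if "Ck_on k S f" "\<And>x. x \<in> S \<Longrightarrow> f x = g x" for f g :: "'a \<Rightarrow> 'b"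
    using that
  proof (induction k arbitrary: f g)
    case 0
    then show ?case by (auto cong: continuous_on_cong)
  next
    case (Suc k)
    have D: "(g has_derivative frechet_derivative f (at x)) (at x)" if "x \<in> S" for x
      using has_derivative_transform_within_open[OF _ \<open>open S\<close> that Suc.prems(2)] Suc.prems(1) that
      by (auto simp: frechet_derivative_works)
    have "frechet_derivative f (at x) = frechet_derivative g (at x)" if "x \<in> S" for x
      using D[OF that] by (rule frechet_derivative_at)
    then show ?case
      using Suc.IH[of "\<lambda>x. frechet_derivative f (at x) v" "\<lambda>x. frechet_derivative g (at x) v" for v]
        Suc.prems(1) D
      by (auto simp: differentiable_def)
  qed
  then show ?thesis using assms by (metis (no_types))
qed

lemma Ck_on_subset: "Ck_on k S f \<Longrightarrow> T \<subseteq> S \<Longrightarrow> Ck_on k T f"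
  by (induction k arbitrary: f) (auto intro: continuous_on_subset)

text \<open>Any derivative \<open>D\<close> found by a calculus rule will do, since uniqueness
  identifies it with the one chosen by \<open>frechet_derivative\<close>. The closure proofs below
  feed their product and chain rules into this.\<close>

lemma Ck_on_SucI:
  assumes "open S" "\<And>x. x \<in> S \<Longrightarrow> (f has_derivative D x) (at x)"
    and "\<And>v. Ck_on k S (\<lambda>x. D x v)"
  shows "Ck_on (Suc k) S f"
proof -
  have "D x = frechet_derivative f (at x)" if "x \<in> S" for x
    using assms(2)[OF that] by (rule frechet_derivative_at)
  then have "Ck_on k S (\<lambda>x. frechet_derivative f (at x) v)" for v
    using Ck_on_cong[OF assms(1), of "\<lambda>x. D x v" "\<lambda>x. frechet_derivative f (at x) v" k] assms(3) by auto
  then show ?thesis using assms(2) by (auto simp: differentiable_def)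
qed

lemma Ck_on_SucD:
  assumes "Ck_on (Suc k) S f" "x \<in> S"
  shows "(f has_derivative frechet_derivative f (at x)) (at x)"
  using assms by (simp add: frechet_derivative_works)

lemma Ck_on_const: "Ck_on k S (\<lambda>x. c)"
  by (induction k arbitrary: c) auto

lemma Ck_on_linear_compose:
  assumes L: "bounded_linear L" and S: "open S"
  shows "Ck_on k S f \<Longrightarrow> Ck_on k S (\<lambda>x. L (f x))"
proof (induction k arbitrary: f)
  case 0
  then show ?case by (auto intro: bounded_linear.continuous_on[OF L])
next
  case (Suc k)
  show ?case
    by (rule Ck_on_SucI[OF S bounded_linear.has_derivative[OF L Ck_on_SucD[OF Suc.prems]]])
      (use Suc in auto)
qed

lemma Ck_on_ident: "open S \<Longrightarrow> Ck_on k S (\<lambda>x. x)"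
  by (cases k) (auto intro!: Ck_on_SucI[where D = "\<lambda>x v. v"] Ck_on_const)

lemma Ck_on_add:
  assumes S: "open S"
  shows "Ck_on k S f \<Longrightarrow> Ck_on k S g \<Longrightarrow> Ck_on k S (\<lambda>x. f x + g x)"
proof (induction k arbitrary: f g)
  case 0
  then show ?case by (auto intro: continuous_on_add)
next
  case (Suc k)
  show ?case
    by (rule Ck_on_SucI[OF S has_derivative_add[OF Ck_on_SucD[OF Suc.prems(1)] Ck_on_SucD[OF Suc.prems(2)]]])
      (use Suc in auto)
qed

lemma Ck_on_bilinear:
  assumes B: "bounded_bilinear B" and S: "open S"
  shows "Ck_on k S f \<Longrightarrow> Ck_on k S g \<Longrightarrow> Ck_on k S (\<lambda>x. B (f x) (g x))"
proof (induction k arbitrary: f g)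
  case 0
  then show ?case by (auto intro: bounded_bilinear.continuous_on[OF B])
next
  case (Suc k)
  have "Ck_on k S f" "Ck_on k S g" using Suc.prems by (auto dest: Ck_on_Suc_imp simp del: Ck_on.simps)
  then show ?case
    by (intro Ck_on_SucI[OF S bounded_bilinear.FDERIV[OF B Ck_on_SucD[OF Suc.prems(1)] Ck_on_SucD[OF Suc.prems(2)]]]
        Ck_on_add S Suc.IH) (use Suc.prems in auto)
qed

lemma Ck_on_sum:
  assumes "open S" "\<And>i. i \<in> I \<Longrightarrow> Ck_on k S (f i)"
  shows "Ck_on k S (\<lambda>x. \<Sum>i\<in>I. f i x)"
  using assms(2)
  by (induction I rule: infinite_finite_induct) (auto intro!: Ck_on_add Ck_on_const assms(1))

text \<open>The chain rule yields the derivative of \<open>f\<close> at \<open>g x\<close> in the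
  direction \<open>frechet_derivative g (at x) v\<close>, which moves with \<open>x\<close>, while
  \<open>Ck_on\<close> speaks of fixed directions. Expanding that direction in \<open>Basis\<close>
  leaves coordinates of the derivative of \<open>g\<close> times derivatives of \<open>f\<close> in
  fixed directions, and the induction hypothesis applies; hence the Euclidean domain of
  \<open>f\<close>.\<close>

lemma Ck_on_compose:
  fixes f :: "'b::euclidean_space \<Rightarrow> 'c::real_normed_vector"
  assumes S: "open S" and T: "open T"
  shows "Ck_on k T f \<Longrightarrow> Ck_on k S g \<Longrightarrow> g ` S \<subseteq> T \<Longrightarrow> Ck_on k S (\<lambda>x. f (g x))"
proof (induction k arbitrary: f g)
  case 0
  then show ?case by (auto intro: continuous_on_compose2)
next
  case (Suc k)
  let ?D = "\<lambda>x v. \<Sum>b\<in>Basis. (frechet_derivative g (at x) v \<bullet> b) *\<^sub>R frechet_derivative f (at (g x)) b"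
  have D: "((\<lambda>x. f (g x)) has_derivative ?D x) (at x)" if x: "x \<in> S" for x
  proof -
    have *: "(f has_derivative frechet_derivative f (at (g x))) (at (g x))"
      using Suc.prems x by (intro Ck_on_SucD) auto
    have chain: "((\<lambda>x. f (g x)) has_derivative
        (\<lambda>v. frechet_derivative f (at (g x)) (frechet_derivative g (at x) v))) (at x)"
      using diff_chain_at[OF Ck_on_SucD[OF Suc.prems(2) x] *] by (simp add: o_def)
    have eq: "frechet_derivative f (at (g x)) w
      = (\<Sum>b\<in>Basis. (w \<bullet> b) *\<^sub>R frechet_derivative f (at (g x)) b)" for w
    proof -
      have "frechet_derivative f (at (g x)) w = frechet_derivative f (at (g x)) (\<Sum>b\<in>Basis. (w \<bullet> b) *\<^sub>R b)"
        by (simp only: euclidean_representation)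
      then show ?thesis
        by (simp only: linear_sum[OF has_derivative_linear[OF *]] linear_scale[OF has_derivative_linear[OF *]])
    qed
    show ?thesis by (rule has_derivative_eq_rhs[OF chain]) (rule ext, rule eq)
  qed
  show ?case
  proof (rule Ck_on_SucI[OF S D])
    fix v
    have "Ck_on k T f" "Ck_on k S g" using Suc.prems by (auto dest: Ck_on_Suc_imp simp del: Ck_on.simps)
    then show "Ck_on k S (\<lambda>x. ?D x v)"
      using Suc.prems(3)
      by (intro Ck_on_sum S Ck_on_bilinear[OF bounded_bilinear_scaleR]
          Ck_on_linear_compose[OF bounded_linear_inner_left] Suc.IH)
        (use Suc.prems in auto)
  qed
qed

lemma Ck_on_inverse:
  fixes f :: "'a::real_normed_vector \<Rightarrow> real"
  assumes S: "open S" and nz: "\<And>x. x \<in> S \<Longrightarrow> f x \<noteq> 0"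
  shows "Ck_on k S f \<Longrightarrow> Ck_on k S (\<lambda>x. inverse (f x))"
proof (induction k)
  case 0
  then show ?case using nz by (auto intro!: continuous_on_inverse)
next
  case (Suc k)
  have D: "((\<lambda>x. inverse (f x)) has_derivative
      (\<lambda>v. - (inverse (f x) * frechet_derivative f (at x) v * inverse (f x)))) (at x)" if "x \<in> S" for x
    using Deriv.has_derivative_inverse[OF nz[OF that] Ck_on_SucD[OF Suc.prems that]] .
  have "Ck_on k S (\<lambda>x. inverse (f x))" by (rule Suc.IH[OF Ck_on_Suc_imp[OF Suc.prems]])
  then show ?case
    by (intro Ck_on_SucI[OF S D] Ck_on_linear_compose[OF bounded_linear_minus[OF bounded_linear_ident] S]
        Ck_on_bilinear[OF bounded_bilinear_mult S]) (use Suc.prems in auto)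
qed

lemma smooth_on_cong:
  "open S \<Longrightarrow> (\<And>x. x \<in> S \<Longrightarrow> f x = g x) \<Longrightarrow> smooth_on S f \<longleftrightarrow> smooth_on S g"
  unfolding smooth_on_def using Ck_on_cong by metis

lemma smooth_on_subset: "smooth_on S f \<Longrightarrow> T \<subseteq> S \<Longrightarrow> smooth_on T f"
  unfolding smooth_on_def using Ck_on_subset by blast

lemma smooth_on_differentiable: "smooth_on S f \<Longrightarrow> x \<in> S \<Longrightarrow> f differentiable (at x)"
  unfolding smooth_on_def by (metis Ck_on.simps(2))

lemma smooth_on_has_derivative:
  "smooth_on S f \<Longrightarrow> x \<in> S \<Longrightarrow> (f has_derivative frechet_derivative f (at x)) (at x)"
  using smooth_on_differentiable frechet_derivative_works by blast

lemma smooth_on_derivative: "smooth_on S f \<Longrightarrow> smooth_on S (\<lambda>x. frechet_derivative f (at x) v)"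
  unfolding smooth_on_def by (metis Ck_on.simps(2))

lemma smooth_on_continuous: "smooth_on S f \<Longrightarrow> continuous_on S f"
  unfolding smooth_on_def by (metis Ck_on.simps(1))

named_theorems smooth_intros

lemma smooth_on_const [smooth_intros]: "smooth_on S (\<lambda>x. c)"
  and smooth_on_ident [smooth_intros]: "open S \<Longrightarrow> smooth_on S (\<lambda>x. x)"
  and smooth_on_add [smooth_intros]:
    "open S \<Longrightarrow> smooth_on S f \<Longrightarrow> smooth_on S g \<Longrightarrow> smooth_on S (\<lambda>x. f x + g x)"
  and smooth_on_linear_compose:
    "bounded_linear L \<Longrightarrow> open S \<Longrightarrow> smooth_on S h \<Longrightarrow> smooth_on S (\<lambda>x. L (h x))"
  and smooth_on_bilinear:
    "bounded_bilinear B \<Longrightarrow> open S \<Longrightarrow> smooth_on S h \<Longrightarrow> smooth_on S h' \<Longrightarrow> smooth_on S (\<lambda>x. B (h x) (h' x))"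
  and smooth_on_sum [smooth_intros]:
    "open S \<Longrightarrow> (\<And>i. i \<in> I \<Longrightarrow> smooth_on S (k i)) \<Longrightarrow> smooth_on S (\<lambda>x. \<Sum>i\<in>I. k i x)"
  unfolding smooth_on_def
  by (auto intro: Ck_on_const Ck_on_ident Ck_on_add Ck_on_linear_compose Ck_on_bilinear Ck_on_sum)

lemma smooth_on_compose:
  fixes f :: "'b::euclidean_space \<Rightarrow> 'c::real_normed_vector"
  assumes "smooth_on T f" "smooth_on S g" "g ` S \<subseteq> T" "open S" "open T"
  shows "smooth_on S (\<lambda>x. f (g x))"
  using assms unfolding smooth_on_def by (auto intro: Ck_on_compose)

lemma smooth_on_mult [smooth_intros]:
  fixes f g :: "_ \<Rightarrow> real"
  shows "open S \<Longrightarrow> smooth_on S f \<Longrightarrow> smooth_on S g \<Longrightarrow> smooth_on S (\<lambda>x. f x * g x)"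
  by (rule smooth_on_bilinear[OF bounded_bilinear_mult])

lemma smooth_on_scaleR [smooth_intros]:
  "open S \<Longrightarrow> smooth_on S f \<Longrightarrow> smooth_on S g \<Longrightarrow> smooth_on S (\<lambda>x. f x *\<^sub>R g x)"
  by (rule smooth_on_bilinear[OF bounded_bilinear_scaleR])

lemma smooth_on_minus [smooth_intros]:
  "open S \<Longrightarrow> smooth_on S f \<Longrightarrow> smooth_on S (\<lambda>x. - f x)"
  by (rule smooth_on_linear_compose[OF bounded_linear_minus[OF bounded_linear_ident]])

lemma smooth_on_diff [smooth_intros]:
  assumes "open S" "smooth_on S f" "smooth_on S g"
  shows "smooth_on S (\<lambda>x. f x - g x)"
  using smooth_on_add[OF assms(1,2) smooth_on_minus[OF assms(1,3)]] by simp

lemma smooth_on_vec_nth [smooth_intros]: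
  "open S \<Longrightarrow> smooth_on S f \<Longrightarrow> smooth_on S (\<lambda>x. f x $ i)"
  by (rule smooth_on_linear_compose[OF bounded_linear_vec_nth])

lemma smooth_on_inner [smooth_intros]:
  "open S \<Longrightarrow> smooth_on S f \<Longrightarrow> smooth_on S g \<Longrightarrow> smooth_on S (\<lambda>x. f x \<bullet> g x)"
  by (rule smooth_on_bilinear[OF bounded_bilinear_inner])

lemma smooth_on_inverse [smooth_intros]:
  fixes f :: "_ \<Rightarrow> real"
  shows "open S \<Longrightarrow> (\<And>x. x \<in> S \<Longrightarrow> f x \<noteq> 0) \<Longrightarrow> smooth_on S f \<Longrightarrow> smooth_on S (\<lambda>x. inverse (f x))"
  unfolding smooth_on_def by (auto intro: Ck_on_inverse)

lemma smooth_on_prod [smooth_intros]: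
  fixes k :: "_ \<Rightarrow> _ \<Rightarrow> real"
  assumes "open S" "\<And>i. i \<in> I \<Longrightarrow> smooth_on S (k i)"
  shows "smooth_on S (\<lambda>x. \<Prod>i\<in>I. k i x)"
  using assms(2)
  by (induction I rule: infinite_finite_induct) (auto intro!: smooth_intros assms(1))

lemma smooth_on_Pair [smooth_intros]:
  assumes "open S" "smooth_on S f" "smooth_on S g"
  shows "smooth_on S (\<lambda>x. (f x, g x))"
proof -
  have "smooth_on S (\<lambda>x. (f x, 0) + (0, g x))"
    using assms smooth_on_linear_compose[OF bounded_linear_Pair[OF bounded_linear_ident bounded_linear_zero]]
      smooth_on_linear_compose[OF bounded_linear_Pair[OF bounded_linear_zero bounded_linear_ident]]
    by (intro smooth_on_add) auto
  then show ?thesis by simp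
qed

lemma smooth_on_fst [smooth_intros]: "open S \<Longrightarrow> smooth_on S fst"
  using smooth_on_linear_compose[OF bounded_linear_fst, of S "\<lambda>x. x"] by (auto intro: smooth_on_ident)

lemma smooth_on_snd [smooth_intros]: "open S \<Longrightarrow> smooth_on S snd"
  using smooth_on_linear_compose[OF bounded_linear_snd, of S "\<lambda>x. x"] by (auto intro: smooth_on_ident)

section \<open>Symmetry of second derivatives by second differences\<close>

lemma second_difference_mean_value:
  fixes f :: "'a::real_normed_vector \<Rightarrow> real"
  assumes S: "open S" and f: "smooth_on S f" and h: "h > 0"
    and sub: "\<And>s t. 0 \<le> s \<Longrightarrow> s \<le> h \<Longrightarrow> 0 \<le> t \<Longrightarrow> t \<le> h \<Longrightarrow> x + s *\<^sub>R u + t *\<^sub>R v \<in> S"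
  obtains s t where "0 \<le> s" "s \<le> h" "0 \<le> t" "t \<le> h"
    and "f (x + h *\<^sub>R u + h *\<^sub>R v) - f (x + h *\<^sub>R u) - f (x + h *\<^sub>R v) + f x
      = h\<^sup>2 * frechet_derivative (\<lambda>z. frechet_derivative f (at z) u) (at (x + s *\<^sub>R u + t *\<^sub>R v)) v"
proof -
  let ?Du = "\<lambda>z. frechet_derivative f (at z) u"
  have line: "((\<lambda>s. g (w + s *\<^sub>R u')) has_real_derivative frechet_derivative g (at (w + s *\<^sub>R u')) u') (at s)"
    if "smooth_on S g" "w + s *\<^sub>R u' \<in> S" for g :: "'a \<Rightarrow> real" and w u' s
  proof -
    note D = smooth_on_has_derivative[OF that]
    have "((\<lambda>s. g (w + s *\<^sub>R u')) has_derivative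
        (\<lambda>r. frechet_derivative g (at (w + s *\<^sub>R u')) (r *\<^sub>R u'))) (at s)"
      using has_derivative_compose[of "\<lambda>s. w + s *\<^sub>R u'" "\<lambda>r. r *\<^sub>R u'" s UNIV, OF _ D]
      by (rule meta_mp) (auto intro!: derivative_eq_intros)
    moreover have "frechet_derivative g (at (w + s *\<^sub>R u')) (r *\<^sub>R u')
        = frechet_derivative g (at (w + s *\<^sub>R u')) u' * r" for r
      by (simp add: linear_scale[OF has_derivative_linear[OF D]])
    ultimately show ?thesis by (simp add: has_field_derivative_def)
  qed
  \<comment> \<open>The second difference is the increment of \<open>?\<phi>\<close> over
    \<open>[0, h]\<close>. One mean value theorem turns it into an increment of the
    \<open>u\<close>-derivative along \<open>v\<close>, a second one, in \<open>t\<close>, into the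
    mixed derivative.\<close>
  let ?\<phi> = "\<lambda>s. f (x + h *\<^sub>R v + s *\<^sub>R u) - f (x + s *\<^sub>R u)"
  have "(?\<phi> has_real_derivative (?Du (x + h *\<^sub>R v + s *\<^sub>R u) - ?Du (x + s *\<^sub>R u))) (at s)"
    if "0 \<le> s" "s \<le> h" for s
    using sub[of s h] sub[of s 0] that h
    by (intro DERIV_diff line[OF f]) (auto simp: algebra_simps)
  from MVT2[OF h this] obtain s where s: "0 < s" "s < h"
    and 1: "?\<phi> h - ?\<phi> 0 = h * (?Du (x + h *\<^sub>R v + s *\<^sub>R u) - ?Du (x + s *\<^sub>R u))"
    by auto
  have "((\<lambda>t. ?Du (x + s *\<^sub>R u + t *\<^sub>R v)) has_real_derivative
     frechet_derivative ?Du (at (x + s *\<^sub>R u + t *\<^sub>R v)) v) (at t)" if "0 \<le> t" "t \<le> h" for t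
    by (rule line[OF smooth_on_derivative[OF f]]) (use sub[of s t] that s in auto)
  from MVT2[OF h this] obtain t where t: "0 < t" "t < h"
    and 2: "?Du (x + s *\<^sub>R u + h *\<^sub>R v) - ?Du (x + s *\<^sub>R u)
      = h * frechet_derivative ?Du (at (x + s *\<^sub>R u + t *\<^sub>R v)) v"
    by auto
  show thesis
    by (rule that[of s t]) (use s t 1 2 in \<open>auto simp: algebra_simps power2_eq_square\<close>)
qed

text \<open>The second difference over a small parallelogram does not change when \<open>u\<close>
  and \<open>v\<close> are swapped, and it equals \<open>h\<^sup>2\<close> times either mixed
  derivative at some nearby point. Continuity of both then forces equality at
  \<open>x\<close>.\<close>

lemma second_derivative_symmetric_real:
  fixes f :: "'a::real_normed_vector \<Rightarrow> real"
  assumes S: "open S" and f: "smooth_on S f" and x: "x \<in> S"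
  shows "frechet_derivative (\<lambda>z. frechet_derivative f (at z) u) (at x) v
       = frechet_derivative (\<lambda>z. frechet_derivative f (at z) v) (at x) u"
proof -
  let ?A = "\<lambda>z. frechet_derivative (\<lambda>z. frechet_derivative f (at z) u) (at z) v"
  let ?B = "\<lambda>z. frechet_derivative (\<lambda>z. frechet_derivative f (at z) v) (at z) u"
  have cont: "isCont ?A x" "isCont ?B x"
    using smooth_on_continuous[OF smooth_on_derivative[OF smooth_on_derivative[OF f]]] S x
    by (auto simp: continuous_on_eq_continuous_at)
  have "\<bar>?A x - ?B x\<bar> \<le> e" if e: "e > 0" for e
  proof -
    obtain d where d: "d > 0" "ball x d \<subseteq> S"
      and dA: "\<And>z. dist z x < d \<Longrightarrow> dist (?A z) (?A x) < e/2"
      and dB: "\<And>z. dist z x < d \<Longrightarrow> dist (?B z) (?B x) < e/2"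
    proof -
      obtain d1 where "d1 > 0" "\<And>z. dist z x < d1 \<Longrightarrow> dist (?A z) (?A x) < e/2"
        using cont(1) e unfolding continuous_at_eps_delta by (metis half_gt_zero)
      moreover obtain d2 where "d2 > 0" "\<And>z. dist z x < d2 \<Longrightarrow> dist (?B z) (?B x) < e/2"
        using cont(2) e unfolding continuous_at_eps_delta by (metis half_gt_zero)
      moreover obtain d3 where "d3 > 0" "ball x d3 \<subseteq> S" using S x open_contains_ball by blast
      ultimately show thesis
        by (intro that[of "Min {d1,d2,d3}"]) (auto simp: subset_iff)
    qed
    \<comment> \<open>This keeps the parallelogram spanned by \<open>h u\<close> and
      \<open>h v\<close> within \<open>d / 2\<close> of \<open>x\<close>; the summand 1 makes the
      denominator positive even when both vectors vanish.\<close>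
    define h where "h = d / (2 * (norm u + norm v + 1))"
    have pos: "norm u + norm v + 1 > 0" by (intro add_nonneg_pos) auto
    have h: "h > 0" unfolding h_def using d by (auto intro!: divide_pos_pos add_nonneg_pos)
    have near: "dist (x + s *\<^sub>R u + t *\<^sub>R v) x < d"
      if "0 \<le> s" "s \<le> h" "0 \<le> t" "t \<le> h" for s t
    proof -
      have "dist (x + s *\<^sub>R u + t *\<^sub>R v) x = norm (s *\<^sub>R u + t *\<^sub>R v)"
        by (simp add: dist_norm add.assoc)
      also have "\<dots> \<le> s * norm u + t * norm v"
        using norm_triangle_ineq[of "s *\<^sub>R u" "t *\<^sub>R v"] that by simp
      also have "\<dots> \<le> h * norm u + h * norm v"
        using that by (intro add_mono mult_right_mono) auto
      also have "\<dots> \<le> h * (norm u + norm v + 1)" using h by (simp add: algebra_simps)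
      also have "\<dots> = d / 2" unfolding h_def using pos
        by (metis nonzero_mult_divide_mult_cancel_right times_divide_eq_left less_irrefl)
      also have "\<dots> < d" using d by simp
      finally show ?thesis .
    qed
    then have inS: "x + s *\<^sub>R u + t *\<^sub>R v \<in> S"
      if "0 \<le> s" "s \<le> h" "0 \<le> t" "t \<le> h" for s t
      using that d(2) by (auto simp: subset_iff dist_commute)
    obtain s t where st: "0 \<le> s" "s \<le> h" "0 \<le> t" "t \<le> h"
      and 1: "f (x + h *\<^sub>R u + h *\<^sub>R v) - f (x + h *\<^sub>R u) - f (x + h *\<^sub>R v) + f x
        = h\<^sup>2 * ?A (x + s *\<^sub>R u + t *\<^sub>R v)"
      using second_difference_mean_value[OF S f h, of x u v] inS by blast
    have inS': "x + s *\<^sub>R v + t *\<^sub>R u \<in> S"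
      if "0 \<le> s" "s \<le> h" "0 \<le> t" "t \<le> h" for s t
      using inS[of t s] that by (simp add: add_ac)
    obtain s' t' where st': "0 \<le> s'" "s' \<le> h" "0 \<le> t'" "t' \<le> h"
      and 2: "f (x + h *\<^sub>R v + h *\<^sub>R u) - f (x + h *\<^sub>R v) - f (x + h *\<^sub>R u) + f x
        = h\<^sup>2 * ?B (x + s' *\<^sub>R v + t' *\<^sub>R u)"
      using second_difference_mean_value[OF S f h, of x v u] inS' by blast
    have "h\<^sup>2 * ?A (x + s *\<^sub>R u + t *\<^sub>R v) = h\<^sup>2 * ?B (x + t' *\<^sub>R u + s' *\<^sub>R v)"
      using 1 2 by (simp only: add_ac)
    then have "?A (x + s *\<^sub>R u + t *\<^sub>R v) = ?B (x + t' *\<^sub>R u + s' *\<^sub>R v)"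
      using h by simp
    then show ?thesis
      using dA[OF near[OF st]] dB[OF near[OF st'(3,4,1,2)]] by (simp add: dist_real_def abs_if split: if_splits)
  qed
  then have "\<bar>?A x - ?B x\<bar> \<le> 0" using field_le_epsilon[of "\<bar>?A x - ?B x\<bar>" 0] by simp
  then show ?thesis by simp
qed

text \<open>Inner products with basis vectors reduce this to the real case. The vector form is what
  interchanges the variation parameter and time in \<open>first_variation\<close>.\<close>

lemma second_derivative_symmetric:
  fixes f :: "'a::real_normed_vector \<Rightarrow> 'b::euclidean_space"
  assumes S: "open S" and f: "smooth_on S f" and x: "x \<in> S"
  shows "frechet_derivative (\<lambda>z. frechet_derivative f (at z) u) (at x) v
       = frechet_derivative (\<lambda>z. frechet_derivative f (at z) v) (at x) u"
proof (rule euclidean_eqI)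
  fix b :: 'b
  assume "b \<in> Basis"
  have inner: "frechet_derivative (\<lambda>z. g z \<bullet> b) (at z) w = frechet_derivative g (at z) w \<bullet> b"
    if "smooth_on S g" "z \<in> S" for g :: "'a \<Rightarrow> 'b" and z w
    using has_derivative_inner_left[OF smooth_on_has_derivative[OF that]]
    by (metis frechet_derivative_at)
  have fb: "smooth_on S (\<lambda>z. f z \<bullet> b)" using f S by (intro smooth_intros)
  have *: "frechet_derivative (\<lambda>z. frechet_derivative (\<lambda>z. f z \<bullet> b) (at z) u) (at x) v
    = frechet_derivative (\<lambda>z. frechet_derivative f (at z) u) (at x) v \<bullet> b" for u v
  proof -
    have "frechet_derivative (\<lambda>z. frechet_derivative (\<lambda>z. f z \<bullet> b) (at z) u) (at x)
      = frechet_derivative (\<lambda>z. frechet_derivative f (at z) u \<bullet> b) (at x)"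
      using inner[OF f] S x
      by (intro frechet_derivative_transform_within_open[of _ x S]
          smooth_on_differentiable[OF smooth_on_derivative[OF fb]]) auto
    then show ?thesis using inner[OF smooth_on_derivative[OF f] x] by simp
  qed
  show "frechet_derivative (\<lambda>z. frechet_derivative f (at z) u) (at x) v \<bullet> b
       = frechet_derivative (\<lambda>z. frechet_derivative f (at z) v) (at x) u \<bullet> b"
    using second_derivative_symmetric_real[OF S fb x, of u v] by (simp add: *)
qed

subsection \<open>Partial derivatives on the slit tangent bundle of a coordinate domain\<close>

definition lsmooth :: "(real ^ 'n::finite) set \<Rightarrow> 'n lfun \<Rightarrow> bool" where
  "lsmooth U u \<longleftrightarrow> smooth_on (U \<times> - {0}) (\<lambda>z. u (fst z) (snd z))"

text \<open>The restriction to \<open>c > 0\<close> is essential: a Finsler structure may take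
  different values at \<open>y\<close> and \<open>-y\<close>, and evenness of the spray is what has
  to be proved.\<close>

definition homogeneous_on :: "(real ^ 'n::finite) set \<Rightarrow> nat \<Rightarrow> 'n lfun \<Rightarrow> bool" where
  "homogeneous_on U k u \<longleftrightarrow> (\<forall>x\<in>U. \<forall>y. \<forall>c>0. y \<noteq> 0 \<longrightarrow> u x (c *\<^sub>R y) = c ^ k * u x y)"

lemma homogeneous_onD:
  "homogeneous_on U k u \<Longrightarrow> x \<in> U \<Longrightarrow> y \<noteq> 0 \<Longrightarrow> c > 0 \<Longrightarrow> u x (c *\<^sub>R y) = c ^ k * u x y"
  by (simp add: homogeneous_on_def)

lemma open_slit: "open U \<Longrightarrow> open (U \<times> - {0::real ^ 'n::finite})"
  by (intro open_Times) auto

text \<open>The partials \<open>dx\<close> and \<open>dy\<close> are one-dimensional derivatives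
  along coordinate lines; this ties them to the total derivative on the product, on which
  \<open>smooth_on\<close> is built.\<close>

lemma frechet_derivative_prod_expand:
  fixes u :: "'n::finite lfun"
  assumes D: "((\<lambda>z. u (fst z) (snd z)) has_derivative D) (at (x, y))"
  shows "((\<lambda>t. u (x + t *\<^sub>R axis i 1) y) has_real_derivative D (axis i 1, 0)) (at 0)" (is ?A)
    and "((\<lambda>t. u x (y + t *\<^sub>R axis i 1)) has_real_derivative D (0, axis i 1)) (at 0)" (is ?B)
    and "D (v, w) = (\<Sum>i\<in>UNIV. v $ i * dx i u x y) + (\<Sum>i\<in>UNIV. w $ i * dy i u x y)" (is ?C)
proof -
  interpret D: linear D by (rule has_derivative_linear[OF D])
  have line: "((\<lambda>t. (\<lambda>z. u (fst z) (snd z)) ((x, y) + t *\<^sub>R p)) has_real_derivative D p) (at 0)" for p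
  proof -
    have "((\<lambda>t. (x, y) + t *\<^sub>R p) has_derivative (\<lambda>t. t *\<^sub>R p)) (at 0)"
      by (auto intro!: derivative_eq_intros)
    from diff_chain_at[OF this, of "\<lambda>z. u (fst z) (snd z)" D] D
    show ?thesis by (simp add: has_field_derivative_def o_def D.scaleR mult.commute[of _ "D p"])
  qed
  have A: "((\<lambda>t. u (x + t *\<^sub>R axis i 1) y) has_real_derivative D (axis i 1, 0)) (at 0)" for i
    using line[of "(axis i 1, 0)"] by simp
  then show ?A .
  have B: "((\<lambda>t. u x (y + t *\<^sub>R axis i 1)) has_real_derivative D (0, axis i 1)) (at 0)" for i
    using line[of "(0, axis i 1)"] by simp
  then show ?B .
  have dx: "dx i u x y = D (axis i 1, 0)" and dy: "dy i u x y = D (0, axis i 1)" for i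
    unfolding dx_def dy_def by (rule DERIV_imp_deriv, rule A B)+
  have "(v, w) = (\<Sum>i\<in>UNIV. v $ i *\<^sub>R (axis i 1, 0)) + (\<Sum>i\<in>UNIV. w $ i *\<^sub>R (0, axis i 1))"
    using basis_expansion[of v] basis_expansion[of w]
    by (simp add: prod_eq_iff fst_sum snd_sum scalar_mult_eq_scaleR)
  then show ?C
    by (simp only: D.add D.sum D.scaleR dx dy real_scaleR_def)
qed

context
  fixes U :: "(real ^ 'n::finite) set"
  assumes U: "open U"
begin

lemma lsmooth_has_derivative:
  assumes "lsmooth U u" "x \<in> U" "y \<noteq> 0"
  shows "((\<lambda>z. u (fst z) (snd z)) has_derivative
     (\<lambda>p. (\<Sum>i\<in>UNIV. fst p $ i * dx i u x y) + (\<Sum>i\<in>UNIV. snd p $ i * dy i u x y))) (at (x, y))"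
proof -
  let ?D = "frechet_derivative (\<lambda>z. u (fst z) (snd z)) (at (x, y))"
  have D: "((\<lambda>z. u (fst z) (snd z)) has_derivative ?D) (at (x, y))"
    using assms by (intro smooth_on_has_derivative) (auto simp: lsmooth_def)
  show ?thesis
    by (rule has_derivative_eq_rhs[OF D]) (rule ext, simp add: frechet_derivative_prod_expand(3)[OF D, symmetric])
qed

text \<open>As a Frechet derivative in a fixed direction the partial inherits smoothness from
  \<open>smooth_on_derivative\<close> and commutation from the symmetry of second
  derivatives.\<close>

lemma dx_eq_frechet:
  assumes "lsmooth U u" "x \<in> U" "y \<noteq> 0"
  shows "dx i u x y = frechet_derivative (\<lambda>z. u (fst z) (snd z)) (at (x, y)) (axis i 1, 0)"
  unfolding dx_def
  by (rule DERIV_imp_deriv[OF frechet_derivative_prod_expand(1)[OF smooth_on_has_derivative[of "U \<times> - {0}"]]])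
    (use assms in \<open>auto simp: lsmooth_def\<close>)

lemma dy_eq_frechet:
  assumes "lsmooth U u" "x \<in> U" "y \<noteq> 0"
  shows "dy i u x y = frechet_derivative (\<lambda>z. u (fst z) (snd z)) (at (x, y)) (0, axis i 1)"
  unfolding dy_def
  by (rule DERIV_imp_deriv[OF frechet_derivative_prod_expand(2)[OF smooth_on_has_derivative[of "U \<times> - {0}"]]])
    (use assms in \<open>auto simp: lsmooth_def\<close>)

lemma has_derivative_dx:
  assumes "lsmooth U u" "x \<in> U" "y \<noteq> 0"
  shows "((\<lambda>t. u (x + t *\<^sub>R axis i 1) y) has_real_derivative dx i u x y) (at 0)"
  unfolding dx_eq_frechet[OF assms]
  by (rule frechet_derivative_prod_expand(1)[OF smooth_on_has_derivative[of "U \<times> - {0}"]])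
    (use assms in \<open>auto simp: lsmooth_def\<close>)

lemma has_derivative_dy:
  assumes "lsmooth U u" "x \<in> U" "y \<noteq> 0"
  shows "((\<lambda>t. u x (y + t *\<^sub>R axis i 1)) has_real_derivative dy i u x y) (at 0)"
  unfolding dy_eq_frechet[OF assms]
  by (rule frechet_derivative_prod_expand(2)[OF smooth_on_has_derivative[of "U \<times> - {0}"]])
    (use assms in \<open>auto simp: lsmooth_def\<close>)

lemma lsmooth_cong:
  assumes "\<And>x y. x \<in> U \<Longrightarrow> y \<noteq> 0 \<Longrightarrow> u x y = v x y"
  shows "lsmooth U u \<longleftrightarrow> lsmooth U v"
  unfolding lsmooth_def by (rule smooth_on_cong[OF open_slit[OF U]]) (use assms in force)

lemma lsmooth_dx:
  assumes "lsmooth U u" shows "lsmooth U (dx i u)"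
proof -
  have "smooth_on (U \<times> - {0}) (\<lambda>z. frechet_derivative (\<lambda>z. u (fst z) (snd z)) (at z) (axis i 1, 0))"
    using assms unfolding lsmooth_def by (rule smooth_on_derivative)
  then show ?thesis
    unfolding lsmooth_def
    by (subst smooth_on_cong[OF open_slit[OF U], where g = "\<lambda>z. frechet_derivative (\<lambda>z. u (fst z) (snd z)) (at z) (axis i 1, 0)"])
      (use dx_eq_frechet[OF assms] in force)
qed

lemma lsmooth_dy:
  assumes "lsmooth U u" shows "lsmooth U (dy i u)"
proof -
  have "smooth_on (U \<times> - {0}) (\<lambda>z. frechet_derivative (\<lambda>z. u (fst z) (snd z)) (at z) (0, axis i 1))"
    using assms unfolding lsmooth_def by (rule smooth_on_derivative)
  then show ?thesis
    unfolding lsmooth_def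
    by (subst smooth_on_cong[OF open_slit[OF U], where g = "\<lambda>z. frechet_derivative (\<lambda>z. u (fst z) (snd z)) (at z) (0, axis i 1)"])
      (use dy_eq_frechet[OF assms] in force)
qed

lemma lsmooth_const: "lsmooth U (\<lambda>x y. c)"
  and lsmooth_add: "lsmooth U u \<Longrightarrow> lsmooth U v \<Longrightarrow> lsmooth U (\<lambda>x y. u x y + v x y)"
  and lsmooth_diff: "lsmooth U u \<Longrightarrow> lsmooth U v \<Longrightarrow> lsmooth U (\<lambda>x y. u x y - v x y)"
  and lsmooth_mult: "lsmooth U u \<Longrightarrow> lsmooth U v \<Longrightarrow> lsmooth U (\<lambda>x y. u x y * v x y)"
  and lsmooth_sum: "(\<And>i. i \<in> I \<Longrightarrow> lsmooth U (w i)) \<Longrightarrow> lsmooth U (\<lambda>x y. \<Sum>i\<in>I. w i x y)"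
  and lsmooth_prod: "(\<And>i. i \<in> I \<Longrightarrow> lsmooth U (w i)) \<Longrightarrow> lsmooth U (\<lambda>x y. \<Prod>i\<in>I. w i x y)"
  and lsmooth_snd_nth: "lsmooth U (\<lambda>x y. y $ j)"
  and lsmooth_inverse:
    "(\<And>x y. x \<in> U \<Longrightarrow> y \<noteq> 0 \<Longrightarrow> u x y \<noteq> 0) \<Longrightarrow> lsmooth U u \<Longrightarrow> lsmooth U (\<lambda>x y. inverse (u x y))"
  unfolding lsmooth_def using open_slit[OF U] by (auto intro!: smooth_intros)

lemma dx_cong:
  assumes "\<And>x y. x \<in> U \<Longrightarrow> y \<noteq> 0 \<Longrightarrow> u x y = v x y" and "x \<in> U" "y \<noteq> 0"
  shows "dx i u x y = dx i v x y"
  unfolding dx_def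
proof (rule deriv_cong_ev[OF _ refl])
  have "((\<lambda>t. x + t *\<^sub>R axis i 1) \<longlongrightarrow> x) (at 0)" by (auto intro!: tendsto_eq_intros)
  then have "((\<lambda>t. x + t *\<^sub>R axis i 1) \<longlongrightarrow> x) (nhds 0)"
    using tendsto_at_iff_tendsto_nhds[of "\<lambda>t. x + t *\<^sub>R axis i 1" "0::real"] by simp
  from topological_tendstoD[OF this U \<open>x \<in> U\<close>]
  show "\<forall>\<^sub>F t in nhds 0. u (x + t *\<^sub>R axis i 1) y = v (x + t *\<^sub>R axis i 1) y"
    by eventually_elim (use assms in auto)
qed

lemma dy_cong:
  assumes "\<And>x y. x \<in> U \<Longrightarrow> y \<noteq> 0 \<Longrightarrow> u x y = v x y" and "x \<in> U" "y \<noteq> 0"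
  shows "dy i u x y = dy i v x y"
  unfolding dy_def
proof (rule deriv_cong_ev[OF _ refl])
  have "((\<lambda>t. y + t *\<^sub>R axis i 1) \<longlongrightarrow> y) (at 0)" by (auto intro!: tendsto_eq_intros)
  then have "((\<lambda>t. y + t *\<^sub>R axis i 1) \<longlongrightarrow> y) (nhds 0)"
    using tendsto_at_iff_tendsto_nhds[of "\<lambda>t. y + t *\<^sub>R axis i 1" "0::real"] by simp
  from topological_tendstoD[OF this, of "- {0}"]
  have "\<forall>\<^sub>F t in nhds 0. y + t *\<^sub>R axis i 1 \<in> - {0}" using \<open>y \<noteq> 0\<close> by auto
  then show "\<forall>\<^sub>F t in nhds 0. u x (y + t *\<^sub>R axis i 1) = v x (y + t *\<^sub>R axis i 1)"
    by eventually_elim (use assms in auto)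
qed

lemma dy_mult:
  assumes "lsmooth U u" "lsmooth U v" "x \<in> U" "y \<noteq> 0"
  shows "dy i (\<lambda>x y. u x y * v x y) x y = dy i u x y * v x y + u x y * dy i v x y"
  using DERIV_mult[OF has_derivative_dy[OF assms(1,3,4)] has_derivative_dy[OF assms(2,3,4)], of i i]
  unfolding dy_def[of i "\<lambda>x y. u x y * v x y"] by (auto dest!: DERIV_imp_deriv simp: algebra_simps)

lemma dx_mult:
  assumes "lsmooth U u" "lsmooth U v" "x \<in> U" "y \<noteq> 0"
  shows "dx i (\<lambda>x y. u x y * v x y) x y = dx i u x y * v x y + u x y * dx i v x y"
  using DERIV_mult[OF has_derivative_dx[OF assms(1,3,4)] has_derivative_dx[OF assms(2,3,4)], of i i]
  unfolding dx_def[of i "\<lambda>x y. u x y * v x y"] by (auto dest!: DERIV_imp_deriv simp: algebra_simps)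

lemma dy_cmult:
  assumes "lsmooth U u" "x \<in> U" "y \<noteq> 0"
  shows "dy i (\<lambda>x y. c * u x y) x y = c * dy i u x y"
  using DERIV_cmult[OF has_derivative_dy[OF assms], of c i]
  unfolding dy_def[of i "\<lambda>x y. c * u x y"] by (rule DERIV_imp_deriv)

lemma dx_cmult:
  assumes "lsmooth U u" "x \<in> U" "y \<noteq> 0"
  shows "dx i (\<lambda>x y. c * u x y) x y = c * dx i u x y"
  using DERIV_cmult[OF has_derivative_dx[OF assms], of c i]
  unfolding dx_def[of i "\<lambda>x y. c * u x y"] by (rule DERIV_imp_deriv)

lemma dy_sum:
  assumes "\<And>j. j \<in> I \<Longrightarrow> lsmooth U (u j)" "x \<in> U" "y \<noteq> 0"
  shows "dy i (\<lambda>x y. \<Sum>j\<in>I. u j x y) x y = (\<Sum>j\<in>I. dy i (u j) x y)"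
  unfolding dy_def[of i "\<lambda>x y. \<Sum>j\<in>I. u j x y"]
  by (rule DERIV_imp_deriv, rule DERIV_sum)
    (rule has_derivative_dy[OF assms])

lemma dx_sum:
  assumes "\<And>j. j \<in> I \<Longrightarrow> lsmooth U (u j)" "x \<in> U" "y \<noteq> 0"
  shows "dx i (\<lambda>x y. \<Sum>j\<in>I. u j x y) x y = (\<Sum>j\<in>I. dx i (u j) x y)"
  unfolding dx_def[of i "\<lambda>x y. \<Sum>j\<in>I. u j x y"]
  by (rule DERIV_imp_deriv, rule DERIV_sum)
    (rule has_derivative_dx[OF assms])

lemma dy_snd_nth: "dy i (\<lambda>x y. y $ j) x y = (if i = j then 1 else 0)"
proof -
  have "((\<lambda>t. (y + t *\<^sub>R axis i 1) $ j) has_real_derivative (if i = j then 1 else 0)) (at 0)"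
    by (auto simp: axis_def intro!: derivative_eq_intros)
  then show ?thesis unfolding dy_def by (rule DERIV_imp_deriv)
qed

lemma dx_snd_nth: "dx i (\<lambda>x y. y $ j) x y = 0"
  unfolding dx_def by simp

text \<open>\<open>e\<close> need not be the derivative of \<open>c\<close>. This freedom covers
  rays \<open>t y\<close> over a fixed point, velocities along a curve, and slices of a variation in
  either parameter.\<close>

lemma lfun_chain:
  assumes "lsmooth U u" "c t \<in> U" "e t \<noteq> 0"
    and "(c has_vector_derivative c') (at t within T)" "(e has_vector_derivative e') (at t within T)"
  shows "((\<lambda>t. u (c t) (e t)) has_real_derivative
      (\<Sum>i\<in>UNIV. c' $ i * dx i u (c t) (e t)) + (\<Sum>i\<in>UNIV. e' $ i * dy i u (c t) (e t))) (at t within T)"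
proof -
  have "((\<lambda>t. (c t, e t)) has_derivative (\<lambda>s. (s *\<^sub>R c', s *\<^sub>R e'))) (at t within T)"
    using assms(4,5) unfolding has_vector_derivative_def by (rule has_derivative_Pair)
  from has_derivative_compose[OF this lsmooth_has_derivative[OF assms(1-3)], unfolded fst_conv snd_conv]
  show ?thesis
    unfolding has_field_derivative_def
    by (rule has_derivative_eq_rhs)
      (auto simp: fun_eq_iff sum_distrib_left distrib_right sum_distrib_right algebra_simps)
qed

lemma frechet_derivative_lfun_cong:
  assumes "lsmooth U u" "\<And>x y. x \<in> U \<Longrightarrow> y \<noteq> 0 \<Longrightarrow> u x y = v (x, y)" "x \<in> U" "y \<noteq> 0"
  shows "frechet_derivative (\<lambda>z. u (fst z) (snd z)) (at (x, y)) = frechet_derivative v (at (x, y))"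
proof (rule frechet_derivative_transform_within_open[OF _ open_slit[OF U]])
  show "(\<lambda>z. u (fst z) (snd z)) differentiable at (x, y)"
    using assms unfolding lsmooth_def by (auto intro: smooth_on_differentiable)
qed (use assms in force)+

lemma dy_dx_commute:
  assumes "lsmooth U u" "x \<in> U" "y \<noteq> 0"
  shows "dy i (dx j u) x y = dx j (dy i u) x y"
proof -
  have "dy i (dx j u) x y = frechet_derivative (\<lambda>z. dx j u (fst z) (snd z)) (at (x, y)) (0, axis i 1)"
    by (rule dy_eq_frechet[OF lsmooth_dx[OF assms(1)] assms(2,3)])
  also have "\<dots> = frechet_derivative (\<lambda>z. frechet_derivative (\<lambda>z. u (fst z) (snd z)) (at z) (axis j 1, 0)) (at (x, y)) (0, axis i 1)"
    by (subst frechet_derivative_lfun_cong[OF lsmooth_dx[OF assms(1)] dx_eq_frechet[OF assms(1)] assms(2,3)]) auto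
  also have "\<dots> = frechet_derivative (\<lambda>z. frechet_derivative (\<lambda>z. u (fst z) (snd z)) (at z) (0, axis i 1)) (at (x, y)) (axis j 1, 0)"
    using assms by (intro second_derivative_symmetric_real[OF open_slit[OF U]]) (auto simp: lsmooth_def)
  also have "\<dots> = frechet_derivative (\<lambda>z. dy i u (fst z) (snd z)) (at (x, y)) (axis j 1, 0)"
    by (subst frechet_derivative_lfun_cong[OF lsmooth_dy[OF assms(1)] dy_eq_frechet[OF assms(1)] assms(2,3)]) auto
  also have "\<dots> = dx j (dy i u) x y"
    by (rule dx_eq_frechet[OF lsmooth_dy[OF assms(1)] assms(2,3), symmetric])
  finally show ?thesis .
qed

lemma dy_dy_commute:
  assumes "lsmooth U u" "x \<in> U" "y \<noteq> 0"
  shows "dy i (dy j u) x y = dy j (dy i u) x y"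
proof -
  have *: "dy i (dy j u) x y = frechet_derivative (\<lambda>z. frechet_derivative (\<lambda>z. u (fst z) (snd z)) (at z) (0, axis j 1)) (at (x, y)) (0, axis i 1)" for i j
    unfolding dy_eq_frechet[OF lsmooth_dy[OF assms(1)] assms(2,3)]
    by (subst frechet_derivative_lfun_cong[OF lsmooth_dy[OF assms(1)] dy_eq_frechet[OF assms(1)] assms(2,3)]) auto
  show ?thesis
    unfolding * using assms by (intro second_derivative_symmetric_real[OF open_slit[OF U]]) (auto simp: lsmooth_def)
qed

text \<open>The function sending \<open>t\<close> to \<open>u x (t y)\<close> is
  \<open>t ^ k * u x y\<close> for \<open>t > 0\<close>; differentiating it at \<open>t = 1\<close>
  by the chain rule and directly gives the two sides.\<close>

lemma euler_homogeneous:
  assumes u: "lsmooth U u" and h: "homogeneous_on U k u" and x: "x \<in> U" and y: "y \<noteq> 0"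
  shows "(\<Sum>i\<in>UNIV. y $ i * dy i u x y) = real k * u x y"
proof -
  have c: "((\<lambda>t. x) has_vector_derivative 0) (at 1)" by simp
  have e: "((\<lambda>t. t *\<^sub>R y) has_vector_derivative y) (at (1::real))"
    by (auto intro!: derivative_eq_intros)
  have 1: "((\<lambda>t. u x (t *\<^sub>R y)) has_real_derivative (\<Sum>i\<in>UNIV. y $ i * dy i u x y)) (at 1)"
    using lfun_chain[OF u _ _ c e] x y by simp
  have "((\<lambda>t. t ^ k * u x y) has_real_derivative (real k * u x y)) (at 1)"
    by (auto intro!: derivative_eq_intros)
  then have "((\<lambda>t. u x (t *\<^sub>R y)) has_real_derivative (real k * u x y)) (at 1)"
    by (rule has_field_derivative_transform_within_open[of _ _ _ "{0<..}"])
      (use homogeneous_onD[OF h x y] in auto)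
  with 1 show ?thesis by (rule DERIV_unique)
qed

lemma homogeneous_on_dx:
  assumes u: "lsmooth U u" and h: "homogeneous_on U k u"
  shows "homogeneous_on U k (dx i u)"
  unfolding homogeneous_on_def
proof (intro ballI allI impI)
  fix x y :: "real ^ 'n" and c :: real
  assume x: "x \<in> U" and c: "c > 0" and y: "y \<noteq> 0"
  \<comment> \<open>\<open>dx\<close> does not move its second argument, so that argument may be
    frozen at \<open>c y\<close>. The homogeneity relation becomes an identity between functions of
    the position, as \<open>dx_cong\<close> expects.\<close>
  have "dx i u x (c *\<^sub>R y) = dx i (\<lambda>x' _. u x' (c *\<^sub>R y)) x y" unfolding dx_def ..
  also have "\<dots> = dx i (\<lambda>x' _. c ^ k * u x' y) x y"
    by (rule dx_cong[where u = "\<lambda>x' _. u x' (c *\<^sub>R y)"]) (use homogeneous_onD[OF h _ y c] x y in auto)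
  also have "\<dots> = dx i (\<lambda>x' y. c ^ k * u x' y) x y" unfolding dx_def ..
  also have "\<dots> = c ^ k * dx i u x y" by (rule dx_cmult[OF u x y])
  finally show "dx i u x (c *\<^sub>R y) = c ^ k * dx i u x y" .
qed

text \<open>Differentiating \<open>u x (c y)\<close> in \<open>y\<close> produces an extra factor
  \<open>c\<close>; cancelling it lowers the degree by one.\<close>

lemma homogeneous_on_dy:
  assumes u: "lsmooth U u" and h: "homogeneous_on U (Suc k) u"
  shows "homogeneous_on U k (dy i u)"
  unfolding homogeneous_on_def
proof (intro ballI allI impI)
  fix x y :: "real ^ 'n" and c :: real
  assume x: "x \<in> U" and c: "c > 0" and y: "y \<noteq> 0"
  have "((\<lambda>t. u x (c *\<^sub>R y + (c * t) *\<^sub>R axis i 1)) has_real_derivative (dy i u x (c *\<^sub>R y) * c)) (at 0)"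
    using DERIV_chain2[of "\<lambda>t. u x (c *\<^sub>R y + t *\<^sub>R axis i 1)" "dy i u x (c *\<^sub>R y)" "\<lambda>t. c * t" 0 c UNIV]
      has_derivative_dy[OF u x, of "c *\<^sub>R y" i] c y
    by (auto intro!: derivative_eq_intros)
  then have "dy i (\<lambda>x y. u x (c *\<^sub>R y)) x y = c * dy i u x (c *\<^sub>R y)"
    unfolding dy_def[of i "\<lambda>x y. u x (c *\<^sub>R y)"] by (simp add: DERIV_imp_deriv algebra_simps)
  moreover have "dy i (\<lambda>x y. u x (c *\<^sub>R y)) x y = dy i (\<lambda>x y. c ^ Suc k * u x y) x y"
    by (rule dy_cong) (use homogeneous_onD[OF h _ _ c] x y in auto)
  ultimately show "dy i u x (c *\<^sub>R y) = c ^ k * dy i u x y"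
    using c by (simp add: dy_cmult[OF u x y] del: power_Suc) simp
qed

end

subsection \<open>Finsler structures on a coordinate domain\<close>

lemma matrix_inv_inverse:
  fixes A :: "real ^ 'n::finite ^ 'n"
  assumes "invertible A"
  shows "A ** matrix_inv A = mat 1" "matrix_inv A ** A = mat 1"
  using someI_ex[OF assms[unfolded invertible_def]] unfolding matrix_inv_def by auto

lemma positive_definite_invertible:
  fixes A :: "real ^ 'n::finite ^ 'n"
  assumes "positive_definite A"
  shows "invertible A"
proof -
  have "x = 0" if "A *v x = 0" for x
    using assms that unfolding positive_definite_def by (metis inner_zero_right less_irrefl)
  then show ?thesis unfolding invertible_left_inverse matrix_left_invertible_ker by blast
qed

text \<open>Cramer's rule exhibits the entries of the inverse as quotients of determinants.
  Determinants are polynomials in the entries, which is how \<open>smooth_fund_inv\<close> obtains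
  smoothness of the inverse metric.\<close>

lemma matrix_inv_nth_cramer:
  fixes A :: "real ^ 'n::finite ^ 'n"
  assumes "invertible A"
  shows "matrix_inv A $ k $ j = det (\<chi> i l. if l = k then axis j 1 $ i else A $ i $ l) * inverse (det A)"
proof -
  have "A *v (matrix_inv A *v axis j 1) = axis j 1"
    by (simp add: matrix_vector_mul_assoc matrix_inv_inverse[OF assms])
  then have "matrix_inv A *v axis j 1 = (\<chi> k. det (\<chi> i l. if l = k then axis j 1 $ i else A $ i $ l) / det A)"
    using cramer[of A] assms by (simp add: invertible_det_nz)
  moreover have "(matrix_inv A *v axis j 1) $ k = matrix_inv A $ k $ j"
    by (simp add: matrix_vector_mult_def axis_def if_distrib[of "\<lambda>t. _ * t"] cong: if_cong)
  ultimately show ?thesis by (simp add: divide_inverse)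
qed

text \<open>The tensor calculus needs only a coordinate expression over an open set of positions.
  Every chart image supplies an instance, see \<open>finsler_domain_chart\<close>.\<close>

locale finsler_domain =
  fixes U :: "(real ^ 'n::finite) set" and f :: "'n lfun"
  assumes open_U: "open U"
    and smooth_f: "lsmooth U f"
    and homogeneous_f: "homogeneous_on U 1 f"
    and nonneg_f: "\<And>x y. x \<in> U \<Longrightarrow> y \<noteq> 0 \<Longrightarrow> 0 \<le> f x y"
    and positive_definite_g: "\<And>x y. x \<in> U \<Longrightarrow> y \<noteq> 0 \<Longrightarrow> positive_definite (\<chi> i j. fund_tensor f i j x y)"
begin

lemmas lsmooth_intros = lsmooth_dx[OF open_U] lsmooth_dy[OF open_U] lsmooth_const[OF open_U] lsmooth_add[OF open_U]
  lsmooth_diff[OF open_U] lsmooth_mult[OF open_U] lsmooth_sum[OF open_U] lsmooth_prod[OF open_U]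
  lsmooth_snd_nth[OF open_U] lsmooth_inverse[OF open_U] smooth_f

abbreviation "g \<equiv> fund_tensor f"
abbreviation "G \<equiv> spray f"

lemma sq_eq: "sq f = (\<lambda>x y. f x y * f x y)"
  by (simp add: sq_def fun_eq_iff power2_eq_square)

lemma smooth_sq: "lsmooth U (sq f)"
  unfolding sq_eq by (intro lsmooth_intros)

lemma smooth_energy: "lsmooth U (\<lambda>x y. 1/2 * sq f x y)"
  by (intro lsmooth_intros smooth_sq)

lemma smooth_g: "lsmooth U (g i j)"
  unfolding fund_tensor_def by (intro lsmooth_intros smooth_sq)

lemma dy_sq: "x \<in> U \<Longrightarrow> y \<noteq> 0 \<Longrightarrow> dy i (sq f) x y = 2 * (f x y * dy i f x y)"
  unfolding sq_eq using dy_mult[OF open_U smooth_f smooth_f] by simp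

lemma dx_sq: "x \<in> U \<Longrightarrow> y \<noteq> 0 \<Longrightarrow> dx i (sq f) x y = 2 * (f x y * dx i f x y)"
  unfolding sq_eq using dx_mult[OF open_U smooth_f smooth_f] by simp

lemma dy_energy: "x \<in> U \<Longrightarrow> y \<noteq> 0 \<Longrightarrow> dy i (\<lambda>x y. 1/2 * sq f x y) x y = f x y * dy i f x y"
  using dy_cmult[OF open_U smooth_sq, of x y i "1/2"] dy_sq by simp

lemma g_eq: "x \<in> U \<Longrightarrow> y \<noteq> 0 \<Longrightarrow> g i j x y = dy i f x y * dy j f x y + f x y * dy j (dy i f) x y"
  unfolding fund_tensor_def
  by (subst dy_cong[OF open_U dy_energy])
    (simp_all add: dy_mult[OF open_U smooth_f lsmooth_intros(2)[OF smooth_f]] mult.commute)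

lemma g_sym: "x \<in> U \<Longrightarrow> y \<noteq> 0 \<Longrightarrow> g i j x y = g j i x y"
  unfolding fund_tensor_def by (rule dy_dy_commute[OF open_U smooth_energy])

lemma euler_f: "x \<in> U \<Longrightarrow> y \<noteq> 0 \<Longrightarrow> (\<Sum>i\<in>UNIV. y $ i * dy i f x y) = f x y"
  using euler_homogeneous[OF open_U smooth_f homogeneous_f] by simp

lemma euler_dy_f: "x \<in> U \<Longrightarrow> y \<noteq> 0 \<Longrightarrow> (\<Sum>j\<in>UNIV. y $ j * dy j (dy i f) x y) = 0"
  using euler_homogeneous[OF open_U lsmooth_intros(2)[OF smooth_f] homogeneous_on_dy[OF open_U smooth_f]] homogeneous_f
  by fastforce

lemma euler_dx_f: "x \<in> U \<Longrightarrow> y \<noteq> 0 \<Longrightarrow> (\<Sum>j\<in>UNIV. y $ j * dy j (dx i f) x y) = dx i f x y"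
  using euler_homogeneous[OF open_U lsmooth_intros(1)[OF smooth_f] homogeneous_on_dx[OF open_U smooth_f homogeneous_f]]
  by fastforce

text \<open>By Euler's relation the second-derivative part of \<open>g\<close> annihilates
  \<open>y\<close>, and the first-derivative part returns \<open>f\<close> once.\<close>

lemma g_contract: "x \<in> U \<Longrightarrow> y \<noteq> 0 \<Longrightarrow> (\<Sum>j\<in>UNIV. g i j x y * y $ j) = f x y * dy i f x y"
proof -
  assume xy: "x \<in> U" "y \<noteq> 0"
  have "(\<Sum>j\<in>UNIV. g i j x y * y $ j)
    = dy i f x y * (\<Sum>j\<in>UNIV. y $ j * dy j f x y) + f x y * (\<Sum>j\<in>UNIV. y $ j * dy j (dy i f) x y)"
    by (simp add: g_eq[OF xy] sum_distrib_left sum.distrib[symmetric] algebra_simps)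
  then show ?thesis by (simp add: euler_f[OF xy] euler_dy_f[OF xy])
qed

text \<open>Contracting \<open>g\<close> twice with \<open>y\<close> gives \<open>f\<close> squared,
  so positive definiteness excludes the value 0 that \<open>nonneg_f\<close> still allows. Later
  arguments divide by \<open>f\<close>.\<close>

lemma f_pos: assumes xy: "x \<in> U" "y \<noteq> 0" shows "0 < f x y"
proof -
  have "0 < y \<bullet> ((\<chi> i j. g i j x y) *v y)"
    using positive_definite_g[OF xy] xy unfolding positive_definite_def by blast
  also have "\<dots> = (\<Sum>i\<in>UNIV. y $ i * (f x y * dy i f x y))"
    by (simp add: inner_vec_def matrix_vector_mult_def g_contract[OF xy])
  also have "\<dots> = f x y * f x y"
    by (subst (2) euler_f[OF xy, symmetric]) (simp add: sum_distrib_left algebra_simps)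
  finally show ?thesis using nonneg_f[OF xy] by (metis mult_zero_left less_irrefl order_le_less)
qed

lemma g_invertible: "x \<in> U \<Longrightarrow> y \<noteq> 0 \<Longrightarrow> invertible (\<chi> i j. g i j x y)"
  by (rule positive_definite_invertible[OF positive_definite_g])

lemma g_injective:
  assumes "x \<in> U" "y \<noteq> 0" "\<And>i. (\<Sum>j\<in>UNIV. g i j x y * w j) = 0"
  shows "w j = 0"
proof (rule ccontr)
  assume "w j \<noteq> 0"
  then have "(\<chi> j. w j) \<noteq> 0" by (auto simp: vec_eq_iff)
  then have "0 < (\<chi> j. w j) \<bullet> ((\<chi> i j. g i j x y) *v (\<chi> j. w j))"
    using positive_definite_g[OF assms(1,2)] unfolding positive_definite_def by blast
  then show False by (simp add: inner_vec_def matrix_vector_mult_def assms(3))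
qed

lemma g_fund_inv:
  assumes xy: "x \<in> U" "y \<noteq> 0"
  shows "(\<Sum>i\<in>UNIV. g h i x y * (\<Sum>l\<in>UNIV. fund_inv f i l x y * A l)) = A h"
proof -
  let ?g = "\<chi> i j. g i j x y"
  have "(?g *v (matrix_inv ?g *v (\<chi> l. A l))) $ h = A h"
    by (simp add: matrix_vector_mul_assoc matrix_inv_inverse[OF g_invertible[OF xy]])
  then show ?thesis by (simp add: matrix_vector_mult_def fund_inv_def)
qed

lemma smooth_det:
  assumes "\<And>i j. lsmooth U (\<lambda>x y. A i j x y)"
  shows "lsmooth U (\<lambda>x y. det (\<chi> i j. A i j x y))"
  unfolding det_def vec_lambda_beta by (intro lsmooth_intros assms)

lemma smooth_fund_inv: "lsmooth U (fund_inv f k j)"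
proof -
  let ?v = "\<lambda>x y. det (\<chi> i l. if l = k then axis j 1 $ i else g i l x y) * inverse (det (\<chi> i l. g i l x y))"
  have "lsmooth U ?v"
  proof (intro lsmooth_intros smooth_det)
    show "lsmooth U (\<lambda>x y. if l = k then axis j 1 $ i else g i l x y)" for i l
      by (cases "l = k") (auto intro: lsmooth_intros smooth_g)
    show "lsmooth U (\<lambda>x y. g i l x y)" for i l by (rule smooth_g)
  qed (use g_invertible in \<open>auto simp: invertible_det_nz\<close>)
  moreover have "fund_inv f k j x y = ?v x y" if "x \<in> U" "y \<noteq> 0" for x y
    unfolding fund_inv_def matrix_inv_nth_cramer[OF g_invertible[OF that]] by (simp only: vec_lambda_beta)
  then have "lsmooth U (fund_inv f k j) \<longleftrightarrow> lsmooth U ?v" by (rule lsmooth_cong[OF open_U])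
  ultimately show ?thesis by simp
qed

lemma smooth_G: "lsmooth U (G i)"
  unfolding spray_def by (intro lsmooth_intros smooth_fund_inv smooth_sq)

lemma smooth_ricci: "lsmooth U (ricci f i j)"
  unfolding ricci_def riemann_curv_def by (intro lsmooth_intros smooth_G)

lemma homogeneous_sq: "homogeneous_on U (Suc 1) (sq f)"
  using homogeneous_f by (auto simp: homogeneous_on_def sq_def power_mult_distrib power2_eq_square)

text \<open>The metric has degree 0, hence so has its inverse, and both terms of the bracket in
  \<open>spray\<close> have degree 2: the mixed derivative has degree 1 and is multiplied by
  \<open>y\<close>.\<close>

lemma homogeneous_G: "homogeneous_on U 2 (G i)"
  unfolding homogeneous_on_def
proof (intro ballI allI impI)
  fix x y :: "real ^ 'n" and c :: real
  assume x: "x \<in> U" and c: "c > 0" and y: "y \<noteq> 0"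
  have "homogeneous_on U (Suc (Suc 0)) (\<lambda>x y. 1/2 * sq f x y)"
    using homogeneous_sq by (auto simp: homogeneous_on_def)
  then have "homogeneous_on U 0 (g k l)" for k l
    unfolding fund_tensor_def
    by (intro homogeneous_on_dy[OF open_U] lsmooth_dy[OF open_U] smooth_energy)
  then have g: "g k l x (c *\<^sub>R y) = g k l x y" for k l
    using homogeneous_onD[of U 0 "g k l" x y c] x y c by simp
  then have ginv: "fund_inv f k l x (c *\<^sub>R y) = fund_inv f k l x y" for k l
    by (simp add: fund_inv_def)
  have hx: "homogeneous_on U (Suc 1) (dx j (sq f))" for j
    by (rule homogeneous_on_dx[OF open_U smooth_sq homogeneous_sq])
  have hyx: "homogeneous_on U 1 (dy k (dx j (sq f)))" for j k
    by (rule homogeneous_on_dy[OF open_U lsmooth_intros(1)[OF smooth_sq] hx])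
  have dx: "dx j (sq f) x (c *\<^sub>R y) = c\<^sup>2 * dx j (sq f) x y" for j
    using homogeneous_onD[OF hx x y c] by (simp add: power2_eq_square)
  have dyx: "dy k (dx j (sq f)) x (c *\<^sub>R y) = c * dy k (dx j (sq f)) x y" for j k
    using homogeneous_onD[OF hyx x y c] by simp
  show "G i x (c *\<^sub>R y) = c ^ 2 * G i x y"
    unfolding spray_def ginv dx dyx
    by (simp add: sum_distrib_left right_diff_distrib power2_eq_square algebra_simps)
qed

lemma euler_G: "x \<in> U \<Longrightarrow> y \<noteq> 0 \<Longrightarrow> (\<Sum>j\<in>UNIV. y $ j * dy j (G i) x y) = 2 * G i x y"
  using euler_homogeneous[OF open_U smooth_G homogeneous_G] by simp

section \<open>The Euler-Lagrange expression of length and the spray\<close>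

lemma g_spray:
  assumes "x \<in> U" "y \<noteq> 0"
  shows "4 * (\<Sum>i\<in>UNIV. g h i x y * G i x y)
     = (\<Sum>j\<in>UNIV. dy h (dx j (sq f)) x y * y $ j) - dx h (sq f) x y"
  using g_fund_inv[OF assms, of h "\<lambda>h. (\<Sum>j\<in>UNIV. dy h (dx j (sq f)) x y * y $ j) - dx h (sq f) x y"]
  unfolding spray_def by (simp add: sum_distrib_left algebra_simps)

text \<open>With position \<open>x\<close>, velocity \<open>y\<close> and acceleration
  \<open>z\<close> this is \<open>d/dt (df/dy^h) - df/dx^h\<close>, the time derivative being
  written out by the chain rule. A separate argument \<open>z\<close> makes it a pointwise
  quantity.\<close>

definition EL :: "real ^ 'n \<Rightarrow> real ^ 'n \<Rightarrow> real ^ 'n \<Rightarrow> 'n \<Rightarrow> real" where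
  "EL x y z h = (\<Sum>j\<in>UNIV. z $ j * dy j (dy h f) x y) + (\<Sum>j\<in>UNIV. y $ j * dx j (dy h f) x y) - dx h f x y"

text \<open>\<open>\<mu>\<close> is the logarithmic time derivative of the speed. The Euler-Lagrange
  expression of \<open>f^2 / 2\<close> is \<open>g (z + 2 G)\<close>; the product rule writes it as
  \<open>f\<close> times \<open>EL\<close> plus the time derivative of \<open>f\<close> times
  \<open>df/dy\<close>, and by \<open>g_contract\<close> the latter is \<open>\<mu>\<close> times
  \<open>g y\<close>.\<close>

lemma EL_spray:
  assumes xy: "x \<in> U" "y \<noteq> 0"
    and \<mu>: "\<mu> = ((\<Sum>j\<in>UNIV. y $ j * dx j f x y) + (\<Sum>j\<in>UNIV. z $ j * dy j f x y)) / f x y"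
  shows "(\<Sum>i\<in>UNIV. g h i x y * (z $ i + 2 * G i x y - \<mu> * y $ i)) = f x y * EL x y z h"
proof -
  have z: "(\<Sum>i\<in>UNIV. g h i x y * z $ i)
    = dy h f x y * (\<Sum>j\<in>UNIV. z $ j * dy j f x y) + f x y * (\<Sum>j\<in>UNIV. z $ j * dy j (dy h f) x y)"
    by (simp add: g_eq[OF xy] sum_distrib_left sum.distrib[symmetric] algebra_simps)
  have dyx: "dy h (dx j (sq f)) x y = 2 * (dy h f x y * dx j f x y + f x y * dx j (dy h f) x y)" for j
  proof -
    have "dy h (dx j (sq f)) x y = dy h (\<lambda>x y. 2 * (f x y * dx j f x y)) x y"
      by (rule dy_cong[OF open_U dx_sq xy])
    also have "\<dots> = 2 * (dy h f x y * dx j f x y + f x y * dy h (dx j f) x y)"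
      using dy_cmult[OF open_U lsmooth_intros(6)[OF smooth_f lsmooth_intros(1)[OF smooth_f]] xy]
        dy_mult[OF open_U smooth_f lsmooth_intros(1)[OF smooth_f] xy] by simp
    finally show ?thesis using dy_dx_commute[OF open_U smooth_f xy] by simp
  qed
  have G: "2 * (\<Sum>i\<in>UNIV. g h i x y * G i x y)
    = dy h f x y * (\<Sum>j\<in>UNIV. y $ j * dx j f x y) + f x y * (\<Sum>j\<in>UNIV. y $ j * dx j (dy h f) x y)
      - f x y * dx h f x y"
  proof -
    have "(\<Sum>j\<in>UNIV. dy h (dx j (sq f)) x y * y $ j)
      = 2 * (dy h f x y * (\<Sum>j\<in>UNIV. y $ j * dx j f x y) + f x y * (\<Sum>j\<in>UNIV. y $ j * dx j (dy h f) x y))"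
      by (simp add: dyx sum_distrib_left sum.distrib[symmetric] algebra_simps)
    with g_spray[OF xy, of h] dx_sq[OF xy, of h] show ?thesis by simp
  qed
  have "(\<Sum>i\<in>UNIV. g h i x y * (z $ i + 2 * G i x y - \<mu> * y $ i))
    = (\<Sum>i\<in>UNIV. g h i x y * z $ i) + 2 * (\<Sum>i\<in>UNIV. g h i x y * G i x y)
      - \<mu> * (\<Sum>i\<in>UNIV. g h i x y * y $ i)"
    by (simp add: sum_distrib_left sum.distrib sum_subtractf algebra_simps)
  also have "\<dots> = f x y * EL x y z h"
    unfolding z G g_contract[OF xy] EL_def \<mu> using f_pos[OF xy] by (simp add: field_simps)
  finally show ?thesis .
qed

text \<open>Infinitesimal form of the invariance of length under reparametrization. After
  interchanging derivatives, Euler's relation removes the \<open>z\<close> terms and turns the mixed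
  \<open>x\<close> and \<open>y\<close> terms into the last sum, which cancels.\<close>

lemma EL_contract:
  assumes xy: "x \<in> U" "y \<noteq> 0"
  shows "(\<Sum>h\<in>UNIV. y $ h * EL x y z h) = 0"
proof -
  have "(\<Sum>h\<in>UNIV. y $ h * EL x y z h)
    = (\<Sum>h\<in>UNIV. \<Sum>j\<in>UNIV. z $ j * (y $ h * dy j (dy h f) x y))
      + (\<Sum>h\<in>UNIV. \<Sum>j\<in>UNIV. y $ j * (y $ h * dx j (dy h f) x y)) - (\<Sum>h\<in>UNIV. y $ h * dx h f x y)"
    by (simp add: EL_def sum_distrib_left sum.distrib sum_subtractf algebra_simps)
  also have "(\<Sum>h\<in>UNIV. \<Sum>j\<in>UNIV. z $ j * (y $ h * dy j (dy h f) x y))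
    = (\<Sum>j\<in>UNIV. z $ j * (\<Sum>h\<in>UNIV. y $ h * dy h (dy j f) x y))"
    by (subst sum.swap) (simp add: sum_distrib_left dy_dy_commute[OF open_U smooth_f xy])
  also have "(\<Sum>h\<in>UNIV. \<Sum>j\<in>UNIV. y $ j * (y $ h * dx j (dy h f) x y))
    = (\<Sum>j\<in>UNIV. y $ j * (\<Sum>h\<in>UNIV. y $ h * dy h (dx j f) x y))"
    by (subst sum.swap) (simp add: sum_distrib_left dy_dx_commute[OF open_U smooth_f xy])
  finally show ?thesis by (simp add: euler_dy_f[OF xy] euler_dx_f[OF xy])
qed

text \<open>One direction takes \<open>r\<close> to be \<open>\<mu>\<close> from
  \<open>EL_spray\<close> and uses that \<open>g\<close> is injective. Conversely a given
  \<open>r\<close> must be shown to equal \<open>\<mu>\<close>: contraction with \<open>y\<close>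
  annihilates \<open>EL\<close> and turns \<open>df/dy\<close> into \<open>f\<close>, which is
  positive.\<close>

lemma EL_zero_iff:
  assumes xy: "x \<in> U" "y \<noteq> 0"
  shows "(\<forall>h. EL x y z h = 0) \<longleftrightarrow> (\<exists>r. \<forall>i. z $ i + 2 * G i x y = r * y $ i)"
proof -
  define \<mu> where "\<mu> = ((\<Sum>j\<in>UNIV. y $ j * dx j f x y) + (\<Sum>j\<in>UNIV. z $ j * dy j f x y)) / f x y"
  note E = EL_spray[OF xy \<mu>_def]
  show ?thesis
  proof
    assume "\<forall>h. EL x y z h = 0"
    then have "z $ i + 2 * G i x y - \<mu> * y $ i = 0" for i
      using g_injective[OF xy, of "\<lambda>i. z $ i + 2 * G i x y - \<mu> * y $ i" i] by (simp add: E)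
    then show "\<exists>r. \<forall>i. z $ i + 2 * G i x y = r * y $ i" by (intro exI[of _ \<mu>]) simp
  next
    assume "\<exists>r. \<forall>i. z $ i + 2 * G i x y = r * y $ i"
    then obtain r where "\<And>i. z $ i + 2 * G i x y = r * y $ i" by blast
    then have "f x y * EL x y z h = (r - \<mu>) * (f x y * dy h f x y)" for h
      unfolding E[symmetric] g_contract[OF xy, symmetric] sum_distrib_left
      by (intro sum.cong) (auto simp: algebra_simps)
    then have *: "EL x y z h = (r - \<mu>) * dy h f x y" for h
      using f_pos[OF xy] by (metis mult.left_commute mult_left_cancel less_irrefl)
    have "(r - \<mu>) * f x y = 0"
      using EL_contract[OF xy, of z] euler_f[OF xy]
      by (simp add: * mult.left_commute[of _ "r - \<mu>"] sum_distrib_left[symmetric])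
    then show "\<forall>h. EL x y z h = 0" using * f_pos[OF xy] by simp
  qed
qed

text \<open>Reversal keeps the acceleration and flips the velocity, so with an even spray the factor
  \<open>r\<close> becomes \<open>- r\<close>. In dimension one \<open>EL_contract\<close> at
  \<open>- y\<close> has a single summand, whose factor \<open>(- y) $ i\<close> is nonzero.\<close>

lemma EL_reverse:
  assumes xy: "x \<in> U" "y \<noteq> 0" and EL: "\<And>h. EL x y z h = 0"
    and even: "CARD('n) = 1 \<or> (\<forall>i. G i x (- y) = G i x y)"
  shows "EL x (- y) z h = 0"
  using even
proof
  assume "CARD('n) = 1"
  then obtain i :: 'n where i: "UNIV = {i}" by (auto simp: card_1_singleton_iff)
  then have "y $ i \<noteq> 0" "h = i" using xy(2) by (auto simp: vec_eq_iff)
  then show ?thesis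
    using EL_contract[of x "- y" z, unfolded i] xy by simp
next
  assume even: "\<forall>i. G i x (- y) = G i x y"
  from EL EL_zero_iff[OF xy, of z] obtain r where r: "\<And>i. z $ i + 2 * G i x y = r * y $ i" by auto
  then have "\<exists>r. \<forall>i. z $ i + 2 * G i x (- y) = r * (- y) $ i"
    using even by (intro exI[of _ "- r"]) simp
  then show ?thesis using EL_zero_iff[of x "- y" z] xy by auto
qed

end

section \<open>Berwald and Chern coefficients, and evenness of the spray\<close>

context finsler_domain
begin

lemma euler_dy_G:
  assumes xy: "x \<in> U" "y \<noteq> 0"
  shows "(\<Sum>l\<in>UNIV. y $ l * dy l (dy j (G r)) x y) = dy j (G r) x y"
proof -
  have "homogeneous_on U 1 (dy j (G r))"
    using homogeneous_on_dy[OF open_U smooth_G, of 1] homogeneous_G by (simp add: numeral_2_eq_2)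
  then show ?thesis
    using euler_homogeneous[OF open_U lsmooth_intros(2)[OF smooth_G] _ xy] by fastforce
qed

text \<open>Common interface of the two connections: symmetry drives the Christoffel trick, and the
  double contraction leads back from the coefficients to the spray.\<close>

definition spray_connection :: "('n \<Rightarrow> 'n \<Rightarrow> 'n \<Rightarrow> 'n lfun) \<Rightarrow> bool" where
  "spray_connection C \<longleftrightarrow> (\<forall>x\<in>U. \<forall>y. y \<noteq> 0 \<longrightarrow>
     (\<forall>r l j. C r l j x y = C r j l x y) \<and>
     (\<forall>r. (\<Sum>l\<in>UNIV. \<Sum>j\<in>UNIV. y $ l * y $ j * C r l j x y) = 2 * G r x y))"

text \<open>Euler's relation twice: \<open>dy j (G r)\<close> has degree 1 and reproduces itself,
  then \<open>G r\<close> has degree 2, which accounts for the factor 2.\<close>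

lemma spray_connection_berwald: "spray_connection (berwald_coeff f)"
  unfolding spray_connection_def
proof (intro ballI allI impI conjI)
  fix x y :: "real ^ 'n" and r l j
  assume xy: "x \<in> U" "y \<noteq> 0"
  show "berwald_coeff f r l j x y = berwald_coeff f r j l x y"
    unfolding berwald_coeff_def by (rule dy_dy_commute[OF open_U smooth_G xy])
  have "(\<Sum>l\<in>UNIV. \<Sum>j\<in>UNIV. y $ l * y $ j * berwald_coeff f r l j x y)
    = (\<Sum>j\<in>UNIV. y $ j * (\<Sum>l\<in>UNIV. y $ l * dy l (dy j (G r)) x y))"
    unfolding berwald_coeff_def by (subst sum.swap) (simp add: sum_distrib_left algebra_simps)
  then show "(\<Sum>l\<in>UNIV. \<Sum>j\<in>UNIV. y $ l * y $ j * berwald_coeff f r l j x y) = 2 * G r x y"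
    by (simp add: euler_dy_G[OF xy] euler_G[OF xy])
qed

lemma delta_x_cong:
  assumes "\<And>x y. x \<in> U \<Longrightarrow> y \<noteq> 0 \<Longrightarrow> u x y = v x y" and "x \<in> U" "y \<noteq> 0"
  shows "delta_x f j u x y = delta_x f j v x y"
  unfolding delta_x_def using dx_cong[OF open_U assms] dy_cong[OF open_U assms] by simp

text \<open>Up to a factor the fibre derivative of \<open>g\<close> is the Cartan tensor. When
  \<open>g_contract\<close> is differentiated along the fibre, the explicit factor
  \<open>y $ j\<close> contributes \<open>g s k\<close>, which is already the whole other
  side.\<close>

lemma dy_g_contract:
  assumes xy: "x \<in> U" "y \<noteq> 0"
  shows "(\<Sum>j\<in>UNIV. y $ j * dy k (g s j) x y) = 0"
proof -
  have eq: "(\<Sum>j\<in>UNIV. y $ j * g s j x y) = dy s (\<lambda>x y. 1/2 * sq f x y) x y" if "x \<in> U" "y \<noteq> 0" for x y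
    using g_contract[OF that, of s] dy_energy[OF that, of s] by (simp add: mult.commute)
  have "dy k (\<lambda>x y. \<Sum>j\<in>UNIV. y $ j * g s j x y) x y = g s k x y"
    unfolding fund_tensor_def[of f s k] by (rule dy_cong[OF open_U eq xy])
  moreover have "dy k (\<lambda>x y. \<Sum>j\<in>UNIV. y $ j * g s j x y) x y
      = (\<Sum>j\<in>UNIV. dy k (\<lambda>x y. y $ j * g s j x y) x y)"
    by (rule dy_sum[OF open_U _ xy]) (intro lsmooth_intros smooth_g)
  moreover have "dy k (\<lambda>x y. y $ j * g s j x y) x y = (if k = j then g s j x y else 0) + y $ j * dy k (g s j) x y" for j
    using dy_mult[OF open_U lsmooth_intros(9) smooth_g xy] by (simp add: dy_snd_nth[OF open_U])
  ultimately show ?thesis by (simp add: sum.distrib)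
qed

lemma dx_g_contract:
  assumes xy: "x \<in> U" "y \<noteq> 0"
  shows "(\<Sum>j\<in>UNIV. y $ j * dx k (g s j) x y) = 1/2 * dy s (dx k (sq f)) x y"
proof -
  have eq: "(\<Sum>j\<in>UNIV. y $ j * g s j x y) = 1/2 * dy s (sq f) x y" if "x \<in> U" "y \<noteq> 0" for x y
    using g_contract[OF that, of s] dy_sq[OF that, of s] by (simp add: mult.commute)
  have "dx k (\<lambda>x y. \<Sum>j\<in>UNIV. y $ j * g s j x y) x y = dx k (\<lambda>x y. 1/2 * dy s (sq f) x y) x y"
    by (rule dx_cong[OF open_U eq xy])
  also have "\<dots> = 1/2 * dy s (dx k (sq f)) x y"
    unfolding dy_dx_commute[OF open_U smooth_sq xy] by (rule dx_cmult[OF open_U lsmooth_intros(2)[OF smooth_sq] xy])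
  finally have "dx k (\<lambda>x y. \<Sum>j\<in>UNIV. y $ j * g s j x y) x y = 1/2 * dy s (dx k (sq f)) x y" .
  moreover have "dx k (\<lambda>x y. \<Sum>j\<in>UNIV. y $ j * g s j x y) x y
      = (\<Sum>j\<in>UNIV. dx k (\<lambda>x y. y $ j * g s j x y) x y)"
    by (rule dx_sum[OF open_U _ xy]) (intro lsmooth_intros smooth_g)
  moreover have "dx k (\<lambda>x y. y $ j * g s j x y) x y = y $ j * dx k (g s j) x y" for j
    using dx_mult[OF open_U lsmooth_intros(9) smooth_g xy] by (simp add: dx_snd_nth[OF open_U])
  ultimately show ?thesis by simp
qed

text \<open>The correction terms of \<open>delta_x\<close> contain fibre derivatives of
  \<open>g\<close> and disappear by \<open>dy_g_contract\<close>, so the nonlinear connection leaves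
  no trace in the contraction.\<close>

lemma delta_g_contract:
  assumes xy: "x \<in> U" "y \<noteq> 0"
  shows "(\<Sum>j\<in>UNIV. y $ j * delta_x f k (g s j) x y) = 1/2 * dy s (dx k (sq f)) x y"
proof -
  have "(\<Sum>j\<in>UNIV. y $ j * delta_x f k (g s j) x y) = (\<Sum>j\<in>UNIV. y $ j * dx k (g s j) x y)
     - (\<Sum>j\<in>UNIV. \<Sum>m\<in>UNIV. dy k (G m) x y * (y $ j * dy m (g s j) x y))"
    by (simp add: delta_x_def sum_distrib_left sum_subtractf algebra_simps)
  also have "(\<Sum>j\<in>UNIV. \<Sum>m\<in>UNIV. dy k (G m) x y * (y $ j * dy m (g s j) x y))
     = (\<Sum>m\<in>UNIV. dy k (G m) x y * (\<Sum>j\<in>UNIV. y $ j * dy m (g s j) x y))"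
    by (subst sum.swap) (simp add: sum_distrib_left)
  finally show ?thesis by (simp add: dy_g_contract[OF xy] dx_g_contract[OF xy])
qed

lemma spray_connection_chern: "spray_connection (chern_coeff f)"
  unfolding spray_connection_def
proof (intro ballI allI impI conjI)
  fix x y :: "real ^ 'n" and r l j
  assume xy: "x \<in> U" "y \<noteq> 0"
  have sym: "delta_x f k (g s t) x y = delta_x f k (g t s) x y" for k s t
    by (rule delta_x_cong[OF g_sym xy])
  let ?T = "\<lambda>s l j. delta_x f l (g s j) x y + delta_x f j (g l s) x y - delta_x f s (g l j) x y"
  have "?T s l j = ?T s j l" for s
    using sym[of l s j] sym[of j l s] sym[of s l j] by linarith
  then show "chern_coeff f r l j x y = chern_coeff f r j l x y"
    unfolding chern_coeff_def by (simp only:)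
  \<comment> \<open>After contraction the first two terms of \<open>?T\<close> agree, each being
    half of the mixed-derivative sum; the third is \<open>dx s (sq f)\<close> because that function
    has degree 2. The result is the bracket in \<open>spray\<close>, and the prefactor 1/2 instead
    of 1/4 yields the 2 in front of \<open>G\<close>.\<close>
  have T: "(\<Sum>l\<in>UNIV. \<Sum>j\<in>UNIV. y $ l * y $ j * ?T s l j)
      = (\<Sum>j\<in>UNIV. dy s (dx j (sq f)) x y * y $ j) - dx s (sq f) x y" for s
  proof -
    have 1: "(\<Sum>l\<in>UNIV. \<Sum>j\<in>UNIV. y $ l * y $ j * delta_x f l (g s j) x y)
       = (\<Sum>l\<in>UNIV. y $ l * (1/2 * dy s (dx l (sq f)) x y))"
      by (simp only: delta_g_contract[OF xy, symmetric] sum_distrib_left mult.assoc)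
    have 2: "(\<Sum>l\<in>UNIV. \<Sum>j\<in>UNIV. y $ l * y $ j * delta_x f j (g l s) x y)
       = (\<Sum>l\<in>UNIV. y $ l * (1/2 * dy s (dx l (sq f)) x y))"
      by (subst sum.swap) (simp only: delta_g_contract[OF xy, symmetric] sum_distrib_left sym[of _ _ s] mult_ac)
    have "homogeneous_on U 2 (dx s (sq f))"
      using homogeneous_on_dx[OF open_U smooth_sq] homogeneous_sq by (simp add: numeral_2_eq_2)
    then have e: "(\<Sum>l\<in>UNIV. y $ l * dy l (dx s (sq f)) x y) = 2 * dx s (sq f) x y"
      using euler_homogeneous[OF open_U lsmooth_intros(1)[OF smooth_sq] _ xy] by fastforce
    have "(\<Sum>l\<in>UNIV. \<Sum>j\<in>UNIV. y $ l * y $ j * delta_x f s (g l j) x y)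
       = 1/2 * (\<Sum>l\<in>UNIV. y $ l * dy l (dx s (sq f)) x y)"
      using delta_g_contract[OF xy, of s, symmetric]
      by (simp add: sum_distrib_left algebra_simps)
    then have 3: "(\<Sum>l\<in>UNIV. \<Sum>j\<in>UNIV. y $ l * y $ j * delta_x f s (g l j) x y) = dx s (sq f) x y"
      using e by simp
    have "(\<Sum>l\<in>UNIV. \<Sum>j\<in>UNIV. y $ l * y $ j * ?T s l j)
      = (\<Sum>l\<in>UNIV. \<Sum>j\<in>UNIV. y $ l * y $ j * delta_x f l (g s j) x y)
       + (\<Sum>l\<in>UNIV. \<Sum>j\<in>UNIV. y $ l * y $ j * delta_x f j (g l s) x y)
       - (\<Sum>l\<in>UNIV. \<Sum>j\<in>UNIV. y $ l * y $ j * delta_x f s (g l j) x y)"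
      by (simp only: distrib_left right_diff_distrib sum.distrib sum_subtractf)
    then show ?thesis unfolding 1 2 3 by (simp add: sum.distrib[symmetric] algebra_simps)
  qed
  have "(\<Sum>l\<in>UNIV. \<Sum>j\<in>UNIV. y $ l * y $ j * chern_coeff f r l j x y)
    = (\<Sum>l\<in>UNIV. \<Sum>j\<in>UNIV. \<Sum>s\<in>UNIV. 1/2 * (fund_inv f r s x y * (y $ l * y $ j * ?T s l j)))"
    unfolding chern_coeff_def sum_distrib_left by (intro sum.cong refl) simp
  also have "\<dots> = (\<Sum>l\<in>UNIV. \<Sum>s\<in>UNIV. \<Sum>j\<in>UNIV. 1/2 * (fund_inv f r s x y * (y $ l * y $ j * ?T s l j)))"
    by (intro sum.cong refl sum.swap)
  also have "\<dots> = (\<Sum>s\<in>UNIV. \<Sum>l\<in>UNIV. \<Sum>j\<in>UNIV. 1/2 * (fund_inv f r s x y * (y $ l * y $ j * ?T s l j)))"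
    by (rule sum.swap)
  also have "\<dots> = 1/2 * (\<Sum>s\<in>UNIV. fund_inv f r s x y * (\<Sum>l\<in>UNIV. \<Sum>j\<in>UNIV. y $ l * y $ j * ?T s l j))"
    by (simp only: sum_distrib_left)
  also have "\<dots> = 2 * G r x y"
    unfolding T spray_def by simp
  finally show "(\<Sum>l\<in>UNIV. \<Sum>j\<in>UNIV. y $ l * y $ j * chern_coeff f r l j x y) = 2 * G r x y" .
qed

lemma spray_even:
  assumes C: "spray_connection C" and card: "CARD('n) \<noteq> 1"
    and neg: "\<And>x y. x \<in> U \<Longrightarrow> y \<noteq> 0 \<Longrightarrow> negative_definite (\<chi> i j. ricci f i j x y)"
    and par: "\<And>x y h l j. x \<in> U \<Longrightarrow> y \<noteq> 0 \<Longrightarrow> delta_x f j (ricci f h l) x y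
                     - (\<Sum>r\<in>UNIV. ricci f h r x y * C r l j x y)
                     - (\<Sum>r\<in>UNIV. ricci f l r x y * C r h j x y) = 0"
    and vert: "\<And>x y i j k. x \<in> U \<Longrightarrow> y \<noteq> 0 \<Longrightarrow> dy k (ricci f i j) x y = 0"
    and xy: "x \<in> U" "y \<noteq> 0"
  shows "G i x (- y) = G i x y"
proof -
  let ?R = "ricci f"
  have "DIM(real ^ 'n) \<ge> 2"
    using card zero_less_card_finite[where 'a = 'n] by (simp add: numeral_2_eq_2 Suc_le_eq le_neq_implies_less)
  then have conn: "connected (- {0 :: real ^ 'n})" by (rule connected_punctured_universe)
  have const: "?R h l x y = ?R h l x y'" if "x \<in> U" "y \<noteq> 0" "y' \<noteq> 0" for h l x y y'
  proof (rule has_derivative_zero_unique_connected[OF _ conn])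
    fix w :: "real ^ 'n"
    assume "w \<in> - {0}"
    then have w: "w \<noteq> 0" by simp
    have "((\<lambda>w. (x, w)) has_derivative (\<lambda>v. (0, v))) (at w)"
      by (auto intro!: derivative_eq_intros)
    from has_derivative_compose[OF this lsmooth_has_derivative[OF open_U smooth_ricci \<open>x \<in> U\<close> w]]
    show "(?R h l x has_derivative (\<lambda>v. 0)) (at w)"
      by (simp add: vert[OF \<open>x \<in> U\<close> w])
  qed (use that in auto)
  \<comment> \<open>Constancy in \<open>y\<close> is used at all nearby positions, not just at
    \<open>x\<close>; otherwise it could not be differentiated in the base direction.\<close>
  have dx_even: "dx j (?R h l) x (- y) = dx j (?R h l) x y" for j h l
  proof -
    have "dx j (?R h l) x (- y) = dx j (\<lambda>x y. ?R h l x (- y)) x y" unfolding dx_def ..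
    also have "\<dots> = dx j (?R h l) x y"
      by (rule dx_cong[OF open_U const xy]) auto
    finally show ?thesis .
  qed
  \<comment> \<open>The upper index of the connection is lowered with the Ricci tensor instead of
    \<open>g\<close>. In the parallelism equation \<open>delta_x\<close> reduces to
    \<open>dx\<close> because the vertical derivatives vanish.\<close>
  define P where "P h l j y = (\<Sum>r\<in>UNIV. ?R h r x y * C r l j x y)" for h l j y
  have dxR: "dx j (?R h l) x y = P h l j y + P l h j y" if "y \<noteq> 0" for h l j y
    using par[OF xy(1) that, of j h l] vert[OF xy(1) that] by (simp add: delta_x_def P_def)
  have Psym: "P h l j y = P h j l y" if "y \<noteq> 0" for h l j y
    unfolding P_def using C xy(1) that by (metis (no_types, lifting) spray_connection_def)
  \<comment> \<open>As for the Levi-Civita connection: two permuted copies of \<open>dxR\<close> are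
    added, a third is subtracted, and symmetry in the last two indices cancels everything but
    \<open>P h l j\<close> taken twice.\<close>
  have christoffel: "2 * P h l j y = dx j (?R h l) x y + dx l (?R h j) x y - dx h (?R l j) x y"
    if "y \<noteq> 0" for h l j y
    unfolding dxR[OF that] using Psym[OF that, of l h j] Psym[OF that, of j h l] Psym[OF that, of h j l] by linarith
  have "P h l j (- y) = P h l j y" for h l j
    using christoffel[OF xy(2), of h l j] christoffel[of "- y" h l j] xy(2) by (simp add: dx_even)
  then have "(\<Sum>r\<in>UNIV. ?R h r x y * (C r l j x y - C r l j x (- y))) = 0" for h l j
    unfolding P_def using const[OF xy(1), of "- y" y] xy(2) by (simp add: right_diff_distrib sum_subtractf)
  then have C_even: "C r l j x y = C r l j x (- y)" for r l j
  proof -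
    \<comment> \<open>For fixed \<open>l\<close> and \<open>j\<close> the difference of the
      coefficients lies in the kernel of \<open>Ric\<close>; the definite quadratic form is 0 on it,
      so it vanishes.\<close>
    let ?w = "\<chi> r. C r l j x y - C r l j x (- y)"
    have "?w \<bullet> ((\<chi> i j. ?R i j x y) *v ?w) = 0"
      using \<open>\<And>l j h. (\<Sum>r\<in>UNIV. ?R h r x y * (C r l j x y - C r l j x (- y))) = 0\<close>
      by (simp add: inner_vec_def matrix_vector_mult_def)
    then have "?w = 0" using neg[OF xy, unfolded negative_definite_def, rule_format, of ?w] by fastforce
    then show ?thesis by (simp add: vec_eq_iff)
  qed
  \<comment> \<open>The weights \<open>y $ l * y $ j\<close> are even in \<open>y\<close>, so
    evenness of \<open>C\<close> passes to \<open>G\<close>.\<close>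
  have *: "2 * G i x y = (\<Sum>l\<in>UNIV. \<Sum>j\<in>UNIV. y $ l * y $ j * C i l j x y)" if "y \<noteq> 0" for y
    using C xy(1) that by (simp add: spray_connection_def)
  show ?thesis
    using *[OF xy(2)] *[of "- y"] xy(2) by (simp add: C_even)
qed

end

subsection \<open>First variation of length in a chart\<close>

lemma has_derivative_slices:
  fixes k :: "real \<times> real \<Rightarrow> 'b::real_normed_vector"
  assumes "smooth_on W k" "(s, t) \<in> W"
  shows "((\<lambda>s. k (s, t)) has_vector_derivative frechet_derivative k (at (s, t)) (1, 0)) (at s)"
    and "((\<lambda>t. k (s, t)) has_vector_derivative frechet_derivative k (at (s, t)) (0, 1)) (at t)"
proof -
  let ?D = "frechet_derivative k (at (s, t))"
  note D = smooth_on_has_derivative[OF assms]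
  interpret D: linear ?D by (rule has_derivative_linear[OF D])
  have "((\<lambda>s. (s, t)) has_derivative (\<lambda>r. r *\<^sub>R (1, 0))) (at s)"
    by (auto intro!: derivative_eq_intros)
  from diff_chain_at[OF this D]
  show "((\<lambda>s. k (s, t)) has_vector_derivative ?D (1, 0)) (at s)"
    unfolding has_vector_derivative_def o_def D.scaleR .
  have "((\<lambda>t. (s, t)) has_derivative (\<lambda>r. r *\<^sub>R (0, 1))) (at t)"
    by (auto intro!: derivative_eq_intros)
  from diff_chain_at[OF this D]
  show "((\<lambda>t. k (s, t)) has_vector_derivative ?D (0, 1)) (at t)"
    unfolding has_vector_derivative_def o_def D.scaleR .
qed

context finsler_domain
begin

text \<open>Differentiation under the integral, interchange of the \<open>s\<close> and
  \<open>t\<close> derivatives, and integration by parts. Since \<open>EL\<close> is the time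
  derivative of \<open>df/dy\<close> minus \<open>df/dx\<close>, it enters with a minus
  sign.\<close>

lemma first_variation:
  fixes h :: "real \<times> real \<Rightarrow> real ^ 'n" and c d \<delta> :: real
  defines "ht \<equiv> \<lambda>z. frechet_derivative h (at z) (0, 1)"
  defines "htt \<equiv> \<lambda>z. frechet_derivative ht (at z) (0, 1)"
  defines "hs \<equiv> \<lambda>z. frechet_derivative h (at z) (1, 0)"
  assumes W: "open W" and h: "smooth_on W h" and \<delta>: "\<delta> > 0" and cd: "c < d"
    and sub: "{-\<delta><..<\<delta>} \<times> {c..d} \<subseteq> W"
    and hU: "\<And>z. z \<in> W \<Longrightarrow> h z \<in> U" and ht0: "\<And>z. z \<in> W \<Longrightarrow> ht z \<noteq> 0"
    and ends: "\<And>s. s \<in> {-\<delta><..<\<delta>} \<Longrightarrow> h (s, c) = h (0, c) \<and> h (s, d) = h (0, d)"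
  shows "((\<lambda>s. integral {c..d} (\<lambda>t. f (h (s, t)) (ht (s, t)))) has_real_derivative
     - integral {c..d} (\<lambda>t. \<Sum>i\<in>UNIV. EL (h (0, t)) (ht (0, t)) (htt (0, t)) i * hs (0, t) $ i)) (at 0)"
proof -
  define \<Phi> where "\<Phi> z = f (h z) (ht z)" for z
  define \<Phi>s where "\<Phi>s z = frechet_derivative \<Phi> (at z) (1, 0)" for z
  have sht: "smooth_on W ht" and shs: "smooth_on W hs"
    unfolding ht_def hs_def by (rule smooth_on_derivative[OF h])+
  have "smooth_on W (\<lambda>z. (\<lambda>z. f (fst z) (snd z)) (h z, ht z))"
    by (rule smooth_on_compose[OF smooth_f[unfolded lsmooth_def] smooth_on_Pair[OF W h sht]])
      (use hU ht0 W open_slit[OF open_U] in auto)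
  then have s\<Phi>: "smooth_on W \<Phi>" by (simp add: \<Phi>_def[abs_def])
  have s\<Phi>s: "smooth_on W \<Phi>s" unfolding \<Phi>s_def[abs_def] by (rule smooth_on_derivative[OF s\<Phi>])
  have inW: "(0, t) \<in> W" if "t \<in> {c..d}" for t using sub that \<delta> by auto
  have hs_ends: "hs (0, e) = 0" if "e = c \<or> e = d" for e
  proof -
    have eq: "h (0, e) = h (s, e)" if "s \<in> {-\<delta><..<\<delta>}" for s
      using ends[OF that] \<open>e = c \<or> e = d\<close> by metis
    have "((\<lambda>s. h (s, e)) has_vector_derivative 0) (at 0)"
    proof (rule has_vector_derivative_transform_within_open)
      show "((\<lambda>s. h (0, e)) has_vector_derivative 0) (at 0)" by simp
      show "0 \<in> {-\<delta><..<\<delta>}" using \<delta> by simp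
    qed (auto intro: eq)
    moreover have "e \<in> {c..d}" using that cd by auto
    ultimately show ?thesis
      using has_derivative_slices(1)[OF h inW, of e] unfolding hs_def
      by (intro vector_derivative_unique_at) auto
  qed
  have \<Phi>s_eq: "\<Phi>s (0, t) = (\<Sum>i\<in>UNIV. hs (0, t) $ i * dx i f (h (0, t)) (ht (0, t)))
      + (\<Sum>i\<in>UNIV. frechet_derivative hs (at (0, t)) (0, 1) $ i * dy i f (h (0, t)) (ht (0, t)))"
    if t: "t \<in> {c..d}" for t
  proof -
    have 1: "((\<lambda>s. f (h (s, t)) (ht (s, t))) has_real_derivative
       (\<Sum>i\<in>UNIV. hs (0, t) $ i * dx i f (h (0, t)) (ht (0, t)))
      + (\<Sum>i\<in>UNIV. frechet_derivative ht (at (0, t)) (1, 0) $ i * dy i f (h (0, t)) (ht (0, t)))) (at 0)"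
      using has_derivative_slices(1)[OF h inW[OF t]] has_derivative_slices(1)[OF sht inW[OF t]]
      by (intro lfun_chain[OF open_U smooth_f, of "\<lambda>s. h (s, t)" 0 "\<lambda>s. ht (s, t)"])
        (use hU ht0 inW[OF t] in \<open>auto simp: hs_def\<close>)
    have 2: "((\<lambda>s. f (h (s, t)) (ht (s, t))) has_real_derivative \<Phi>s (0, t)) (at 0)"
      using has_derivative_slices(1)[OF s\<Phi> inW[OF t]]
      by (simp add: \<Phi>_def \<Phi>s_def has_real_derivative_iff_has_vector_derivative)
    have 3: "frechet_derivative ht (at (0, t)) (1, 0) = frechet_derivative hs (at (0, t)) (0, 1)"
      unfolding ht_def hs_def by (rule second_derivative_symmetric[OF W h inW[OF t]])
    show ?thesis using DERIV_unique[OF 2 1] unfolding 3 .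
  qed
  \<comment> \<open>The boundary term: momentum paired with the variation field. Its derivative is
    the \<open>s\<close>-derivative of the integrand plus \<open>?E\<close>, and it vanishes at both
    ends because the endpoints are fixed.\<close>
  define Q where "Q t = (\<Sum>i\<in>UNIV. dy i f (h (0, t)) (ht (0, t)) * hs (0, t) $ i)" for t
  let ?E = "\<lambda>t. \<Sum>i\<in>UNIV. EL (h (0, t)) (ht (0, t)) (htt (0, t)) i * hs (0, t) $ i"
  have Q': "(Q has_real_derivative (\<Phi>s (0, t) + ?E t)) (at t)" if t: "t \<in> {c..d}" for t
  proof -
    let ?hst = "frechet_derivative hs (at (0, t)) (0, 1)"
    have *: "((\<lambda>t. dy i f (h (0, t)) (ht (0, t))) has_real_derivative
        (\<Sum>j\<in>UNIV. ht (0, t) $ j * dx j (dy i f) (h (0, t)) (ht (0, t)))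
      + (\<Sum>j\<in>UNIV. htt (0, t) $ j * dy j (dy i f) (h (0, t)) (ht (0, t)))) (at t)" for i
      using has_derivative_slices(2)[OF h inW[OF t]] has_derivative_slices(2)[OF sht inW[OF t]]
      by (intro lfun_chain[OF open_U lsmooth_dy[OF open_U smooth_f], of "\<lambda>t. h (0, t)" t "\<lambda>t. ht (0, t)"])
        (use hU ht0 inW[OF t] in \<open>auto simp: ht_def htt_def\<close>)
    have **: "((\<lambda>t. hs (0, t) $ i) has_real_derivative ?hst $ i) (at t)" for i
      using bounded_linear.has_vector_derivative[OF bounded_linear_vec_nth has_derivative_slices(2)[OF shs inW[OF t]]]
      by (simp add: has_real_derivative_iff_has_vector_derivative)
    have "(Q has_real_derivative (\<Sum>i\<in>UNIV.
         ((\<Sum>j\<in>UNIV. ht (0, t) $ j * dx j (dy i f) (h (0, t)) (ht (0, t)))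
        + (\<Sum>j\<in>UNIV. htt (0, t) $ j * dy j (dy i f) (h (0, t)) (ht (0, t)))) * hs (0, t) $ i
        + ?hst $ i * dy i f (h (0, t)) (ht (0, t)))) (at t)"
      unfolding Q_def[abs_def] by (rule DERIV_sum) (rule DERIV_mult[OF * **])
    also have "(\<Sum>i\<in>UNIV.
         ((\<Sum>j\<in>UNIV. ht (0, t) $ j * dx j (dy i f) (h (0, t)) (ht (0, t)))
        + (\<Sum>j\<in>UNIV. htt (0, t) $ j * dy j (dy i f) (h (0, t)) (ht (0, t)))) * hs (0, t) $ i
        + ?hst $ i * dy i f (h (0, t)) (ht (0, t))) = \<Phi>s (0, t) + ?E t"
      unfolding \<Phi>s_eq[OF t] sum.distrib[symmetric] EL_def
      by (intro sum.cong refl) (simp add: algebra_simps)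
    finally show ?thesis .
  qed
  have "((\<lambda>t. \<Phi>s (0, t) + ?E t) has_integral (Q d - Q c)) {c..d}"
    using Q' cd
    by (intro fundamental_theorem_of_calculus)
      (auto simp: has_real_derivative_iff_has_vector_derivative intro: has_vector_derivative_at_within)
  then have "((\<lambda>t. \<Phi>s (0, t) + ?E t) has_integral 0) {c..d}"
    by (simp add: Q_def hs_ends)
  moreover have "continuous_on {c..d} (\<lambda>t. \<Phi>s (0, t))"
    by (rule continuous_on_compose2[OF smooth_on_continuous[OF s\<Phi>s]]) (auto intro!: continuous_intros inW)
  then have int: "(\<lambda>t. \<Phi>s (0, t)) integrable_on {c..d}" by (rule integrable_continuous_real)
  ultimately have "((\<lambda>t. \<Phi>s (0, t) + ?E t - \<Phi>s (0, t)) has_integral 0 - integral {c..d} (\<lambda>t. \<Phi>s (0, t))) {c..d}"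
    by (intro has_integral_diff integrable_integral)
  then have E: "integral {c..d} (\<lambda>t. \<Phi>s (0, t)) = - integral {c..d} ?E"
    by (auto dest!: integral_unique)
  have "((\<lambda>s. integral (cbox c d) (\<lambda>t. \<Phi> (s, t))) has_real_derivative integral (cbox c d) (\<lambda>t. \<Phi>s (0, t)))
    (at 0 within {-\<delta><..<\<delta>})"
  proof (rule leibniz_rule_field_derivative)
    fix s t assume st: "s \<in> {-\<delta><..<\<delta>}" "t \<in> cbox c d"
    then have "(s, t) \<in> W" using sub by auto
    from has_derivative_slices(1)[OF s\<Phi> this]
    show "((\<lambda>s. \<Phi> (s, t)) has_real_derivative \<Phi>s (s, t)) (at s within {-\<delta><..<\<delta>})"
      by (auto simp: \<Phi>s_def has_real_derivative_iff_has_vector_derivative intro: has_vector_derivative_at_within)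
  next
    fix s assume "s \<in> {-\<delta><..<\<delta>}"
    then show "(\<lambda>t. \<Phi> (s, t)) integrable_on cbox c d"
      using sub
      by (intro integrable_continuous continuous_on_compose2[OF smooth_on_continuous[OF s\<Phi>]])
        (auto intro!: continuous_intros)
  next
    have "continuous_on ({-\<delta><..<\<delta>} \<times> cbox c d) \<Phi>s"
      by (rule continuous_on_subset[OF smooth_on_continuous[OF s\<Phi>s]]) (use sub in auto)
    then show "continuous_on ({-\<delta><..<\<delta>} \<times> cbox c d) (\<lambda>(s, t). \<Phi>s (s, t))" by simp
  qed (use \<delta> in auto)
  then show ?thesis
    using \<delta> E by (simp add: at_within_open[of 0 "{-\<delta><..<\<delta>}"] \<Phi>_def)
qed

end

subsection \<open>Charts, velocities and variations\<close>

text \<open>Tube lemma with the second factor reaching beyond \<open>[c, d]\<close>, as the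
  smoothness condition on variations in \<open>length_extremal\<close> demands.\<close>

lemma interval_tube:
  fixes c d :: real
  assumes W: "open W" and sub: "{0} \<times> {c..d} \<subseteq> W" and cd: "c \<le> d"
  obtains \<delta> :: real where "\<delta> > 0" "{-\<delta><..<\<delta>} \<times> {c - \<delta><..<d + \<delta>} \<subseteq> W"
proof -
  have "compact ({0::real} \<times> {c..d})" by (intro compact_Times) auto
  from compact_subset_open_imp_ball_epsilon_subset[OF this W sub]
  obtain e where e: "e > 0" "(\<Union>x\<in>{0} \<times> {c..d}. ball x e) \<subseteq> W" by metis
  have "(s, t) \<in> W" if "s \<in> {-(e/2)<..<e/2}" "t \<in> {c - e/2<..<d + e/2}" for s t
  proof -
    \<comment> \<open>The point of \<open>[c, d]\<close> nearest to \<open>t\<close>. Both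
      coordinate distances stay below \<open>e / 2\<close>, hence the distance in the plane below
      \<open>e\<close>.\<close>
    define t' where "t' = max c (min d t)"
    have t': "t' \<in> {c..d}" using cd by (simp add: t'_def)
    have near: "\<bar>t' - t\<bar> < e/2" "\<bar>s\<bar> < e/2"
      using that e cd unfolding t'_def max_def min_def greaterThanLessThan_iff by (auto split: if_splits)
    have "dist (0, t') (s, t) \<le> dist 0 s + dist t' t"
      unfolding dist_Pair_Pair by (rule sqrt_sum_squares_le_sum) auto
    also have "\<dots> < e" using near unfolding dist_real_def by linarith
    finally have "(s, t) \<in> ball (0, t') e" by simp
    then show ?thesis using e(2) t' by blast
  qed
  then show thesis using e by (intro that[of "e/2"]) auto
qed

locale finsler_manifold =
  fixes X :: "'a topology" and \<A> :: "('a, 'n::finite) chart set" and F :: "'a \<times> ('a, 'n) tvec \<Rightarrow> real"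
  assumes manifold: "smooth_manifold X \<A>" and finsler: "finsler_structure X \<A> F"
begin

lemma chart_open: "\<kappa> \<in> \<A> \<Longrightarrow> openin X (chart_dom \<kappa>)"
  and chart_image_open: "\<kappa> \<in> \<A> \<Longrightarrow> open (chart_image \<kappa>)"
  and chart_homeomorphic: "\<kappa> \<in> \<A> \<Longrightarrow>
    homeomorphic_map (subtopology X (chart_dom \<kappa>)) (top_of_set (chart_image \<kappa>)) (chart_map \<kappa>)"
  and transition_smooth: "\<kappa> \<in> \<A> \<Longrightarrow> \<kappa>' \<in> \<A> \<Longrightarrow>
    smooth_on (chart_map \<kappa> ` (chart_dom \<kappa> \<inter> chart_dom \<kappa>')) (transition \<kappa> \<kappa>')"
  using manifold unfolding smooth_manifold_def by auto

lemma chart_around: "p \<in> topspace X \<Longrightarrow> \<exists>\<kappa>\<in>\<A>. p \<in> chart_dom \<kappa>"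
  using manifold unfolding smooth_manifold_def by blast

lemma chart_dom_subset: "\<kappa> \<in> \<A> \<Longrightarrow> chart_dom \<kappa> \<subseteq> topspace X"
  by (rule openin_subset[OF chart_open])

lemma chart_inj: "\<kappa> \<in> \<A> \<Longrightarrow> inj_on (chart_map \<kappa>) (chart_dom \<kappa>)"
  using homeomorphic_imp_injective_map[OF chart_homeomorphic] chart_dom_subset
  by (metis topspace_subtopology_subset)

lemma chart_inv_map [simp]: "\<kappa> \<in> \<A> \<Longrightarrow> p \<in> chart_dom \<kappa> \<Longrightarrow> chart_inv \<kappa> (chart_map \<kappa> p) = p"
  unfolding chart_inv_def by (rule inv_into_f_f[OF chart_inj])

lemma chart_map_in_image: "p \<in> chart_dom \<kappa> \<Longrightarrow> chart_map \<kappa> p \<in> chart_image \<kappa>"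
  unfolding chart_image_def by auto

lemma chart_map_inv [simp]: "x \<in> chart_image \<kappa> \<Longrightarrow> chart_map \<kappa> (chart_inv \<kappa> x) = x"
  unfolding chart_image_def chart_inv_def by (rule f_inv_into_f)

lemma chart_inv_in_dom: "x \<in> chart_image \<kappa> \<Longrightarrow> chart_inv \<kappa> x \<in> chart_dom \<kappa>"
  unfolding chart_image_def chart_inv_def by (rule inv_into_into)

lemma chart_open_image:
  assumes \<kappa>: "\<kappa> \<in> \<A>" and V: "openin X V"
  shows "open (chart_map \<kappa> ` (chart_dom \<kappa> \<inter> V))"
proof -
  have "openin (subtopology X (chart_dom \<kappa>)) (chart_dom \<kappa> \<inter> V)"
    using V by (auto simp: openin_subtopology)
  then have "openin (top_of_set (chart_image \<kappa>)) (chart_map \<kappa> ` (chart_dom \<kappa> \<inter> V))"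
    using homeomorphic_imp_open_map[OF chart_homeomorphic[OF \<kappa>]] by (simp add: open_map_def)
  then show ?thesis using chart_image_open[OF \<kappa>] by (simp add: openin_open_eq)
qed

lemma chart_inv_continuous:
  assumes \<kappa>: "\<kappa> \<in> \<A>"
  shows "continuous_map (top_of_set (chart_image \<kappa>)) X (chart_inv \<kappa>)"
  unfolding continuous_map_def
proof (intro conjI allI impI)
  show "chart_inv \<kappa> \<in> topspace (top_of_set (chart_image \<kappa>)) \<rightarrow> topspace X"
    using chart_inv_in_dom chart_dom_subset[OF \<kappa>] by fastforce
  fix V assume V: "openin X V"
  have "{x \<in> topspace (top_of_set (chart_image \<kappa>)). chart_inv \<kappa> x \<in> V} = chart_map \<kappa> ` (chart_dom \<kappa> \<inter> V)"
  proof (intro equalityI subsetI)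
    fix x assume "x \<in> {x \<in> topspace (top_of_set (chart_image \<kappa>)). chart_inv \<kappa> x \<in> V}"
    then show "x \<in> chart_map \<kappa> ` (chart_dom \<kappa> \<inter> V)"
      using chart_inv_in_dom[of x \<kappa>] by (intro image_eqI[of _ _ "chart_inv \<kappa> x"]) auto
  qed (use \<kappa> in \<open>auto simp: chart_map_in_image\<close>)
  then show "openin (top_of_set (chart_image \<kappa>)) {x \<in> topspace (top_of_set (chart_image \<kappa>)). chart_inv \<kappa> x \<in> V}"
    using chart_open_image[OF \<kappa> V] by (auto simp: chart_image_def intro!: open_subset)
qed

lemma open_preimage:
  assumes "continuous_map (top_of_set W) X H" "open W" "openin X V"
  shows "open {w \<in> W. H w \<in> V}"
proof -
  have "openin (top_of_set W) {w \<in> W. H w \<in> V}"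
    using openin_continuous_map_preimage[OF assms(1,3)] by simp
  then show ?thesis using assms(2) by (simp add: openin_open_eq)
qed

lemma transition_chart: "\<kappa> \<in> \<A> \<Longrightarrow> p \<in> chart_dom \<kappa> \<Longrightarrow> transition \<kappa> \<kappa>' (chart_map \<kappa> p) = chart_map \<kappa>' p"
  by (simp add: transition_def)

lemma transition_has_derivative:
  assumes "\<kappa> \<in> \<A>" "\<kappa>' \<in> \<A>" "p \<in> chart_dom \<kappa>" "p \<in> chart_dom \<kappa>'"
  shows "(transition \<kappa> \<kappa>' has_derivative frechet_derivative (transition \<kappa> \<kappa>') (at (chart_map \<kappa> p))) (at (chart_map \<kappa> p))"
  using assms by (intro smooth_on_has_derivative[OF transition_smooth]) auto

text \<open>Chain rule for the cocycle identity of the coordinate changes. Homogeneity and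
  nonnegativity of \<open>F\<close> are assumed on the tangent bundle, so coordinate vectors must be
  seen to lie in it.\<close>

lemma coord_tvec_tangent:
  assumes \<kappa>: "\<kappa> \<in> \<A>" and x: "x \<in> chart_image \<kappa>"
  shows "(chart_inv \<kappa> x, coord_tvec \<A> \<kappa> x y) \<in> tangent_bundle X \<A>"
proof -
  define p where "p = chart_inv \<kappa> x"
  have p: "p \<in> chart_dom \<kappa>" "chart_map \<kappa> p = x" using x by (auto simp: p_def chart_inv_in_dom)
  have "coord_tvec \<A> \<kappa> x y \<in> tangent_space \<A> p"
    unfolding tangent_space_def
  proof (intro CollectI conjI ballI allI impI)
    fix \<kappa>1 \<kappa>2 assume \<kappa>12: "\<kappa>1 \<in> \<A>" "\<kappa>2 \<in> \<A>" and p12: "p \<in> chart_dom \<kappa>1 \<and> p \<in> chart_dom \<kappa>2"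
    let ?N = "chart_map \<kappa> ` (chart_dom \<kappa> \<inter> (chart_dom \<kappa>1 \<inter> chart_dom \<kappa>2))"
    have N: "open ?N" "x \<in> ?N"
      using chart_open_image[OF \<kappa> openin_Int[OF chart_open[OF \<kappa>12(1)] chart_open[OF \<kappa>12(2)]]] p p12 by auto
    have D1: "(transition \<kappa> \<kappa>1 has_derivative frechet_derivative (transition \<kappa> \<kappa>1) (at x)) (at x)"
      using transition_has_derivative[OF \<kappa> \<kappa>12(1) p(1)] p12 p(2) by simp
    have D2: "(transition \<kappa>1 \<kappa>2 has_derivative frechet_derivative (transition \<kappa>1 \<kappa>2) (at (chart_map \<kappa>1 p)))
        (at (transition \<kappa> \<kappa>1 x))"
      using transition_has_derivative[OF \<kappa>12] p12 p transition_chart[OF \<kappa> p(1), of \<kappa>1] by simp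
    have "((transition \<kappa>1 \<kappa>2 \<circ> transition \<kappa> \<kappa>1) has_derivative
        (frechet_derivative (transition \<kappa>1 \<kappa>2) (at (chart_map \<kappa>1 p)) \<circ> frechet_derivative (transition \<kappa> \<kappa>1) (at x))) (at x)"
      by (rule diff_chain_at[OF D1 D2])
    then have "(transition \<kappa> \<kappa>2 has_derivative
        (frechet_derivative (transition \<kappa>1 \<kappa>2) (at (chart_map \<kappa>1 p)) \<circ> frechet_derivative (transition \<kappa> \<kappa>1) (at x))) (at x)"
      by (rule has_derivative_transform_within_open[OF _ N]) (use \<kappa> \<kappa>12 in \<open>auto simp: transition_def\<close>)
    from frechet_derivative_at[OF this]
    show "coord_tvec \<A> \<kappa> x y \<kappa>2 =
        frechet_derivative (transition \<kappa>1 \<kappa>2) (at (chart_map \<kappa>1 p)) (coord_tvec \<A> \<kappa> x y \<kappa>1)"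
      using \<kappa>12 p12 by (auto simp: coord_tvec_def p_def[symmetric] o_def dest!: fun_cong[of _ _ y])
  qed (auto simp: coord_tvec_def p_def)
  then show ?thesis
    unfolding tangent_bundle_def using p chart_dom_subset[OF \<kappa>] by (auto simp: p_def)
qed

lemma linear_transition_derivative:
  assumes \<kappa>: "\<kappa> \<in> \<A>" and x: "x \<in> chart_image \<kappa>" and \<kappa>': "\<kappa>' \<in> \<A>" "chart_inv \<kappa> x \<in> chart_dom \<kappa>'"
  shows "linear (frechet_derivative (transition \<kappa> \<kappa>') (at x))"
  using transition_has_derivative[OF \<kappa> \<kappa>'(1) chart_inv_in_dom[OF x] \<kappa>'(2)] x
  by (auto dest: has_derivative_linear)

lemma coord_tvec_scale:
  assumes "\<kappa> \<in> \<A>" "x \<in> chart_image \<kappa>"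
  shows "coord_tvec \<A> \<kappa> x (c *\<^sub>R y) = (\<lambda>\<kappa>'. c *\<^sub>R coord_tvec \<A> \<kappa> x y \<kappa>')"
  using linear_transition_derivative[OF assms] by (auto simp: coord_tvec_def fun_eq_iff linear_scale)

lemma finsler_domain_chart:
  assumes \<kappa>: "\<kappa> \<in> \<A>"
  shows "finsler_domain (chart_image \<kappa>) (local_rep \<A> F \<kappa>)"
proof
  show "open (chart_image \<kappa>)" by (rule chart_image_open[OF \<kappa>])
  show "lsmooth (chart_image \<kappa>) (local_rep \<A> F \<kappa>)"
    using finsler \<kappa> by (auto simp: lsmooth_def finsler_structure_def split_beta')
  show "homogeneous_on (chart_image \<kappa>) 1 (local_rep \<A> F \<kappa>)"
    unfolding homogeneous_on_def
  proof (intro ballI allI impI)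
    fix x y and c :: real assume x: "x \<in> chart_image \<kappa>" and "0 < c"
    then show "local_rep \<A> F \<kappa> x (c *\<^sub>R y) = c ^ 1 * local_rep \<A> F \<kappa> x y"
      using finsler coord_tvec_tangent[OF \<kappa> x, of y]
      by (auto simp: finsler_structure_def local_rep_def coord_tvec_scale[OF \<kappa> x])
  qed
  show "0 \<le> local_rep \<A> F \<kappa> x y" if "x \<in> chart_image \<kappa>" for x y
    using finsler coord_tvec_tangent[OF \<kappa> that, of y] by (auto simp: finsler_structure_def local_rep_def)
  show "positive_definite (\<chi> i j. fund_tensor (local_rep \<A> F \<kappa>) i j x y)"
    if "x \<in> chart_image \<kappa>" "y \<noteq> 0" for x y
    using finsler \<kappa> that by (auto simp: finsler_structure_def)
qed

text \<open>The components of a velocity in two charts are related by the derivative of the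
  transition, so one chart determines the whole family and suffices to compute the length
  integrand.\<close>

lemma velocity_eq_coord_tvec:
  assumes \<kappa>: "\<kappa> \<in> \<A>" and I: "open I" "t \<in> I" and cont: "continuous_map (top_of_set I) X \<gamma>"
    and dom: "\<gamma> t \<in> chart_dom \<kappa>" and D: "((chart_map \<kappa> \<circ> \<gamma>) has_vector_derivative v) (at t)"
  shows "velocity \<A> \<gamma> t = coord_tvec \<A> \<kappa> (chart_map \<kappa> (\<gamma> t)) v"
proof
  fix \<kappa>'
  show "velocity \<A> \<gamma> t \<kappa>' = coord_tvec \<A> \<kappa> (chart_map \<kappa> (\<gamma> t)) v \<kappa>'"
  proof (cases "\<kappa>' \<in> \<A> \<and> \<gamma> t \<in> chart_dom \<kappa>'")
    case True
    let ?T = "transition \<kappa> \<kappa>'"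
    have T: "(?T has_derivative frechet_derivative ?T (at (chart_map \<kappa> (\<gamma> t)))) (at ((chart_map \<kappa> \<circ> \<gamma>) t))"
      using transition_has_derivative[OF \<kappa> _ dom] True by simp
    have 1: "(?T \<circ> (chart_map \<kappa> \<circ> \<gamma>) has_vector_derivative frechet_derivative ?T (at (chart_map \<kappa> (\<gamma> t))) v) (at t)"
      using diff_chain_at[OF D[unfolded has_vector_derivative_def] T]
      by (simp add: has_vector_derivative_def o_def linear_scale[OF has_derivative_linear[OF T]])
    have "open {s \<in> I. \<gamma> s \<in> chart_dom \<kappa>}" by (rule open_preimage[OF cont I(1) chart_open[OF \<kappa>]])
    from has_vector_derivative_transform_within_open[OF 1 this, of "chart_map \<kappa>' \<circ> \<gamma>"]
    have "(chart_map \<kappa>' \<circ> \<gamma> has_vector_derivative frechet_derivative ?T (at (chart_map \<kappa> (\<gamma> t))) v) (at t)"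
      using I dom \<kappa> by (auto simp: transition_def)
    then show ?thesis
      using True \<kappa> dom by (auto simp: velocity_def coord_tvec_def vector_derivative_at)
  next
    case False
    then show ?thesis using \<kappa> dom by (auto simp: velocity_def coord_tvec_def)
  qed
qed

lemma length_integrand_eq:
  assumes \<kappa>: "\<kappa> \<in> \<A>" and "open I" "t \<in> I" and "continuous_map (top_of_set I) X \<gamma>"
    and dom: "\<gamma> t \<in> chart_dom \<kappa>" and "((chart_map \<kappa> \<circ> \<gamma>) has_vector_derivative v) (at t)"
  shows "F (\<gamma> t, velocity \<A> \<gamma> t) = local_rep \<A> F \<kappa> (chart_map \<kappa> (\<gamma> t)) v"
  unfolding local_rep_def velocity_eq_coord_tvec[OF assms] using \<kappa> dom by simp

text \<open>Variations are built in one chart, but \<open>smooth_into\<close> tests every chart;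
  composing with a transition map supplies the others.\<close>

lemma smooth_into_chart_inv:
  fixes h :: "'e::euclidean_space \<Rightarrow> real ^ 'n"
  assumes \<kappa>: "\<kappa> \<in> \<A>" and W: "open W" and h: "smooth_on W h" and im: "h ` W \<subseteq> chart_image \<kappa>"
  shows "smooth_into X \<A> W (chart_inv \<kappa> \<circ> h)"
  unfolding smooth_into_def
proof (intro conjI ballI)
  have "continuous_map (top_of_set W) (top_of_set (chart_image \<kappa>)) h"
    using smooth_on_continuous[OF h] im by (auto simp: continuous_map_in_subtopology)
  then show cont: "continuous_map (top_of_set W) X (chart_inv \<kappa> \<circ> h)"
    by (rule continuous_map_compose[OF _ chart_inv_continuous[OF \<kappa>]])
  fix \<kappa>' assume \<kappa>': "\<kappa>' \<in> \<A>"
  let ?V = "{w \<in> W. (chart_inv \<kappa> \<circ> h) w \<in> chart_dom \<kappa>'}"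
  have "smooth_on ?V (\<lambda>w. transition \<kappa> \<kappa>' (h w))"
  proof (rule smooth_on_compose[OF transition_smooth[OF \<kappa> \<kappa>'] smooth_on_subset[OF h]])
    show "open ?V" by (rule open_preimage[OF cont W chart_open[OF \<kappa>']])
    show "open (chart_map \<kappa> ` (chart_dom \<kappa> \<inter> chart_dom \<kappa>'))"
      by (rule chart_open_image[OF \<kappa> chart_open[OF \<kappa>']])
    show "h ` ?V \<subseteq> chart_map \<kappa> ` (chart_dom \<kappa> \<inter> chart_dom \<kappa>')"
    proof
      fix x assume "x \<in> h ` ?V"
      then obtain w where w: "x = h w" "w \<in> W" "chart_inv \<kappa> (h w) \<in> chart_dom \<kappa>'" by auto
      then have "h w \<in> chart_image \<kappa>" using im by auto
      then show "x \<in> chart_map \<kappa> ` (chart_dom \<kappa> \<inter> chart_dom \<kappa>')"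
        using w chart_inv_in_dom[of "h w" \<kappa>] by (intro image_eqI[of _ _ "chart_inv \<kappa> (h w)"]) auto
    qed
  qed auto
  then show "smooth_on ?V (chart_map \<kappa>' \<circ> (chart_inv \<kappa> \<circ> h))"
    by (simp add: transition_def o_def)
qed

lemma smooth_into_subset:
  assumes "smooth_into X \<A> W H" "W' \<subseteq> W"
  shows "smooth_into X \<A> W' H"
  using assms unfolding smooth_into_def
  by (auto intro: continuous_map_from_subtopology_mono elim!: smooth_on_subset)

lemma smooth_into_chart:
  assumes "smooth_into X \<A> W H" "\<kappa> \<in> \<A>" "\<And>w. w \<in> W' \<Longrightarrow> w \<in> W \<and> H w \<in> chart_dom \<kappa>"
  shows "smooth_on W' (chart_map \<kappa> \<circ> H)"
  by (rule smooth_on_subset[of "{w \<in> W. H w \<in> chart_dom \<kappa>}"])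
    (use assms in \<open>auto simp: smooth_into_def\<close>)

text \<open>The chart expression of length is valid for \<open>s\<close> near 0, which is enough for
  a derivative at 0, so \<open>first_variation\<close> carries over to the manifold.\<close>

lemma curve_length_variation:
  fixes H :: "real \<times> real \<Rightarrow> 'a" and c d \<delta> :: real and \<kappa>
  defines "h \<equiv> chart_map \<kappa> \<circ> H"
  defines "ht \<equiv> \<lambda>z. frechet_derivative h (at z) (0, 1)"
  defines "htt \<equiv> \<lambda>z. frechet_derivative ht (at z) (0, 1)"
  defines "hs \<equiv> \<lambda>z. frechet_derivative h (at z) (1, 0)"
  defines "W \<equiv> {-\<delta><..<\<delta>} \<times> {c - \<delta><..<d + \<delta>}"
  assumes \<kappa>: "\<kappa> \<in> \<A>" and \<delta>: "\<delta> > 0" and cd: "c < d" and H: "smooth_into X \<A> W H"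
    and dom: "\<And>z. z \<in> W \<Longrightarrow> H z \<in> chart_dom \<kappa>" and ht0: "\<And>z. z \<in> W \<Longrightarrow> ht z \<noteq> 0"
    and ends: "\<And>s. s \<in> {-\<delta><..<\<delta>} \<Longrightarrow> H (s, c) = H (0, c) \<and> H (s, d) = H (0, d)"
  shows "((\<lambda>s. curve_length \<A> F c d (\<lambda>t. H (s, t))) has_real_derivative
     - integral {c..d} (\<lambda>t. \<Sum>i\<in>UNIV. finsler_domain.EL (local_rep \<A> F \<kappa>) (h (0, t)) (ht (0, t)) (htt (0, t)) i
         * hs (0, t) $ i)) (at 0)"
proof -
  interpret finsler_domain "chart_image \<kappa>" "local_rep \<A> F \<kappa>" by (rule finsler_domain_chart[OF \<kappa>])
  have W: "open W" unfolding W_def by (intro open_Times) auto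
  have h: "smooth_on W h" unfolding h_def by (rule smooth_into_chart[OF H \<kappa>]) (use dom in auto)
  have "((\<lambda>s. integral {c..d} (\<lambda>t. local_rep \<A> F \<kappa> (h (s, t)) (ht (s, t)))) has_real_derivative
     - integral {c..d} (\<lambda>t. \<Sum>i\<in>UNIV. EL (h (0, t)) (ht (0, t)) (htt (0, t)) i * hs (0, t) $ i)) (at 0)"
    unfolding ht_def htt_def hs_def
  proof (rule first_variation[OF W h \<delta> cd])
    show "{- \<delta><..<\<delta>} \<times> {c..d} \<subseteq> W" using \<delta> by (auto simp: W_def)
    show "h z \<in> chart_image \<kappa>" if "z \<in> W" for z using dom[OF that] by (simp add: h_def chart_map_in_image)
    show "frechet_derivative h (at z) (0, 1) \<noteq> 0" if "z \<in> W" for z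
      using ht0[OF that] by (simp add: ht_def)
    show "h (s, c) = h (0, c) \<and> h (s, d) = h (0, d)" if "s \<in> {- \<delta><..<\<delta>}" for s
      using ends[OF that] by (simp add: h_def)
  qed
  moreover have "integral {c..d} (\<lambda>t. local_rep \<A> F \<kappa> (h (s, t)) (ht (s, t))) = curve_length \<A> F c d (\<lambda>t. H (s, t))"
    if s: "s \<in> {-\<delta><..<\<delta>}" for s
    unfolding curve_length_def
  proof (rule integral_cong)
    fix t assume t: "t \<in> {c..d}"
    then have st: "(s, t) \<in> W" using s \<delta> by (auto simp: W_def)
    have cont: "continuous_map (top_of_set {c - \<delta><..<d + \<delta>}) X (\<lambda>t. H (s, t))"
    proof -
      have "continuous_map (top_of_set {c - \<delta><..<d + \<delta>}) (top_of_set W) (\<lambda>t. (s, t))"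
        using s by (auto simp: continuous_map_in_subtopology W_def intro!: continuous_intros)
      from continuous_map_compose[OF this, of X H] H show ?thesis by (simp add: smooth_into_def o_def)
    qed
    have "((chart_map \<kappa> \<circ> (\<lambda>t. H (s, t))) has_vector_derivative ht (s, t)) (at t)"
      using has_derivative_slices(2)[OF h st] by (simp add: ht_def h_def o_def)
    from length_integrand_eq[OF \<kappa> _ _ cont _ this]
    show "local_rep \<A> F \<kappa> (h (s, t)) (ht (s, t)) = F (H (s, t), velocity \<A> (\<lambda>t. H (s, t)) t)"
      using t \<delta> dom[OF st] by (simp add: h_def)
  qed
  ultimately show ?thesis
    using \<delta> by (auto elim!: has_field_derivative_transform_within_open[of _ _ _ "{-\<delta><..<\<delta>}"])
qed

end

subsection \<open>Geodesics and the Euler-Lagrange equation\<close>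

lemma smooth_curve_derivative:
  fixes c :: "real \<Rightarrow> 'b::real_normed_vector"
  assumes J: "open J" and c: "smooth_on J c"
  shows "t \<in> J \<Longrightarrow> (c has_vector_derivative vector_derivative c (at t)) (at t)"
    and "smooth_on J (\<lambda>t. vector_derivative c (at t))"
proof -
  show "t \<in> J \<Longrightarrow> (c has_vector_derivative vector_derivative c (at t)) (at t)"
    using smooth_on_differentiable[OF c] by (simp add: vector_derivative_works)
  have "frechet_derivative c (at t) 1 = vector_derivative c (at t)" if "t \<in> J" for t
    using frechet_derivative_eq_vector_derivative[OF smooth_on_differentiable[OF c that]] by simp
  then show "smooth_on J (\<lambda>t. vector_derivative c (at t))"
    using smooth_on_derivative[OF c, of 1]
      smooth_on_cong[OF J, of "\<lambda>t. frechet_derivative c (at t) 1" "\<lambda>t. vector_derivative c (at t)"] by simp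
qed

text \<open>\<open>J\<close> is open so that the identity for the velocity holds near
  \<open>t\<close> and can be differentiated once more.\<close>

lemma variation_center:
  fixes h :: "real \<times> real \<Rightarrow> 'b::real_normed_vector"
  assumes h: "smooth_on W h" and J: "open J" and c: "\<And>s. s \<in> J \<Longrightarrow> (0, s) \<in> W \<and> h (0, s) = c s" and t: "t \<in> J"
  shows "frechet_derivative h (at (0, t)) (0, 1) = vector_derivative c (at t)"
    and "frechet_derivative (\<lambda>z. frechet_derivative h (at z) (0, 1)) (at (0, t)) (0, 1)
      = vector_derivative (\<lambda>s. vector_derivative c (at s)) (at t)"
proof -
  have 1: "frechet_derivative h (at (0, t)) (0, 1) = vector_derivative c (at t)" if "t \<in> J" for t
  proof -
    have "(c has_vector_derivative frechet_derivative h (at (0, t)) (0, 1)) (at t)"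
      by (rule has_vector_derivative_transform_within_open[OF has_derivative_slices(2)[OF h] J that])
        (use c that in auto)
    then show ?thesis by (simp add: vector_derivative_at)
  qed
  then show "frechet_derivative h (at (0, t)) (0, 1) = vector_derivative c (at t)" using t .
  have "((\<lambda>s. vector_derivative c (at s)) has_vector_derivative
      frechet_derivative (\<lambda>z. frechet_derivative h (at z) (0, 1)) (at (0, t)) (0, 1)) (at t)"
    by (rule has_vector_derivative_transform_within_open[OF has_derivative_slices(2)[OF smooth_on_derivative[OF h]] J t])
      (use c t 1 in auto)
  then show "frechet_derivative (\<lambda>z. frechet_derivative h (at z) (0, 1)) (at (0, t)) (0, 1)
      = vector_derivative (\<lambda>s. vector_derivative c (at s)) (at t)"
    by (simp add: vector_derivative_at)
qed

lemma (in finsler_domain) continuous_on_EL: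
  assumes "continuous_on J x" "continuous_on J y" "continuous_on J z"
    and "\<And>s. s \<in> J \<Longrightarrow> x s \<in> U" "\<And>s. s \<in> J \<Longrightarrow> y s \<noteq> 0"
  shows "continuous_on J (\<lambda>s. EL (x s) (y s) (z s) i)"
proof -
  have u: "continuous_on J (\<lambda>s. u (x s) (y s))" if "lsmooth U u" for u
    using continuous_on_compose2[OF smooth_on_continuous[OF that[unfolded lsmooth_def]]
        continuous_on_Pair[OF assms(1,2)]] assms(4,5) by auto
  show ?thesis
    unfolding EL_def by (intro continuous_intros assms u lsmooth_intros)
qed

context finsler_manifold
begin

definition chart_EL :: "('a, 'n) chart \<Rightarrow> (real \<Rightarrow> 'a) \<Rightarrow> real \<Rightarrow> 'n \<Rightarrow> real" where
  "chart_EL \<kappa> \<gamma> t i = (let c = chart_map \<kappa> \<circ> \<gamma>; c' = (\<lambda>s. vector_derivative c (at s)) in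
     finsler_domain.EL (local_rep \<A> F \<kappa>) (c t) (c' t) (vector_derivative c' (at t)) i)"

lemma regular_curve_chart:
  fixes \<gamma> :: "real \<Rightarrow> 'a" and \<kappa> :: "('a, 'n) chart"
  defines "c \<equiv> chart_map \<kappa> \<circ> \<gamma>"
  assumes \<gamma>: "regular_curve X \<A> I \<gamma>" and I: "open I" and \<kappa>: "\<kappa> \<in> \<A>"
  shows "open {s \<in> I. \<gamma> s \<in> chart_dom \<kappa>}" and "smooth_on {s \<in> I. \<gamma> s \<in> chart_dom \<kappa>} c"
    and "s \<in> I \<Longrightarrow> \<gamma> s \<in> chart_dom \<kappa> \<Longrightarrow> (c has_vector_derivative vector_derivative c (at s)) (at s)"
    and "s \<in> I \<Longrightarrow> \<gamma> s \<in> chart_dom \<kappa> \<Longrightarrow> velocity \<A> \<gamma> s = coord_tvec \<A> \<kappa> (c s) (vector_derivative c (at s))"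
    and "s \<in> I \<Longrightarrow> \<gamma> s \<in> chart_dom \<kappa> \<Longrightarrow> vector_derivative c (at s) \<noteq> 0"
proof -
  have smooth: "smooth_into X \<A> I \<gamma>" using \<gamma> by (simp add: regular_curve_def)
  then have cont: "continuous_map (top_of_set I) X \<gamma>" by (simp add: smooth_into_def)
  show J: "open {s \<in> I. \<gamma> s \<in> chart_dom \<kappa>}" by (rule open_preimage[OF cont I chart_open[OF \<kappa>]])
  show c: "smooth_on {s \<in> I. \<gamma> s \<in> chart_dom \<kappa>} c"
    unfolding c_def by (rule smooth_into_chart[OF smooth \<kappa>]) auto
  assume s: "s \<in> I" "\<gamma> s \<in> chart_dom \<kappa>"
  show D: "(c has_vector_derivative vector_derivative c (at s)) (at s)"
    by (rule smooth_curve_derivative(1)[OF J c]) (use s in auto)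
  show v: "velocity \<A> \<gamma> s = coord_tvec \<A> \<kappa> (c s) (vector_derivative c (at s))"
    using velocity_eq_coord_tvec[OF \<kappa> I s(1) cont s(2) D[unfolded c_def]] by (simp add: c_def)
  show "vector_derivative c (at s) \<noteq> 0"
  proof
    assume "vector_derivative c (at s) = 0"
    then have "velocity \<A> \<gamma> s = (\<lambda>_. 0)"
      using v coord_tvec_scale[OF \<kappa>, of "c s" 0 0] s by (simp add: c_def chart_map_in_image)
    then show False using \<gamma> s by (simp add: regular_curve_def)
  qed
qed

text \<open>Fundamental lemma of the calculus of variations: if the covector \<open>E t\<close> were
  nonzero, it could be tested against a field in the constant direction \<open>E t\<close>, weighted
  to vanish at the ends of a small interval.\<close>

lemma extremal_imp_EL:
  assumes \<gamma>: "regular_curve X \<A> I \<gamma>" and I: "open I" "t \<in> I" and \<kappa>: "\<kappa> \<in> \<A>" "\<gamma> t \<in> chart_dom \<kappa>"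
    and e: "e > 0" and ext: "\<And>c d. t - e \<le> c \<Longrightarrow> c < d \<Longrightarrow> d \<le> t + e \<Longrightarrow> length_extremal X \<A> F c d \<gamma>"
  shows "chart_EL \<kappa> \<gamma> t i = 0"
proof -
  interpret finsler_domain "chart_image \<kappa>" "local_rep \<A> F \<kappa>" by (rule finsler_domain_chart[OF \<kappa>(1)])
  define c where "c = chart_map \<kappa> \<circ> \<gamma>"
  define c' where "c' s = vector_derivative c (at s)" for s
  define c'' where "c'' s = vector_derivative c' (at s)" for s
  define J where "J = {s \<in> I. \<gamma> s \<in> chart_dom \<kappa>}"
  note reg = regular_curve_chart[OF \<gamma> I(1) \<kappa>(1), folded c_def J_def, folded c'_def]
  have J: "open J" "t \<in> J" and sc: "smooth_on J c" using reg(1,2) I \<kappa> by (auto simp: J_def)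
  have sc': "smooth_on J c'" unfolding c'_def[abs_def] by (rule smooth_curve_derivative(2)[OF J(1) sc])
  have sc'': "smooth_on J c''" unfolding c''_def[abs_def] by (rule smooth_curve_derivative(2)[OF J(1) sc'])
  have cU: "c s \<in> chart_image \<kappa>" and c'0: "c' s \<noteq> 0" if "s \<in> J" for s
    using reg(5)[of s] that by (auto simp: J_def c_def chart_map_in_image)
  define E where "E s = (\<chi> i. EL (c s) (c' s) (c'' s) i)" for s
  have contE: "continuous_on J E"
    unfolding E_def[abs_def]
    by (intro continuous_on_vec_lambda continuous_on_EL smooth_on_continuous sc sc' sc'' cU c'0)
  have "E t = 0"
  proof (rule ccontr)
    assume nz: "E t \<noteq> 0"
    \<comment> \<open>A constant direction; by continuity the pairing \<open>E s \<bullet> v\<close>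
      stays positive near \<open>t\<close>.\<close>
    define v where "v = E t"
    have "open (J \<inter> (\<lambda>s. E s \<bullet> v) -` {0<..})"
      by (intro continuous_open_preimage continuous_intros contE J)
    moreover have "t \<in> J \<inter> (\<lambda>s. E s \<bullet> v) -` {0<..}" using J nz by (simp add: v_def)
    ultimately obtain r0 where r0: "r0 > 0" "cball t r0 \<subseteq> J \<inter> (\<lambda>s. E s \<bullet> v) -` {0<..}"
      using open_contains_cball by metis
    define r where "r = min r0 e"
    have r: "r > 0" "r \<le> e" "r \<le> r0" using r0 e by (auto simp: r_def)
    define c0 where "c0 = t - r"
    define d0 where "d0 = t + r"
    have cd: "c0 < d0" "t - e \<le> c0" "d0 \<le> t + e" using r by (auto simp: c0_def d0_def)
    have inK: "s \<in> J" "E s \<bullet> v > 0" if "s \<in> {c0..d0}" for s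
    proof -
      have "s \<in> cball t r0" using that r by (auto simp: c0_def d0_def dist_real_def)
      then show "s \<in> J" "E s \<bullet> v > 0" using r0(2) by auto
    qed
    \<comment> \<open>Variations need only fix the endpoints, so a quadratic weight replaces the usual bump function.\<close>
    define \<phi> where "\<phi> s = (s - c0) * (d0 - s)" for s
    define h where "h z = c (snd z) + (fst z * \<phi> (snd z)) *\<^sub>R v" for z
    have op: "open (UNIV \<times> J :: (real \<times> real) set)" using J by (intro open_Times) auto
    have sh: "smooth_on (UNIV \<times> J) h"
      unfolding h_def[abs_def] \<phi>_def
      by (intro smooth_intros op smooth_on_compose[OF sc smooth_on_snd[OF op]] J) auto
    define ht where "ht z = frechet_derivative h (at z) (0, 1)" for z
    have sht: "smooth_on (UNIV \<times> J) ht" unfolding ht_def[abs_def] by (rule smooth_on_derivative[OF sh])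
    \<comment> \<open>Here the varied curves remain in the chart with nonzero velocity, so that the
      first variation formula applies; a tube around the central curve lies inside.\<close>
    define W where "W = ((UNIV \<times> J) \<inter> h -` chart_image \<kappa>) \<inter> ((UNIV \<times> J) \<inter> ht -` (- {0}))"
    have W: "open W"
      unfolding W_def
      by (intro open_Int continuous_open_preimage smooth_on_continuous sh sht op open_U) auto
    have h0: "h (0, s) = c s" for s by (simp add: h_def)
    have ht0: "ht (0, s) = c' s" if "s \<in> J" for s
      unfolding ht_def c'_def by (rule variation_center(1)[OF sh J(1) _ that]) (auto simp: h0)
    have "{0} \<times> {c0..d0} \<subseteq> W" using inK(1) cU c'0 by (auto simp: W_def h0 ht0)
    from interval_tube[OF W this] cd obtain \<delta> where \<delta>: "\<delta> > 0"
      "{-\<delta><..<\<delta>} \<times> {c0 - \<delta><..<d0 + \<delta>} \<subseteq> W" by force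
    define B where "B = {-\<delta><..<\<delta>} \<times> {c0 - \<delta><..<d0 + \<delta>}"
    have B: "open B" "B \<subseteq> W" using \<delta> by (auto simp: B_def intro!: open_Times)
    have BJ: "B \<subseteq> UNIV \<times> J" using B by (auto simp: W_def)
    have im: "h z \<in> chart_image \<kappa>" if "z \<in> B" for z using B that by (auto simp: W_def)
    define H where "H = chart_inv \<kappa> \<circ> h"
    have sH: "smooth_into X \<A> B H"
      unfolding H_def by (rule smooth_into_chart_inv[OF \<kappa>(1) B(1) smooth_on_subset[OF sh BJ]]) (use im in auto)
    have H0: "H (0, s) = \<gamma> s" if "s \<in> J" for s
      using that \<kappa>(1) by (simp add: H_def h0 c_def J_def)
    have ends: "H (s, c0) = \<gamma> c0 \<and> H (s, d0) = \<gamma> d0" for s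
      using H0[of c0] H0[of d0] inK(1)[of c0] inK(1)[of d0] cd by (simp add: H_def h_def \<phi>_def)
    have "((\<lambda>s. curve_length \<A> F c0 d0 (\<lambda>t. H (s, t))) has_real_derivative 0) (at 0)"
      using ext[OF cd(2,1,3)] \<delta>(1) sH ends H0 inK(1)
      unfolding length_extremal_def B_def by blast
    moreover
    \<comment> \<open>The lifted variation read back in the chart. It agrees with \<open>h\<close>
      on \<open>B\<close> but need not do so where \<open>h\<close> leaves the chart image.\<close>
    define k where "k = chart_map \<kappa> \<circ> H"
    have kh: "k z = h z" if "z \<in> B" for z using im[OF that] by (simp add: k_def H_def)
    have sk: "smooth_on B k" using smooth_on_cong[OF B(1) kh] smooth_on_subset[OF sh BJ] by simp
    have kt: "frechet_derivative k (at z) = frechet_derivative h (at z)" if "z \<in> B" for z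
      by (rule frechet_derivative_transform_within_open[OF smooth_on_differentiable[OF sk that] B(1) that kh])
    have "((\<lambda>s. curve_length \<A> F c0 d0 (\<lambda>t. H (s, t))) has_real_derivative
     - integral {c0..d0} (\<lambda>t. \<Sum>i\<in>UNIV. EL (k (0, t)) (frechet_derivative k (at (0, t)) (0, 1))
         (frechet_derivative (\<lambda>z. frechet_derivative k (at z) (0, 1)) (at (0, t)) (0, 1)) i
         * frechet_derivative k (at (0, t)) (1, 0) $ i)) (at 0)"
      unfolding k_def
    proof (rule curve_length_variation[OF \<kappa>(1) \<delta>(1) cd(1), folded B_def, OF sH])
      show "H z \<in> chart_dom \<kappa>" if "z \<in> B" for z
        using im[OF that] by (simp add: H_def chart_inv_in_dom)
      show "frechet_derivative (chart_map \<kappa> \<circ> H) (at z) (0, 1) \<noteq> 0" if "z \<in> B" for z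
        using kt[OF that] B that by (auto simp: W_def ht_def k_def)
      show "H (s, c0) = H (0, c0) \<and> H (s, d0) = H (0, d0)" for s
        using ends by simp
    qed
    ultimately have int0: "integral {c0..d0} (\<lambda>t. \<Sum>i\<in>UNIV. EL (k (0, t)) (frechet_derivative k (at (0, t)) (0, 1))
         (frechet_derivative (\<lambda>z. frechet_derivative k (at z) (0, 1)) (at (0, t)) (0, 1)) i
         * frechet_derivative k (at (0, t)) (1, 0) $ i) = 0"
      using DERIV_unique by fastforce
    have eq: "(\<Sum>i\<in>UNIV. EL (k (0, s)) (frechet_derivative k (at (0, s)) (0, 1))
         (frechet_derivative (\<lambda>z. frechet_derivative k (at z) (0, 1)) (at (0, s)) (0, 1)) i
         * frechet_derivative k (at (0, s)) (1, 0) $ i) = \<phi> s * (E s \<bullet> v)" if s: "s \<in> {c0..d0}" for s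
    proof -
      have sB: "s \<in> {c0 - \<delta><..<d0 + \<delta>}" using s \<delta>(1) by auto
      have zB: "(0, s) \<in> B" using sB \<delta>(1) by (auto simp: B_def)
      have center: "(0, s) \<in> B \<and> k (0, s) = c s" if "s \<in> {c0 - \<delta><..<d0 + \<delta>}" for s
        using that \<delta>(1) kh[of "(0, s)"] by (auto simp: B_def h0)
      have 1: "frechet_derivative k (at (0, s)) (0, 1) = c' s"
        "frechet_derivative (\<lambda>z. frechet_derivative k (at z) (0, 1)) (at (0, s)) (0, 1) = c'' s"
        unfolding c''_def c'_def[abs_def]
        using variation_center[OF sk open_greaterThanLessThan center sB] by simp_all
      have "((\<lambda>\<sigma>. h (\<sigma>, s)) has_vector_derivative \<phi> s *\<^sub>R v) (at 0)"
        unfolding h_def by (auto intro!: derivative_eq_intros)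
      moreover have "((\<lambda>\<sigma>. h (\<sigma>, s)) has_vector_derivative frechet_derivative k (at (0, s)) (1, 0)) (at 0)"
        unfolding kt[OF zB] by (rule has_derivative_slices(1)[OF sh]) (use inK(1)[OF s] in auto)
      ultimately have 2: "frechet_derivative k (at (0, s)) (1, 0) = \<phi> s *\<^sub>R v"
        by (metis vector_derivative_unique_at)
      show ?thesis
        unfolding 1 2 using center[OF sB] by (simp add: inner_vec_def E_def sum_distrib_left algebra_simps)
    qed
    have "integral {c0..d0} (\<lambda>s. \<phi> s * (E s \<bullet> v)) = 0"
      by (rule trans[OF integral_cong[OF eq[symmetric]] int0])
    moreover have "continuous_on {c0..d0} (\<lambda>s. \<phi> s * (E s \<bullet> v))"
      unfolding \<phi>_def
      by (intro continuous_intros continuous_on_subset[OF contE]) (use inK in auto)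
    moreover have "\<phi> s * (E s \<bullet> v) \<ge> 0" if "s \<in> {c0..d0}" for s
      using inK(2)[OF that] that by (auto simp: \<phi>_def intro!: mult_nonneg_nonneg)
    ultimately have "\<forall>s\<in>{c0..d0}. \<phi> s * (E s \<bullet> v) = 0"
      using integral_eq_0_iff[OF _ cd(1)] by blast
    \<comment> \<open>At the midpoint the weight is \<open>r * r > 0\<close> and the pairing is
      positive, which contradicts the vanishing integrand.\<close>
    moreover have "t \<in> {c0..d0}" "\<phi> t = r * r" using r by (auto simp: c0_def d0_def \<phi>_def)
    ultimately show False using inK(2)[of t] r by fastforce
  qed
  then have "EL (c t) (c' t) (c'' t) i = 0" by (simp add: E_def vec_eq_iff)
  then show ?thesis
    by (simp add: chart_EL_def Let_def c_def c'_def[abs_def] c''_def[abs_def])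
qed

text \<open>A given variation is cut down to a strip on which it stays in the chart with nonzero
  velocity; there the first variation formula has an integrand vanishing on the open interval, and
  the endpoints do not affect the integral.\<close>

lemma EL_imp_extremal:
  assumes \<gamma>: "regular_curve X \<A> I \<gamma>" and I: "open I" "{c..d} \<subseteq> I" and \<kappa>: "\<kappa> \<in> \<A>" and cd: "c < d"
    and dom: "\<And>t. t \<in> {c..d} \<Longrightarrow> \<gamma> t \<in> chart_dom \<kappa>"
    and EL: "\<And>t i. t \<in> {c<..<d} \<Longrightarrow> chart_EL \<kappa> \<gamma> t i = 0"
  shows "length_extremal X \<A> F c d \<gamma>"
  unfolding length_extremal_def
proof (intro allI impI, elim conjE)
  fix H :: "real \<times> real \<Rightarrow> 'a" and \<epsilon> :: real
  assume \<epsilon>: "0 < \<epsilon>" and H: "smooth_into X \<A> ({- \<epsilon><..<\<epsilon>} \<times> {c - \<epsilon><..<d + \<epsilon>}) H"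
    and H0: "\<forall>t\<in>{c..d}. H (0, t) = \<gamma> t" and ends: "\<forall>s\<in>{- \<epsilon><..<\<epsilon>}. H (s, c) = \<gamma> c \<and> H (s, d) = \<gamma> d"
  let ?B = "\<lambda>\<epsilon>. {- \<epsilon><..<\<epsilon>} \<times> {c - \<epsilon><..<d + \<epsilon>}"
  define k where "k = chart_map \<kappa> \<circ> H"
  define kt where "kt z = frechet_derivative k (at z) (0, 1)" for z
  define W0 where "W0 = {z \<in> ?B \<epsilon>. H z \<in> chart_dom \<kappa>}"
  have W0: "open W0"
    unfolding W0_def by (rule open_preimage[OF _ _ chart_open[OF \<kappa>]])
      (use H in \<open>auto simp: smooth_into_def intro!: open_Times\<close>)
  have sk: "smooth_on W0 k" unfolding k_def by (rule smooth_into_chart[OF H \<kappa>]) (auto simp: W0_def)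
  have skt: "smooth_on W0 kt" unfolding kt_def[abs_def] by (rule smooth_on_derivative[OF sk])
  define W where "W = W0 \<inter> kt -` (- {0})"
  have W: "open W"
    unfolding W_def by (intro continuous_open_preimage smooth_on_continuous skt W0) auto
  have in0: "(0, t) \<in> W0" if "t \<in> {c..d}" for t
    using that \<epsilon> dom[OF that] H0 by (auto simp: W0_def)
  have "kt (0, t) \<noteq> 0" if t: "t \<in> {c..d}" for t
  proof -
    \<comment> \<open>\<open>H (0, t)\<close> is known to agree with \<open>\<gamma>\<close> only on
      \<open>[c, d]\<close>, so at the endpoints the velocities must be compared through one-sided
      derivatives.\<close>
    have "((\<lambda>t. k (0, t)) has_vector_derivative kt (0, t)) (at t within cbox c d)"
      unfolding kt_def by (rule has_vector_derivative_at_within[OF has_derivative_slices(2)[OF sk in0[OF t]]])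
    then have 1: "((chart_map \<kappa> \<circ> \<gamma>) has_vector_derivative kt (0, t)) (at t within cbox c d)"
      by (rule has_vector_derivative_transform[rotated 2]) (use t H0 in \<open>auto simp: k_def\<close>)
    have "t \<in> I" using t I by auto
    then have "((chart_map \<kappa> \<circ> \<gamma>) has_vector_derivative vector_derivative (chart_map \<kappa> \<circ> \<gamma>) (at t)) (at t within cbox c d)"
      by (rule has_vector_derivative_at_within[OF regular_curve_chart(3)[OF \<gamma> I(1) \<kappa> _ dom[OF t]]])
    from vector_derivative_unique_within_closed_interval[OF cd _ 1 this] t
    show ?thesis using regular_curve_chart(5)[OF \<gamma> I(1) \<kappa> \<open>t \<in> I\<close> dom[OF t]] by simp
  qed
  then have "{0} \<times> {c..d} \<subseteq> W" using in0 by (auto simp: W_def)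
  from interval_tube[OF W this] cd obtain \<delta>' where \<delta>': "\<delta>' > 0" "?B \<delta>' \<subseteq> W" by force
  define \<delta> where "\<delta> = min \<delta>' \<epsilon>"
  have le: "\<delta> > 0" "\<delta> \<le> \<epsilon>" "\<delta> \<le> \<delta>'" using \<delta>' \<epsilon> by (auto simp: \<delta>_def)
  then have "?B \<delta> \<subseteq> ?B \<delta>'" "?B \<delta> \<subseteq> ?B \<epsilon>" by auto
  with le \<delta>' have \<delta>: "\<delta> > 0" "\<delta> \<le> \<epsilon>" "?B \<delta> \<subseteq> W" "?B \<delta> \<subseteq> ?B \<epsilon>" by blast+
  have "((\<lambda>s. curve_length \<A> F c d (\<lambda>t. H (s, t))) has_real_derivative
     - integral {c..d} (\<lambda>t. \<Sum>i\<in>UNIV. finsler_domain.EL (local_rep \<A> F \<kappa>) (k (0, t)) (kt (0, t))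
         (frechet_derivative kt (at (0, t)) (0, 1)) i * frechet_derivative k (at (0, t)) (1, 0) $ i)) (at 0)"
    unfolding kt_def[abs_def] k_def
  proof (rule curve_length_variation[OF \<kappa> \<delta>(1) cd])
    show "smooth_into X \<A> (?B \<delta>) H" by (rule smooth_into_subset[OF H \<delta>(4)])
    show "H z \<in> chart_dom \<kappa>" if "z \<in> ?B \<delta>" for z using that \<delta>(3) by (auto simp: W_def W0_def)
    show "frechet_derivative (chart_map \<kappa> \<circ> H) (at z) (0, 1) \<noteq> 0" if "z \<in> ?B \<delta>" for z
      using that \<delta>(3) by (auto simp: W_def kt_def k_def)
    show "H (s, c) = H (0, c) \<and> H (s, d) = H (0, d)" if "s \<in> {- \<delta><..<\<delta>}" for s
      using ends that \<delta>(2) \<epsilon> by auto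
  qed
  \<comment> \<open>\<open>variation_center\<close> needs agreement on an open set, available here
    in the interior; the integral over the open interval is the same.\<close>
  moreover have "integral {c..d} (\<lambda>t. \<Sum>i\<in>UNIV. finsler_domain.EL (local_rep \<A> F \<kappa>) (k (0, t)) (kt (0, t))
         (frechet_derivative kt (at (0, t)) (0, 1)) i * frechet_derivative k (at (0, t)) (1, 0) $ i) = integral {c<..<d} (\<lambda>t. 0)"
    unfolding integral_open_interval_real
  proof (rule integral_cong)
    fix t assume t: "t \<in> {c<..<d}"
    have center: "(0, s) \<in> W0 \<and> k (0, s) = (chart_map \<kappa> \<circ> \<gamma>) s" if "s \<in> {c<..<d}" for s
      using that in0[of s] H0 by (auto simp: k_def)
    have "finsler_domain.EL (local_rep \<A> F \<kappa>) (k (0, t)) (kt (0, t)) (frechet_derivative kt (at (0, t)) (0, 1)) i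
      = chart_EL \<kappa> \<gamma> t i" for i
      unfolding chart_EL_def Let_def kt_def[abs_def]
      using variation_center[OF sk open_greaterThanLessThan center t] center[OF t] by (simp add: o_def)
    then show "(\<Sum>i\<in>UNIV. finsler_domain.EL (local_rep \<A> F \<kappa>) (k (0, t)) (kt (0, t))
         (frechet_derivative kt (at (0, t)) (0, 1)) i * frechet_derivative k (at (0, t)) (1, 0) $ i) = 0"
      using EL[OF t] by simp
  qed
  ultimately show "((\<lambda>s. curve_length \<A> F c d (\<lambda>t. H (s, t))) has_real_derivative 0) (at 0)" by simp
qed

end

subsection \<open>Reversal\<close>

lemma has_vector_derivative_reflect:
  assumes "(c has_vector_derivative v) (at (k - t))"
  shows "((\<lambda>t. c (k - t)) has_vector_derivative - v) (at (t::real))"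
proof -
  have "((\<lambda>t. k - t) has_vector_derivative -1) (at t)"
    by (auto intro!: derivative_eq_intros)
  from vector_diff_chain_at[OF this assms] show ?thesis by (simp add: o_def)
qed

context finsler_manifold
begin

lemma regular_curve_reverse:
  assumes \<gamma>: "regular_curve X \<A> {a<..<b} \<gamma>"
  shows "regular_curve X \<A> {a<..<b} (\<lambda>t. \<gamma> (a + b - t))"
  unfolding regular_curve_def smooth_into_def
proof (intro conjI ballI)
  let ?I = "{a<..<b}" and ?\<rho> = "\<lambda>t. a + b - t"
  have 1: "continuous_map (top_of_set ?I) X \<gamma>" using \<gamma> by (simp add: regular_curve_def smooth_into_def)
  have 2: "continuous_map (top_of_set ?I) (top_of_set ?I) ?\<rho>"
    by (auto simp: continuous_map_in_subtopology intro!: continuous_intros)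
  show cont: "continuous_map (top_of_set ?I) X (\<lambda>t. \<gamma> (?\<rho> t))"
    using continuous_map_compose[OF 2 1] unfolding o_def .
  show "smooth_on {w \<in> ?I. \<gamma> (?\<rho> w) \<in> chart_dom \<kappa>} (chart_map \<kappa> \<circ> (\<lambda>t. \<gamma> (?\<rho> t)))" if \<kappa>: "\<kappa> \<in> \<A>" for \<kappa>
  proof -
    have op: "open {w \<in> ?I. \<gamma> (?\<rho> w) \<in> chart_dom \<kappa>}"
      by (rule open_preimage[OF cont _ chart_open[OF \<kappa>]]) auto
    have "smooth_on {w \<in> ?I. \<gamma> (?\<rho> w) \<in> chart_dom \<kappa>} (\<lambda>w. (chart_map \<kappa> \<circ> \<gamma>) (?\<rho> w))"
    proof (rule smooth_on_compose[OF regular_curve_chart(2)[OF \<gamma> _ \<kappa>] _ _ op regular_curve_chart(1)[OF \<gamma> _ \<kappa>]])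
      show "smooth_on {w \<in> ?I. \<gamma> (?\<rho> w) \<in> chart_dom \<kappa>} ?\<rho>" by (intro smooth_intros op)
    qed auto
    then show ?thesis by (simp add: o_def)
  qed
  fix t assume t: "t \<in> ?I"
  then have rt: "?\<rho> t \<in> ?I" by auto
  have "velocity \<A> (\<lambda>t. \<gamma> (?\<rho> t)) t = (\<lambda>\<kappa>. - velocity \<A> \<gamma> (?\<rho> t) \<kappa>)"
  proof
    fix \<kappa>
    show "velocity \<A> (\<lambda>t. \<gamma> (?\<rho> t)) t \<kappa> = - velocity \<A> \<gamma> (?\<rho> t) \<kappa>"
    proof (cases "\<kappa> \<in> \<A> \<and> \<gamma> (?\<rho> t) \<in> chart_dom \<kappa>")
      case True
      from has_vector_derivative_reflect[OF regular_curve_chart(3)[OF \<gamma> _ _ rt], of \<kappa>] True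
      show ?thesis by (simp add: velocity_def o_def vector_derivative_at)
    qed (auto simp: velocity_def)
  qed
  moreover have "velocity \<A> \<gamma> (?\<rho> t) \<noteq> (\<lambda>_. 0)" using \<gamma> rt by (simp add: regular_curve_def)
  ultimately show "velocity \<A> (\<lambda>t. \<gamma> (?\<rho> t)) t \<noteq> (\<lambda>_. 0)"
    by (simp add: fun_eq_iff)
qed

text \<open>Reflecting the parameter changes the sign of the first derivative once and of the second
  twice, so at the reflected time the reversed curve has the same position and acceleration and the
  opposite velocity, as in \<open>EL_reverse\<close>.\<close>

lemma chart_EL_reverse:
  assumes \<gamma>: "regular_curve X \<A> {a<..<b} \<gamma>" and \<kappa>: "\<kappa> \<in> \<A>"
    and t: "t \<in> {a<..<b}" "\<gamma> (a + b - t) \<in> chart_dom \<kappa>"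
    and EL: "\<And>i. chart_EL \<kappa> \<gamma> (a + b - t) i = 0"
    and even: "CARD('n) = 1 \<or> (\<forall>x\<in>chart_image \<kappa>. \<forall>y. y \<noteq> 0 \<longrightarrow>
       (\<forall>i. spray (local_rep \<A> F \<kappa>) i x (- y) = spray (local_rep \<A> F \<kappa>) i x y))"
  shows "chart_EL \<kappa> (\<lambda>t. \<gamma> (a + b - t)) t i = 0"
proof -
  interpret finsler_domain "chart_image \<kappa>" "local_rep \<A> F \<kappa>" by (rule finsler_domain_chart[OF \<kappa>])
  let ?\<rho> = "\<lambda>t. a + b - t"
  define c where "c = chart_map \<kappa> \<circ> \<gamma>"
  define c' where "c' s = vector_derivative c (at s)" for s
  define J where "J = {s \<in> {a<..<b}. \<gamma> s \<in> chart_dom \<kappa>}"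
  note reg = regular_curve_chart[OF \<gamma> open_greaterThanLessThan \<kappa>, folded c_def J_def, folded c'_def]
  have sc': "smooth_on J c'" unfolding c'_def[abs_def] by (rule smooth_curve_derivative(2)[OF reg(1,2)])
  have tJ: "?\<rho> t \<in> J" using t by (auto simp: J_def)
  have op: "open (?\<rho> -` J)" by (rule open_vimage[OF reg(1)]) (intro continuous_intros)
  have 1: "vector_derivative (\<lambda>t. c (?\<rho> t)) (at s) = - c' (?\<rho> s)" if "s \<in> ?\<rho> -` J" for s
    using has_vector_derivative_reflect[OF reg(3)[of "?\<rho> s"]] that
    by (auto simp: J_def intro: vector_derivative_at)
  have "((\<lambda>s. - c' (?\<rho> s)) has_vector_derivative vector_derivative c' (at (?\<rho> t))) (at t)"
    using has_vector_derivative_minus[OF has_vector_derivative_reflect[OF smooth_curve_derivative(1)[OF reg(1) sc' tJ]]]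
    by simp
  then have "((\<lambda>s. vector_derivative (\<lambda>t. c (?\<rho> t)) (at s)) has_vector_derivative vector_derivative c' (at (?\<rho> t))) (at t)"
    by (rule has_vector_derivative_transform_within_open[OF _ op]) (use 1 tJ in auto)
  then have 2: "vector_derivative (\<lambda>s. vector_derivative (\<lambda>t. c (?\<rho> t)) (at s)) (at t) = vector_derivative c' (at (?\<rho> t))"
    by (rule vector_derivative_at)
  have "EL (c (?\<rho> t)) (- c' (?\<rho> t)) (vector_derivative c' (at (?\<rho> t))) i = 0"
  proof (rule EL_reverse)
    show x: "c (?\<rho> t) \<in> chart_image \<kappa>" using t by (simp add: c_def chart_map_in_image)
    show y: "c' (?\<rho> t) \<noteq> 0" using reg(5)[of "?\<rho> t"] tJ by (auto simp: J_def)
    show "EL (c (?\<rho> t)) (c' (?\<rho> t)) (vector_derivative c' (at (?\<rho> t))) h = 0" for h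
      using EL[of h] by (simp add: chart_EL_def Let_def c_def c'_def[abs_def])
    show "CARD('n) = 1 \<or> (\<forall>i. spray (local_rep \<A> F \<kappa>) i (c (?\<rho> t)) (- c' (?\<rho> t))
        = spray (local_rep \<A> F \<kappa>) i (c (?\<rho> t)) (c' (?\<rho> t)))"
      using even x y by blast
  qed
  then show ?thesis
    using 1[of t] 2 tJ by (simp add: chart_EL_def Let_def c_def o_def)
qed

text \<open>Extremality is a local condition, so one chart around
  \<open>\<gamma> (a + b - t)\<close> suffices. The Euler-Lagrange equation is needed on a whole
  interval there, hence extremality is used at every nearby parameter, each with its own
  radius.\<close>

lemma geodesic_reverse:
  assumes geo: "geodesic X \<A> F {a<..<b} \<gamma>"
    and even: "\<And>\<kappa>. \<kappa> \<in> \<A> \<Longrightarrow> CARD('n) = 1 \<or> (\<forall>x\<in>chart_image \<kappa>. \<forall>y. y \<noteq> 0 \<longrightarrow>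
       (\<forall>i. spray (local_rep \<A> F \<kappa>) i x (- y) = spray (local_rep \<A> F \<kappa>) i x y))"
  shows "geodesic X \<A> F {a<..<b} (\<lambda>t. \<gamma> (a + b - t))"
proof -
  let ?I = "{a<..<b}" and ?\<rho> = "\<lambda>t. a + b - t"
  have \<gamma>: "regular_curve X \<A> ?I \<gamma>" using geo by (simp add: geodesic_def)
  note \<gamma>' = regular_curve_reverse[OF \<gamma>]
  have "\<exists>e>0. {t - e..t + e} \<subseteq> ?I \<and>
      (\<forall>c d. t - e \<le> c \<and> c < d \<and> d \<le> t + e \<longrightarrow> length_extremal X \<A> F c d (\<lambda>t. \<gamma> (?\<rho> t)))" if t: "t \<in> ?I" for t
  proof -
    have rt: "?\<rho> t \<in> ?I" using t by auto
    have "\<gamma> \<in> ?I \<rightarrow> topspace X"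
      using \<gamma> continuous_map_image_subset_topspace[of "top_of_set ?I" X \<gamma>]
      by (auto simp: regular_curve_def smooth_into_def)
    then obtain \<kappa> where \<kappa>: "\<kappa> \<in> \<A>" "\<gamma> (?\<rho> t) \<in> chart_dom \<kappa>" using chart_around rt by blast
    define J where "J = {s \<in> ?I. \<gamma> s \<in> chart_dom \<kappa>}"
    have "open J" unfolding J_def by (rule regular_curve_chart(1)[OF \<gamma> _ \<kappa>(1)]) auto
    moreover have "?\<rho> t \<in> J" using rt \<kappa> by (simp add: J_def)
    ultimately obtain e where e: "e > 0" "cball (?\<rho> t) e \<subseteq> J"
      using open_contains_cball by metis
    have EL: "chart_EL \<kappa> \<gamma> s i = 0" if "s \<in> J" for s i
    proof -
      have s: "s \<in> ?I" "\<gamma> s \<in> chart_dom \<kappa>" using that by (auto simp: J_def)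
      then have "\<exists>e>0. {s - e..s + e} \<subseteq> ?I \<and>
          (\<forall>c d. s - e \<le> c \<and> c < d \<and> d \<le> s + e \<longrightarrow> length_extremal X \<A> F c d \<gamma>)"
        using geo by (simp add: geodesic_def)
      then obtain e where e: "e > 0" "\<forall>c d. s - e \<le> c \<and> c < d \<and> d \<le> s + e \<longrightarrow> length_extremal X \<A> F c d \<gamma>"
        by blast
      show ?thesis
        by (rule extremal_imp_EL[OF \<gamma> open_greaterThanLessThan s(1) \<kappa>(1) s(2) e(1)]) (use e(2) in simp)
    qed
    have inJ: "?\<rho> s \<in> J" "s \<in> ?I" if "s \<in> {t - e..t + e}" for s
    proof -
      have "?\<rho> s \<in> cball (?\<rho> t) e" using that by (auto simp: dist_real_def)
      then show "?\<rho> s \<in> J" using e by auto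
      then show "s \<in> ?I" by (auto simp: J_def)
    qed
    have "length_extremal X \<A> F c d (\<lambda>t. \<gamma> (?\<rho> t))" if "t - e \<le> c" "c < d" "d \<le> t + e" for c d
    proof (rule EL_imp_extremal[OF \<gamma>' _ _ \<kappa>(1) \<open>c < d\<close>])
      have sub: "s \<in> {t - e..t + e}" if "s \<in> {c..d}" for s
        using that \<open>t - e \<le> c\<close> \<open>d \<le> t + e\<close> by auto
      show "{c..d} \<subseteq> ?I" using inJ(2) sub by blast
      show "\<gamma> (?\<rho> s) \<in> chart_dom \<kappa>" if "s \<in> {c..d}" for s
        using inJ(1)[OF sub[OF that]] by (simp add: J_def)
      show "chart_EL \<kappa> (\<lambda>t. \<gamma> (?\<rho> t)) s i = 0" if "s \<in> {c<..<d}" for s i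
      proof -
        have "s \<in> {c..d}" using that by auto
        note s = inJ[OF sub[OF this]]
        show ?thesis
          by (rule chart_EL_reverse[OF \<gamma> \<kappa>(1) s(2) _ EL[OF s(1)] even[OF \<kappa>(1)]]) (use s in \<open>auto simp: J_def\<close>)
      qed
    qed auto
    then show ?thesis using e(1) inJ(2) by (intro exI[of _ e]) blast
  qed
  then show ?thesis unfolding geodesic_def using \<gamma>' by blast
qed

end

theorem theorem2:
  fixes X :: "'a topology" and \<A> :: "('a, 'n::finite) chart set"
    and F :: "'a \<times> ('a, 'n) tvec \<Rightarrow> real"
    and \<gamma> :: "real \<Rightarrow> 'a" and a b :: real
  assumes "smooth_manifold X \<A>" and "connected_space X"
    and "finsler_structure X \<A> F"
    and "forward_complete X \<A> F" and "backward_complete X \<A> F"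
    and "ricci_negative_definite \<A> F"
    and "ricci_parallel berwald_coeff \<A> F \<or> ricci_parallel chern_coeff \<A> F"
    and "a < b" and "geodesic X \<A> F {a<..<b} \<gamma>"
  shows "geodesic X \<A> F {a<..<b} (\<lambda>t. \<gamma> (a + b - t))"
proof -
  interpret finsler_manifold X \<A> F using assms(1,3) by unfold_locales
  show ?thesis
  proof (rule geodesic_reverse[OF assms(9)])
    fix \<kappa> assume \<kappa>: "\<kappa> \<in> \<A>"
    let ?f = "local_rep \<A> F \<kappa>"
    interpret finsler_domain "chart_image \<kappa>" ?f by (rule finsler_domain_chart[OF \<kappa>])
    \<comment> \<open>Both alternatives supply a coefficient family to which
      \<open>spray_even\<close> applies, so the case distinction ends here.\<close>
    obtain C where C: "ricci_parallel C \<A> F" "spray_connection (C ?f)"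
      using assms(7) spray_connection_berwald spray_connection_chern by blast
    have "spray ?f i x (- y) = spray ?f i x y"
      if "CARD('n) \<noteq> 1" "x \<in> chart_image \<kappa>" "y \<noteq> 0" for x y i
      by (rule spray_even[OF C(2) that(1) _ _ _ that(2,3)])
        (use assms(6) C(1) \<kappa> in \<open>auto simp: ricci_negative_definite_def ricci_parallel_def Let_def\<close>)
    then show "CARD('n) = 1 \<or> (\<forall>x\<in>chart_image \<kappa>. \<forall>y. y \<noteq> 0 \<longrightarrow>
       (\<forall>i. spray ?f i x (- y) = spray ?f i x y))" by blast
  qed
qed

end
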